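(* Let $n,k\in\mathbb{N}$ and $p\in[1,\infty]$. 1. Let $X$ be a continuous $p$-radial random vector in $\mathbb{R}^n$ such that $$\sqrt{n}\,\bigl(1-\|X\|_p\bigr)\longrightarrow 0\quad\text{in probability, as }n\to\infty .$$ Fix a $k$-tuple $(q_1,\ldots,q_k)\in([1,\infty)\setminus\{p\})^k$. Then, as $n\to\infty$, the following multivariate central limit theorem holds: $$\sqrt{n}\Bigl(n^{1/p-1/q_1}\frac{\|X\|_{q_1}}{m_{p,q_1}}-1,\ \ldots,\ n^{1/p-1/q_k}\frac{\|X\|_{q_k}}{m_{p,q_k}}-1\Bigr)\longrightarrow N\quad\text{in distribution},$$ where $N=(N_1,\ldots,N_k)$ is a centred Gaussian random vector with covariance matrix $\Sigma=(c_{i,j})_{i,j=1}^k$ whose entries are $$c_{i,j}=\begin{cases}\dfrac{1}{q_iq_j}\left(\dfrac{\Gamma(\frac1p)\,\Gamma(\frac{q_i+q_j+1}{p})}{\Gamma(\frac{q_i+1}{p})\,\Gamma(\frac{q_j+1}{p})}-1\right)-\dfrac1p & \text{if } p<\infty,\\[3mm] \dfrac{1}{q_i+q_j+1} & \text{if } p=\infty.\end{cases}$$ 2. Let $X\sim\nu_p^n$. If $p<\infty$, then, as $n\to\infty$, the following non-central limit theorem holds: $$\frac{n^{1/p}}{(p\log n)^{1/p-1}}\,\|X\|_\infty-A_n^{(p)}\longrightarrow G\quad\text{in distribution},$$ where $$A_n^{(p)}:=p\log n-\frac{1-p}{p}\log(p\log n)+\log\bigl(p^{1/p}\,\Gamma(1+1/p)\bigr)$$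 and $G$ is a Gumbel random variable with distribution function $t\mapsto e^{-e^{-t}}$, $t\in\mathbb{R}$.
   Context: For $x\in\mathbb{R}^n$, $\|x\|_p:=(\sum_{i=1}^n|x_i|^p)^{1/p}$ if $p<\infty$ and $\|x\|_\infty:=\max_i|x_i|$; $\mathbb{B}_p^n:=\{x\in\mathbb{R}^n:\|x\|_p\le 1\}$. For $p=\infty$ the convention $1/p:=0$ is used. The vector $X$ depends on $n$ (one random vector in $\mathbb{R}^n$ for each $n$), while $k$, $p$ and the $q_i$ are fixed. A function on $\mathbb{R}^n$ is called $p$-radial if it depends on $x$ only through $\|x\|_p$; a probability measure is called $p$-radial if its distribution function is $p$-radial, and a random vector is $p$-radial if its distribution is. $\nu_p^n$ is the uniform distribution on $\mathbb{B}_p^n$, i.e. $\nu_p^n(A):=|A\cap\mathbb{B}_p^n|/|\mathbb{B}_p^n|$ for Borel $A\subseteq\mathbb{R}^n$, with $|\cdot|$ the $n$-dimensional Lebesgue measure. For $q\in[1,\infty)$, $m_{p,q}:=M_p(q)^{1/q}$, where $M_p(q):=\frac{p^{q/p}}{q+1}\frac{\Gamma(1+\frac{q+1}{p})}{\Gamma(1+\frac1p)}$ if $p<\infty$ and $M_\infty(q):=\frac{1}{q+1}$; this is the $q$-th absolute moment of a random variable with density $f_p(x)=\frac{1}{2p^{1/p}\Gamma(1+1/p)}e^{-|x|^p/p}$ (for $p<\infty$), respectively of a uniform random variable on $[-1,1]$ (for $p=\infty$).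
   Formalization: In part 2 the last two terms of A_n have the opposite signs: A_n = p log n + ((1-p)/p) log(p log n) - log(p^{1/p} Γ(1+1/p)); as printed the limit fails for every finite p ≠ 1. "Distribution function" of the continuous p-radial X is read as its Lebesgue density. *)

theory Defs
  imports "HOL-Probability.Probability"
begin

section \<open>Vectors in \<open>\<real>\<^sup>n\<close> for varying \<open>n\<close>\<close>

text \<open>The dimension \<open>n\<close> tends to infinity, so \<open>\<real>\<^sup>n\<close> is the space of the product measure below:
  functions on \<open>{..<n}\<close>, extended by \<open>undefined\<close>. Its sets are the Borel sets.\<close>

definition lborel_n :: "nat \<Rightarrow> (nat \<Rightarrow> real) measure"
  where "lborel_n n = (\<Pi>\<^sub>M i\<in>{..<n}. lborel)"

text \<open>Exponents range over \<^typ>\<open>ereal\<close>; only \<open>1 \<le> p \<le> \<infinity>\<close> and \<open>n \<ge> 1\<close> are meaningful.\<close>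

definition lp_norm :: "nat \<Rightarrow> ereal \<Rightarrow> (nat \<Rightarrow> real) \<Rightarrow> real"
  where "lp_norm n p x =
    (if p = \<infinity> then MAX i\<in>{..<n}. \<bar>x i\<bar>
     else (\<Sum>i<n. \<bar>x i\<bar> powr real_of_ereal p) powr (1 / real_of_ereal p))"

definition lp_ball :: "nat \<Rightarrow> ereal \<Rightarrow> (nat \<Rightarrow> real) set"
  where "lp_ball n p = {x \<in> space (lborel_n n). lp_norm n p x \<le> 1}"

text \<open>The measure \<open>\<nu>\<^sub>p\<^sup>n\<close>.\<close>

definition unif_lp_ball :: "nat \<Rightarrow> ereal \<Rightarrow> (nat \<Rightarrow> real) measure"
  where "unif_lp_ball n p = uniform_measure (lborel_n n) (lp_ball n p)"

section \<open>\<open>p\<close>-radial random vectors\<close>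

definition p_radial_fun :: "nat \<Rightarrow> ereal \<Rightarrow> ((nat \<Rightarrow> real) \<Rightarrow> 'b) \<Rightarrow> bool"
  where "p_radial_fun n p f \<longleftrightarrow> (\<exists>g. \<forall>x\<in>space (lborel_n n). f x = g (lp_norm n p x))"

text \<open>``Distribution function'' of a continuous random vector means its Lebesgue density here:
  a cumulative distribution function on \<open>\<real>\<^sup>n\<close> is never a function of \<open>\<parallel>x\<parallel>\<^sub>p\<close>, because it tends
  to 0 and to 1 along \<open>(-t, \<dots>, -t)\<close> and \<open>(t, \<dots>, t)\<close>. Densities being unique only up to null
  sets, it is required that some version of the density is \<open>p\<close>-radial.\<close>

definition continuous_p_radial ::
    "nat \<Rightarrow> ereal \<Rightarrow> 'a measure \<Rightarrow> ('a \<Rightarrow> nat \<Rightarrow> real) \<Rightarrow> bool"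
  where "continuous_p_radial n p M X \<longleftrightarrow>
    (\<exists>f. distributed M (lborel_n n) X f \<and> p_radial_fun n p f)"

section \<open>Modes of convergence\<close>

text \<open>The \<open>n\<close>-th random variable may live on its own probability space \<open>M n\<close>.\<close>

definition tends_to_zero_in_probability ::
    "(nat \<Rightarrow> 'a measure) \<Rightarrow> (nat \<Rightarrow> 'a \<Rightarrow> real) \<Rightarrow> bool"
  where "tends_to_zero_in_probability M Y \<longleftrightarrow>
    (\<forall>\<epsilon>>0. (\<lambda>n. measure (M n) {\<omega> \<in> space (M n). \<bar>Y n \<omega>\<bar> > \<epsilon>}) \<longlonglongrightarrow> 0)"

text \<open>Weak convergence of laws on a general space, tested on bounded continuous functions
  (the library's \<^const>\<open>weak_conv_m\<close> is confined to the real line).\<close>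

definition converges_weakly ::
    "(nat \<Rightarrow> 'a::topological_space measure) \<Rightarrow> 'a measure \<Rightarrow> bool"
  where "converges_weakly \<mu> N \<longleftrightarrow>
    (\<forall>f :: 'a \<Rightarrow> real. continuous_on UNIV f \<and> bounded (range f) \<longrightarrow>
      (\<lambda>n. \<integral>x. f x \<partial>\<mu> n) \<longlonglongrightarrow> (\<integral>x. f x \<partial>N))"

section \<open>The limit laws\<close>

text \<open>A covariance matrix may be singular (for instance when the exponents \<open>q\<^sub>i\<close> are not distinct),
  so a Gaussian vector is defined through its one-dimensional projections, with point masses
  as degenerate normal laws.\<close>

definition normal_law :: "real \<Rightarrow> real \<Rightarrow> real measure"
  where "normal_law m \<sigma> =
    (if \<sigma> = 0 then return borel m else density lborel (\<lambda>x. ennreal (normal_density m \<sigma> x)))"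

definition gaussian_vector :: "(real ^ 'k) measure \<Rightarrow> bool"
  where "gaussian_vector N \<longleftrightarrow> prob_space N \<and> sets N = sets borel \<and>
    (\<forall>u. \<exists>m. \<exists>\<sigma>\<ge>0. distr N borel (\<lambda>x. u \<bullet> x) = normal_law m \<sigma>)"

definition centred_gaussian_vector :: "(real ^ 'k) measure \<Rightarrow> real ^ 'k ^ 'k \<Rightarrow> bool"
  where "centred_gaussian_vector N S \<longleftrightarrow> gaussian_vector N \<and>
    (\<forall>i. (\<integral>x. x $ i \<partial>N) = 0) \<and>
    (\<forall>i j. (\<integral>x. x $ i * x $ j \<partial>N) = S $ i $ j)"

definition gumbel :: "real measure"
  where "gumbel = interval_measure (\<lambda>t. exp (- exp (- t)))"

lemma
  shows real_distribution_gumbel: "real_distribution gumbel"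
    and cdf_gumbel: "cdf gumbel = (\<lambda>t. exp (- exp (- t)))"
proof -
  let ?F = "\<lambda>t::real. exp (- exp (- t))"
  have mono: "?F x \<le> ?F y" if "x \<le> y" for x y
    using that by simp
  have cont: "continuous (at_right a) ?F" for a
    by (intro continuous_intros)
  have bot: "(?F \<longlongrightarrow> 0) at_bot"
    by (intro filterlim_compose[OF exp_at_bot]
        filterlim_compose[OF filterlim_uminus_at_bot_at_top]
        filterlim_compose[OF exp_at_top] filterlim_uminus_at_top_at_bot)
  have "(?F \<longlongrightarrow> exp (- 0)) at_top"
    by (intro tendsto_intros filterlim_compose[OF exp_at_bot] filterlim_uminus_at_bot_at_top)
  then have top: "(?F \<longlongrightarrow> 1) at_top"
    by simp
  show "real_distribution gumbel"
    unfolding gumbel_def by (intro real_distribution_interval_measure mono cont bot top)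
  show "cdf gumbel = ?F"
    unfolding gumbel_def by (intro cdf_interval_measure mono cont bot)
qed

section \<open>Constants\<close>

text \<open>Since \<open>1 / \<infinity> = 0\<close> in \<^typ>\<open>ereal\<close>, this realises the convention \<open>1/p = 0\<close> for \<open>p = \<infinity>\<close>.\<close>

definition recip :: "ereal \<Rightarrow> real"
  where "recip p = real_of_ereal (1 / p)"

definition abs_moment :: "ereal \<Rightarrow> real \<Rightarrow> real"
  where "abs_moment p q =
    (if p = \<infinity> then 1 / (q + 1)
     else let r = real_of_ereal p in
       r powr (q / r) / (q + 1) * (Gamma (1 + (q + 1) / r) / Gamma (1 + 1 / r)))"

definition m_const :: "ereal \<Rightarrow> real \<Rightarrow> real"
  where "m_const p q = abs_moment p q powr (1 / q)"

definition clt_cov :: "ereal \<Rightarrow> real ^ 'k \<Rightarrow> real ^ 'k ^ 'k"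
  where "clt_cov p q = (\<chi> i j.
    if p = \<infinity> then 1 / (q $ i + q $ j + 1)
    else let r = real_of_ereal p in
      1 / (q $ i * q $ j) *
        (Gamma (1 / r) * Gamma ((q $ i + q $ j + 1) / r) /
          (Gamma ((q $ i + 1) / r) * Gamma ((q $ j + 1) / r)) - 1)
      - 1 / r)"

text \<open>The centring sequence \<open>A\<^sub>n\<close> is normalised so that the non-central limit is the standard Gumbel law.
  With \<open>Z\<close> of density \<open>f\<^sub>p\<close> and \<open>c = p\<^bsup>1/p\<^esup> \<Gamma>(1 + 1/p)\<close> one has
  \<open>P(\<bar>Z\<bar> > x) \<sim> x\<^bsup>1-p\<^esup> exp (- x\<^bsup>p\<^esup>/p) / c\<close>. Putting \<open>L = p log n\<close> and
  \<open>x = L\<^bsup>1/p-1\<^esup> (L + s)\<close>, this gives \<open>n P(\<bar>Z\<bar> > x) \<sim> L\<^bsup>(1-p)/p\<^esup> e\<^bsup>-s\<^esup> / c\<close>, which equals \<open>e\<^bsup>-t\<^esup>\<close>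
  exactly for \<open>s = t + (1-p)/p log L - log c\<close>. The source prints the two correction terms with the
  opposite signs, \<open>- (1-p)/p log L + log c\<close>; these agree for \<open>p = 1\<close>, where both terms vanish,
  but for \<open>p \<noteq> 1\<close> the printed centring is off by an unbounded amount and there is no limit law.\<close>

definition gumbel_centring :: "real \<Rightarrow> nat \<Rightarrow> real"
  where "gumbel_centring p n =
    p * ln (real n) + (1 - p) / p * ln (p * ln (real n)) - ln (p powr (1 / p) * Gamma (1 + 1 / p))"

end

theory Submission
  imports Defs "HOL-Real_Asymp.Real_Asymp"
begin

text \<open>Why the two limit theorems hold. A \<open>p\<close>-radial vector \<open>X\<close> is the product of its radius \<open>\<parallel>X\<parallel>\<^sub>p\<close> and its
direction \<open>X / \<parallel>X\<parallel>\<^sub>p\<close>, and the law of the direction is the same for every \<open>p\<close>-radial density: if \<open>A\<close> is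
a cone, then the volume of \<open>{x \<in> A. \<parallel>x\<parallel>\<^sub>p \<le> r}\<close> is \<open>r\<^sup>n\<close> times a constant depending on \<open>A\<close>, so that every
\<open>p\<close>-radial density gives \<open>A\<close> the share that \<open>A\<close> has in the volume of the unit ball
(\<open>emeasure_cone_p_radial\<close>). Hence in a scale-invariant function of the vector, \<open>X\<close> may be replaced by a
vector \<open>Z\<close> with independent coordinates of density \<open>f\<^sub>p\<close>, because the product of these densities is
\<open>p\<close>-radial (\<open>p_radial_law\<close>).

For the central limit theorem, \<open>n\<^bsup>-1/q\<^esup> \<parallel>Z\<parallel>\<^sub>q / m\<close> is the \<open>q\<close>-th root of a mean of independent variables,
and \<open>\<parallel>Z\<parallel>\<^sub>p\<close> is treated in the same way. By the delta method, \<open>\<parallel>Z\<parallel>\<^sub>q / \<parallel>Z\<parallel>\<^sub>p\<close> fluctuates like a normalized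
sum of the scores \<open>(\<bar>z\<bar>\<^sup>q / M(q) - 1) / q - (\<bar>z\<bar>\<^sup>p - 1) / p\<close> of the coordinates
(\<open>angular_fluct_linearize\<close>); for \<open>p = \<infinity>\<close> the second term is absent, since a maximum of \<open>n\<close> uniform variables
differs from 1 only by the order \<open>1/n\<close>. The matrix \<open>\<Sigma>\<close> consists of the covariances of these scores
(\<open>angular_score_covariance\<close>), so it is positive semidefinite and is the covariance matrix of a Gaussian
vector. The one-dimensional central limit theorem for linear combinations of the scores gives convergence
of the characteristic functions. Multiplication by the radius changes nothing, because
\<open>\<surd>n (1 - \<parallel>X\<parallel>\<^sub>p)\<close> tends to 0. Convergence of characteristic functions and tightness together give weak
convergence in several dimensions (\<open>converges_weaklyI_char\<close>).

For the Gumbel law, the tail estimate \<open>P(\<bar>Z\<^sub>1\<bar> > x) \<sim> x\<^bsup>1-p\<^esup> exp (- x\<^sup>p/p) / c\<close> shows that \<open>n P(\<bar>Z\<^sub>1\<bar> > x\<^sub>n)\<close>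
tends to \<open>exp (- t)\<close> at the level \<open>x\<^sub>n\<close> belonging to \<open>t\<close>, so the maximum of the independent variables stays
below \<open>x\<^sub>n\<close> with probability \<open>(1 - P(\<bar>Z\<^sub>1\<bar> > x\<^sub>n))\<^sup>n \<rightarrow> exp (- exp (- t))\<close> (\<open>gen_normal_max_gumbel\<close>). The division by
\<open>\<parallel>Z\<parallel>\<^sub>p\<close> and the multiplication by the radius of the uniform point are perturbations of relative order at most
\<open>1/\<surd>n\<close>, while the centring sequence only grows like \<open>log n\<close>.\<close>

section \<open>Weak convergence from characteristic functions\<close>

text \<open>Trigonometric polynomials with complex coefficients: the functions whose integral is a finite combination
of values of the characteristic function.\<close>

inductive trig_poly :: "('a::euclidean_space \<Rightarrow> complex) \<Rightarrow> bool" where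
  exp: "trig_poly (\<lambda>x. c * iexp (u \<bullet> x))"
| add: "trig_poly f \<Longrightarrow> trig_poly g \<Longrightarrow> trig_poly (\<lambda>x. f x + g x)"

lemma trig_poly_mult:
  assumes "trig_poly f" "trig_poly g"
  shows "trig_poly (\<lambda>x. f x * g x)"
  using assms
proof (induction f rule: trig_poly.induct)
  case (exp c u)
  from exp.prems show ?case
  proof (induction g rule: trig_poly.induct)
    case (exp d v)
    have "(\<lambda>x. c * iexp (u \<bullet> x) * (d * iexp (v \<bullet> x))) = (\<lambda>x. (c * d) * iexp ((u + v) \<bullet> x))"
      by (auto simp: fun_eq_iff inner_add_left exp_add algebra_simps)
    then show ?case using trig_poly.exp[of "c * d" "u + v"] by simp
  next
    case (add f g)
    then show ?case using trig_poly.add by (simp add: distrib_left)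
  qed
next
  case (add f1 f2)
  then show ?case using trig_poly.add by (simp add: distrib_right)
qed

lemma trig_poly_sum:
  assumes "finite I" "\<And>i. i \<in> I \<Longrightarrow> trig_poly (f i)"
  shows "trig_poly (\<lambda>x. \<Sum>i\<in>I. f i x)"
  using assms
proof (induction rule: finite_induct)
  case empty
  show ?case using trig_poly.exp[of 0 0] by simp
next
  case (insert i I)
  then show ?case using trig_poly.add by auto
qed

lemma trig_poly_const: "trig_poly (\<lambda>x. c)"
  using trig_poly.exp[of c 0] by simp

lemma trig_poly_sin: "trig_poly (\<lambda>x. complex_of_real (sin (u \<bullet> x)))"
proof -
  have "(\<lambda>x. complex_of_real (sin (u \<bullet> x))) =
      (\<lambda>x. (1 / (2 * \<i>)) * iexp (u \<bullet> x) + (- 1 / (2 * \<i>)) * iexp ((- u) \<bullet> x))"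
    by (auto simp: fun_eq_iff sin_of_real[symmetric] sin_exp_eq field_simps)
  then show ?thesis
    by (simp only: trig_poly.add[OF trig_poly.exp trig_poly.exp])
qed

lemma trig_poly_polynomial_sin:
  fixes g :: "'a::euclidean_space \<Rightarrow> real"
  assumes "real_polynomial_function g"
  shows "trig_poly (\<lambda>x. complex_of_real (g (\<Sum>b\<in>Basis. sin (w * (x \<bullet> b)) *\<^sub>R b)))"
  using assms
proof (induction rule: real_polynomial_function.induct)
  case (linear g)
  then interpret g: bounded_linear g .
  have "trig_poly (\<lambda>x. \<Sum>b\<in>Basis. complex_of_real (g b) * of_real (sin ((w *\<^sub>R b) \<bullet> x)))"
    by (intro trig_poly_sum trig_poly_mult trig_poly_const trig_poly_sin) simp
  then show ?case
    by (simp add: g.sum g.scaleR inner_commute mult_ac)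
next
  case (const c)
  then show ?case by (rule trig_poly_const)
next
  case (add f g)
  then show ?case using trig_poly.add by auto
next
  case (mult f g)
  then show ?case using trig_poly_mult by auto
qed

lemma trig_poly_integral_tendsto:
  fixes \<mu> :: "nat \<Rightarrow> 'a::euclidean_space measure"
  assumes "\<forall>\<^sub>F n in sequentially. prob_space (\<mu> n) \<and> sets (\<mu> n) = sets borel"
    and "prob_space N" "sets N = sets borel"
    and char: "\<And>u. (\<lambda>n. \<integral>x. iexp (u \<bullet> x) \<partial>\<mu> n) \<longlonglongrightarrow> (\<integral>x. iexp (u \<bullet> x) \<partial>N)"
    and "trig_poly h"
  shows "(\<lambda>n. \<integral>x. h x \<partial>\<mu> n) \<longlonglongrightarrow> (\<integral>x. h x \<partial>N)"
    and "integrable N h"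
    and "\<forall>\<^sub>F n in sequentially. integrable (\<mu> n) h"
proof -
  have int: "integrable P (\<lambda>x. c * iexp (u \<bullet> x))"
    if "prob_space P" "sets P = sets borel" for P :: "'a measure" and c u
  proof -
    interpret prob_space P by fact
    note [measurable_cong] = that(2)
    show ?thesis
      by (intro integrable_mult_right integrable_const_bound[of _ 1]) auto
  qed
  have "(\<lambda>n. \<integral>x. h x \<partial>\<mu> n) \<longlonglongrightarrow> (\<integral>x. h x \<partial>N) \<and> integrable N h \<and>
    (\<forall>\<^sub>F n in sequentially. integrable (\<mu> n) h)"
    using \<open>trig_poly h\<close>
  proof induction
    case (exp c u)
    have "(\<lambda>n. c * (\<integral>x. iexp (u \<bullet> x) \<partial>\<mu> n)) \<longlonglongrightarrow> c * (\<integral>x. iexp (u \<bullet> x) \<partial>N)"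
      by (intro tendsto_intros char)
    then show ?case using assms(1-3) int by (auto elim!: eventually_mono)
  next
    case (add f g)
    have ev: "\<forall>\<^sub>F n in sequentially. integrable (\<mu> n) f \<and> integrable (\<mu> n) g"
      using add.IH by (auto intro: eventually_conj)
    have "(\<lambda>n. (\<integral>x. f x \<partial>\<mu> n) + (\<integral>x. g x \<partial>\<mu> n)) \<longlonglongrightarrow> (\<integral>x. f x \<partial>N) + (\<integral>x. g x \<partial>N)"
      using add.IH by (intro tendsto_add) auto
    then have "(\<lambda>n. \<integral>x. f x + g x \<partial>\<mu> n) \<longlonglongrightarrow> (\<integral>x. f x \<partial>N) + (\<integral>x. g x \<partial>N)"
      by (rule Lim_transform_eventually) (use ev in \<open>auto elim!: eventually_mono\<close>)
    then show ?case using add.IH ev by (auto elim!: eventually_mono)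
  qed
  then show "(\<lambda>n. \<integral>x. h x \<partial>\<mu> n) \<longlonglongrightarrow> (\<integral>x. h x \<partial>N)" "integrable N h"
    "\<forall>\<^sub>F n in sequentially. integrable (\<mu> n) h" by auto
qed

text \<open>With \<open>w = \<pi> / (2 K)\<close>, the map taking the coordinates \<open>x\<^sub>b\<close> to \<open>sin (w x\<^sub>b)\<close> sends the whole space into the cube
\<open>[-1, 1]\<^sup>d\<close>, and on the part where all \<open>\<bar>x\<^sub>b\<bar> \<le> K\<close> it is inverted by \<open>arcsin\<close>. So \<open>f\<close> induces a continuous
function on the cube, and the Stone-Weierstrass theorem approximates it there by a polynomial. Since the
sines never leave the cube, the resulting trigonometric polynomial is bounded everywhere, not only where
it approximates \<open>f\<close>.\<close>

lemma trig_poly_approximation: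
  fixes f :: "'a::euclidean_space \<Rightarrow> real"
  assumes f: "continuous_on UNIV f" and bound: "\<And>x. \<bar>f x\<bar> \<le> B" and "0 < K" "0 < e"
  obtains h where "trig_poly (\<lambda>x. complex_of_real (h x))" "\<And>x. \<bar>h x\<bar> \<le> B + e"
    "\<And>x. (\<And>b. b \<in> Basis \<Longrightarrow> \<bar>x \<bullet> b\<bar> \<le> K) \<Longrightarrow> \<bar>f x - h x\<bar> < e"
proof -
  define w where "w = pi / (2 * K)"
  have w: "w > 0" using \<open>0 < K\<close> by (simp add: w_def)
  define C :: "'a set" where "C = cbox (- One) One"
  have C: "y \<bullet> b \<in> {-1..1}" if "y \<in> C" "b \<in> Basis" for y b
    using that by (auto simp: C_def mem_box)
  \<comment> \<open>\<open>f\<close> in the coordinates \<open>y\<^sub>b = sin (w x\<^sub>b)\<close>\<close>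
  define F where "F y = f (\<Sum>b\<in>Basis. (arcsin (y \<bullet> b) / w) *\<^sub>R b)" for y
  have "continuous_on C F"
    unfolding F_def
    by (intro continuous_on_compose2[OF f] continuous_intros) (use w C in fastforce)+
  then obtain g where g: "real_polynomial_function g" "\<And>y. y \<in> C \<Longrightarrow> \<bar>F y - g y\<bar> < e"
    using Stone_Weierstrass_real_polynomial_function[of C F e] \<open>0 < e\<close> unfolding C_def by auto
  define \<theta> where "\<theta> x = (\<Sum>b\<in>Basis. sin (w * (x \<bullet> b)) *\<^sub>R b)" for x :: 'a
  have \<theta>C: "\<theta> x \<in> C" for x
    by (auto simp: \<theta>_def C_def mem_box)
  show thesis
  proof
    show "trig_poly (\<lambda>x. complex_of_real (g (\<theta> x)))"
      unfolding \<theta>_def by (rule trig_poly_polynomial_sin[OF g(1)])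
    show "\<bar>g (\<theta> x)\<bar> \<le> B + e" for x
      using g(2)[OF \<theta>C[of x]] bound[of "\<Sum>b\<in>Basis. (arcsin (\<theta> x \<bullet> b) / w) *\<^sub>R b"]
      unfolding F_def by linarith
    show "\<bar>f x - g (\<theta> x)\<bar> < e" if "\<And>b. b \<in> Basis \<Longrightarrow> \<bar>x \<bullet> b\<bar> \<le> K" for x
    proof -
      have "arcsin (\<theta> x \<bullet> b) / w = x \<bullet> b" if b: "b \<in> Basis" for b
      proof -
        have "\<bar>w * (x \<bullet> b)\<bar> \<le> w * K"
          using \<open>w > 0\<close> \<open>\<And>b. b \<in> Basis \<Longrightarrow> \<bar>x \<bullet> b\<bar> \<le> K\<close>[OF b] by (simp add: abs_mult)
        also have "w * K = pi / 2" using \<open>0 < K\<close> by (simp add: w_def)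
        finally have "arcsin (sin (w * (x \<bullet> b))) = w * (x \<bullet> b)"
          by (intro arcsin_sin) auto
        then show ?thesis using b w by (simp add: \<theta>_def)
      qed
      then have "F (\<theta> x) = f x"
        by (simp add: F_def euclidean_representation)
      then show ?thesis using g(2)[OF \<theta>C[of x]] by simp
    qed
  qed
qed

text \<open>Levy's continuity theorem, with tightness as a hypothesis. A bounded continuous function is replaced
by a bounded trigonometric polynomial that is close to it on a large ball; the mass outside of the ball is
uniformly small.\<close>

lemma converges_weaklyI_char:
  fixes \<mu> :: "nat \<Rightarrow> 'a::euclidean_space measure"
  assumes \<mu>: "\<forall>\<^sub>F n in sequentially. prob_space (\<mu> n) \<and> sets (\<mu> n) = sets borel"
    and N: "prob_space N" "sets N = sets borel"
    and char: "\<And>u. (\<lambda>n. \<integral>x. iexp (u \<bullet> x) \<partial>\<mu> n) \<longlonglongrightarrow> (\<integral>x. iexp (u \<bullet> x) \<partial>N)"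
    and tight: "\<And>e. 0 < e \<Longrightarrow> \<exists>K. \<forall>\<^sub>F n in sequentially. measure (\<mu> n) {x. norm x > K} < e"
  shows "converges_weakly \<mu> N"
  unfolding converges_weakly_def
proof (intro allI impI, elim conjE)
  fix f :: "'a \<Rightarrow> real" assume f: "continuous_on UNIV f" and "bounded (range f)"
  then obtain B where B: "\<And>x. \<bar>f x\<bar> \<le> B"
    by (auto simp: bounded_iff)
  have B0: "0 \<le> B" using B[of 0] by linarith
  have [measurable]: "f \<in> borel_measurable borel"
    using f by (rule borel_measurable_continuous_onI)
  define out where "out K = {x::'a. norm x > K}" for K
  have [measurable]: "out K \<in> sets borel" for K
    unfolding out_def by measurable
  have out_mono: "measure P (out L) \<le> measure P (out K)"
    if "prob_space P" "sets P = sets borel" "K \<le> L" for P :: "'a measure" and K L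
    using that prob_space.finite_measure[OF that(1)]
    by (intro finite_measure.finite_measure_mono) (auto simp: out_def)
  have tight_out: "\<exists>K>0. (\<forall>\<^sub>F n in sequentially. measure (\<mu> n) (out K) \<le> e) \<and> measure N (out K) \<le> e"
    if e: "0 < e" for e
  proof -
    obtain K where K: "\<forall>\<^sub>F n in sequentially. measure (\<mu> n) (out K) < e"
      using tight[OF e] by (auto simp: out_def)
    interpret N: prob_space N by fact
    have "(\<lambda>j. measure N (out (real j))) \<longlonglongrightarrow> measure N (\<Inter>j. out (real j))"
      by (intro N.finite_Lim_measure_decseq)
        (auto simp: decseq_def out_def N(2) intro: le_less_trans[OF of_nat_mono])
    also have "(\<Inter>j. out (real j)) = {}"
    proof -
      have "x \<notin> out (real (nat \<lceil>norm x\<rceil>))" for x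
        by (simp add: out_def not_less)
      then show ?thesis by blast
    qed
    finally have "(\<lambda>j. measure N (out (real j))) \<longlonglongrightarrow> 0" by simp
    from order_tendstoD(2)[OF this e] obtain j where j: "measure N (out (real j)) < e"
      by (auto dest!: eventually_happens)
    define L where "L = max 1 (max (real j) K)"
    have L: "0 < L" "real j \<le> L" "K \<le> L" by (auto simp: L_def)
    have "\<forall>\<^sub>F n in sequentially. measure (\<mu> n) (out L) \<le> e"
      using K \<mu> by eventually_elim (use out_mono[OF _ _ L(3)] in force)
    then show ?thesis using out_mono[OF N L(2)] j L(1) by (intro exI[of _ L]) auto
  qed
  have approx: "\<bar>(\<integral>x. f x \<partial>P) - (\<integral>x. h x \<partial>P)\<bar> \<le> e + (2 * B + e) * measure P (out K)"
    if P: "prob_space P" "sets P = sets borel"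
      and [measurable]: "h \<in> borel_measurable borel" and hB: "\<And>x. \<bar>h x\<bar> \<le> B + e"
      and h: "\<And>x. (\<And>b. b \<in> Basis \<Longrightarrow> \<bar>x \<bullet> b\<bar> \<le> K) \<Longrightarrow> \<bar>f x - h x\<bar> < e"
      and e: "0 < e" for P :: "'a measure" and h e K
  proof -
    interpret prob_space P by fact
    note [measurable_cong] = P(2)
    have intf: "integrable P f"
      using B by (intro integrable_const_bound[of _ B]) auto
    have inth: "integrable P h"
      using hB by (intro integrable_const_bound[of _ "B + e"]) auto
    have "\<bar>(\<integral>x. f x \<partial>P) - (\<integral>x. h x \<partial>P)\<bar> = \<bar>\<integral>x. f x - h x \<partial>P\<bar>"
      using intf inth by simp
    also have "\<dots> \<le> (\<integral>x. \<bar>f x - h x\<bar> \<partial>P)" by (rule integral_abs_bound)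
    also have "\<dots> \<le> (\<integral>x. e + (2 * B + e) * indicator (out K) x \<partial>P)"
    proof (rule integral_mono)
      show "integrable P (\<lambda>x. \<bar>f x - h x\<bar>)" using intf inth by auto
      show "integrable P (\<lambda>x. e + (2 * B + e) * indicator (out K) x)"
        by (auto simp: integrable_mult_right_iff P(2) emeasure_eq_measure intro!: integrable_mult_right)
      fix x
      show "\<bar>f x - h x\<bar> \<le> e + (2 * B + e) * indicator (out K) x"
      proof (cases "x \<in> out K")
        case True
        then show ?thesis using B[of x] hB[of x] e by simp
      next
        case False
        then show ?thesis
          using h[of x] order_trans[OF Basis_le_norm, of _ x K] by (auto simp: out_def not_less)
      qed
    qed
    also have "\<dots> = e + (2 * B + e) * measure P (out K)"
      by (subst Bochner_Integration.integral_add)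
        (auto simp: P(2) emeasure_eq_measure prob_space intro!: integrable_mult_right)
    finally show ?thesis .
  qed
  show "(\<lambda>n. \<integral>x. f x \<partial>\<mu> n) \<longlonglongrightarrow> (\<integral>x. f x \<partial>N)"
  proof (rule tendstoI)
    fix \<epsilon> :: real assume "0 < \<epsilon>"
    \<comment> \<open>The choice of \<open>e\<close> makes \<open>e + (2 B + e) e \<le> \<epsilon> / 3\<close>.\<close>
    define e where "e = min 1 (\<epsilon> / (3 * (2 * B + 2)))"
    have e: "0 < e" "e \<le> 1" using \<open>0 < \<epsilon>\<close> B0 by (auto simp: e_def)
    have eB: "(2 * B + 2) * e \<le> \<epsilon> / 3" 
    proof -
      have "(2 * B + 2) * e \<le> (2 * B + 2) * (\<epsilon> / (3 * (2 * B + 2)))"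
        using B0 by (intro mult_left_mono) (auto simp: e_def)
      also have "\<dots> = \<epsilon> / 3" using B0 by (simp add: field_simps)
      finally show ?thesis .
    qed
    have le: "e + (2 * B + e) * m \<le> \<epsilon> / 3" if "m \<le> e" "0 \<le> m" for m
    proof -
      have "e + (2 * B + e) * m \<le> e + (2 * B + 1) * e"
        using that e B0 by (intro add_left_mono mult_mono) auto
      also have "\<dots> = (2 * B + 2) * e" by (simp add: algebra_simps)
      finally show ?thesis using eB by simp
    qed
    obtain K where K: "K > 0" "\<forall>\<^sub>F n in sequentially. measure (\<mu> n) (out K) \<le> e" "measure N (out K) \<le> e"
      using tight_out[OF e(1)] by blast
    obtain h where h: "trig_poly (\<lambda>x. complex_of_real (h x))" "\<And>x. \<bar>h x\<bar> \<le> B + e"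
      "\<And>x. (\<And>b. b \<in> Basis \<Longrightarrow> \<bar>x \<bullet> b\<bar> \<le> K) \<Longrightarrow> \<bar>f x - h x\<bar> < e"
      using trig_poly_approximation[OF f B \<open>K > 0\<close> e(1)] by metis
    note lim = trig_poly_integral_tendsto[OF \<mu> N char h(1)]
    have "integrable N h" using lim(2) by (simp add: complex_of_real_integrable_eq)
    then have hm[measurable]: "h \<in> borel_measurable borel"
      using measurable_cong_sets[OF N(2) refl] by blast
    have "(\<lambda>n. \<integral>x. h x \<partial>\<mu> n) \<longlonglongrightarrow> (\<integral>x. h x \<partial>N)"
      using lim(1) by (simp add: integral_complex_of_real tendsto_of_real_iff)
    then have "\<forall>\<^sub>F n in sequentially. dist (\<integral>x. h x \<partial>\<mu> n) (\<integral>x. h x \<partial>N) < \<epsilon> / 3"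
      using \<open>0 < \<epsilon>\<close> by (intro tendstoD) auto
    then show "\<forall>\<^sub>F n in sequentially. dist (\<integral>x. f x \<partial>\<mu> n) (\<integral>x. f x \<partial>N) < \<epsilon>"
      using \<mu> K(2)
    proof eventually_elim
      case (elim n)
      have "\<bar>(\<integral>x. f x \<partial>\<mu> n) - (\<integral>x. h x \<partial>\<mu> n)\<bar> \<le> \<epsilon> / 3"
        using approx[of "\<mu> n" h e K] le elim h e hm by fastforce
      moreover have "\<bar>(\<integral>x. f x \<partial>N) - (\<integral>x. h x \<partial>N)\<bar> \<le> \<epsilon> / 3"
        using approx[of N h e K] le K(3) N h e hm by fastforce
      ultimately show ?case using elim(1) unfolding dist_real_def by linarith
    qed
  qed
qed

section \<open>Gaussian vectors with a prescribed covariance matrix\<close>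

text \<open>Induction by Schur complements: if \<open>s\<close> is the new diagonal entry, then \<open>S i j - S k i * S k j / s\<close> is again positive
semidefinite, as one sees by minimizing the quadratic form over the new variable. If \<open>s = 0\<close>, positivity
forces the whole new row to vanish, so that the same formulas hold with \<open>x / 0 = 0\<close>.\<close>

lemma positive_semidefinite_factorization:
  fixes S :: "'i \<Rightarrow> 'i \<Rightarrow> real"
  assumes "finite I" "\<And>i j. S i j = S j i"
    and "\<And>u. 0 \<le> (\<Sum>i\<in>I. \<Sum>j\<in>I. u i * u j * S i j)"
  shows "\<exists>a. \<forall>i\<in>I. \<forall>j\<in>I. S i j = (\<Sum>l\<in>I. a i l * a j l)"
  using assms
proof (induction I arbitrary: S rule: finite_induct)
  case empty
  then show ?case by simp
next
  case (insert k I)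
  define s where "s = S k k"
  note sym = insert.prems(1)
  have Q: "0 \<le> (u k)\<^sup>2 * s + 2 * u k * (\<Sum>j\<in>I. u j * S k j) + (\<Sum>i\<in>I. \<Sum>j\<in>I. u i * u j * S i j)" for u
  proof -
    have "(\<Sum>i\<in>I. u i * u k * S i k) = u k * (\<Sum>j\<in>I. u j * S k j)"
      unfolding sum_distrib_left by (intro sum.cong refl) (simp add: sym[of _ k] mult_ac)
    moreover have "(\<Sum>j\<in>I. u k * u j * S k j) = u k * (\<Sum>j\<in>I. u j * S k j)"
      unfolding sum_distrib_left by (simp add: mult_ac)
    ultimately show ?thesis
      using insert.prems(2)[of u] insert.hyps
      by (simp add: sum.distrib s_def power2_eq_square algebra_simps)
  qed
  have s0: "0 \<le> s"
  proof -
    have "0 \<le> 1 * s + 2 * 1 * (\<Sum>j\<in>I. (if j = k then 1 else 0) * S k j) +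
        (\<Sum>i\<in>I. \<Sum>j\<in>I. (if i = k then 1 else 0) * (if j = k then 1 else 0) * S i j)"
      using Q[of "\<lambda>i. if i = k then 1 else 0"] by simp
    also have "(\<Sum>j\<in>I. (if j = k then 1 else 0) * S k j) = 0"
      using insert.hyps by (intro sum.neutral) auto
    also have "(\<Sum>i\<in>I. \<Sum>j\<in>I. (if i = k then 1 else 0) * (if j = k then 1 else 0) * S i j) = 0"
      using insert.hyps by (intro sum.neutral ballI) auto
    finally show ?thesis by simp
  qed
  have null: "S k j = 0" if "s = 0" "j \<in> I" for j
  proof -
    \<comment> \<open>For this \<open>t\<close> the quadratic form would take the value \<open>-1\<close>.\<close>
    define t where "t = - (S j j + 1) / (2 * S k j)"
    define u where "u i = (if i = k then t else if i = j then 1 else 0)" for i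
    have jk: "j \<noteq> k" using that insert.hyps by auto
    have u: "u i = (if i = j then 1 else 0)" if "i \<in> I" for i
      using that insert.hyps by (auto simp: u_def)
    have "(\<Sum>i\<in>I. u i * S k i) = (\<Sum>i\<in>I. if i = j then S k i else 0)"
      by (intro sum.cong) (auto simp: u)
    also have "\<dots> = S k j" using \<open>j \<in> I\<close> insert.hyps by simp
    finally have 1: "(\<Sum>i\<in>I. u i * S k i) = S k j" .
    have "(\<Sum>i\<in>I. \<Sum>l\<in>I. u i * u l * S i l) =
        (\<Sum>i\<in>I. \<Sum>l\<in>I. if l = j then (if i = j then S i l else 0) else 0)"
      by (intro sum.cong) (auto simp: u)
    also have "\<dots> = S j j" using \<open>j \<in> I\<close> insert.hyps by simp
    finally have 2: "(\<Sum>i\<in>I. \<Sum>l\<in>I. u i * u l * S i l) = S j j" .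
    have "0 \<le> 2 * t * S k j + S j j"
      using Q[of u] by (simp add: 1 2 \<open>s = 0\<close>) (simp add: u_def)
    then show ?thesis
      by (cases "S k j = 0") (auto simp: t_def field_simps)
  qed
  define S' where "S' i j = S i j - S k i * S k j / s" for i j
  have "\<exists>a. \<forall>i\<in>I. \<forall>j\<in>I. S' i j = (\<Sum>l\<in>I. a i l * a j l)"
  proof (rule insert.IH)
    show "S' i j = S' j i" for i j by (simp add: S'_def sym[of i j] mult.commute)
    fix u :: "'i \<Rightarrow> real"
    define b where "b = (\<Sum>j\<in>I. u j * S k j)"
    have b0: "b = 0" if "s = 0" unfolding b_def using null[OF that] by simp
    define v where "v = u(k := - b / s)"
    have v: "v i = u i" if "i \<in> I" for i using that insert.hyps by (auto simp: v_def)
    have "0 \<le> (v k)\<^sup>2 * s + 2 * v k * (\<Sum>j\<in>I. v j * S k j) + (\<Sum>i\<in>I. \<Sum>j\<in>I. v i * v j * S i j)"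
      by (rule Q)
    also have "(\<Sum>j\<in>I. v j * S k j) = b" by (simp add: b_def v)
    also have "(\<Sum>i\<in>I. \<Sum>j\<in>I. v i * v j * S i j) = (\<Sum>i\<in>I. \<Sum>j\<in>I. u i * u j * S i j)"
      by (simp add: v)
    also have "(v k)\<^sup>2 * s + 2 * v k * b = - (b * b / s)"
      using b0 by (cases "s = 0") (auto simp: v_def power2_eq_square field_simps)
    finally have "0 \<le> (\<Sum>i\<in>I. \<Sum>j\<in>I. u i * u j * S i j) - b * b / s" by simp
    also have "b * b / s = (\<Sum>i\<in>I. \<Sum>j\<in>I. u i * u j * (S k i * S k j / s))"
      unfolding b_def sum_product sum_divide_distrib by (intro sum.cong) (auto simp: mult_ac)
    finally show "0 \<le> (\<Sum>i\<in>I. \<Sum>j\<in>I. u i * u j * S' i j)"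
      by (simp add: S'_def sum_subtractf algebra_simps)
  qed
  then obtain a where a: "\<And>i j. i \<in> I \<Longrightarrow> j \<in> I \<Longrightarrow> S' i j = (\<Sum>l\<in>I. a i l * a j l)"
    by blast
  define c where "c i l = (if l = k then S k i / sqrt s else if i = k then 0 else a i l)" for i l
  have prod: "S k i / sqrt s * (S k j / sqrt s) = S k i * S k j / s" for i j
    using s0 by simp
  have "S i j = (\<Sum>l\<in>insert k I. c i l * c j l)" if "i \<in> insert k I" "j \<in> insert k I" for i j
  proof -
    have "(\<Sum>l\<in>insert k I. c i l * c j l) = S k i * S k j / s + (\<Sum>l\<in>I. c i l * c j l)"
      using insert.hyps s0 by (simp add: c_def prod)
    moreover have "(\<Sum>l\<in>I. c i l * c j l) = (if i = k \<or> j = k then 0 else \<Sum>l\<in>I. a i l * a j l)"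
      using insert.hyps by (auto simp: c_def intro!: sum.neutral sum.cong)
    moreover have "S k i * S k j / s = S i j" if "i = k \<or> j = k"
      using that null sym[of i j] \<open>i \<in> insert k I\<close> \<open>j \<in> insert k I\<close>
      by (cases "s = 0") (auto simp: s_def)
    ultimately show ?thesis
      using that a[of i j] by (auto simp: S'_def)
  qed
  then show ?case by blast
qed

lemma normal_law_0_eq_distr:
  assumes "0 \<le> \<sigma>"
  shows "normal_law 0 \<sigma> = distr std_normal_distribution borel (\<lambda>x. \<sigma> * x)"
proof (cases "\<sigma> = 0")
  case True
  interpret real_distribution std_normal_distribution by (rule real_dist_normal_dist)
  have "distr std_normal_distribution borel (\<lambda>x. 0) = return borel (0::real)"
    by (rule measure_eqI) (auto simp: emeasure_distr emeasure_space_1 split: split_indicator)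
  then show ?thesis by (simp add: normal_law_def True)
next
  case False
  interpret real_distribution std_normal_distribution by (rule real_dist_normal_dist)
  have "distributed std_normal_distribution lborel (\<lambda>x. x) (normal_density 0 1)"
    by (auto simp: distributed_def distr_id2)
  from normal_density_affine[OF this, of \<sigma> 0]
  have "distributed std_normal_distribution lborel (\<lambda>x. \<sigma> * x) (normal_density 0 \<sigma>)"
    using False assms by simp
  then have "distr std_normal_distribution lborel (\<lambda>x. \<sigma> * x) = density lborel (normal_density 0 \<sigma>)"
    by (simp add: distributed_def)
  moreover have "distr std_normal_distribution lborel (\<lambda>x. \<sigma> * x) = distr std_normal_distribution borel (\<lambda>x. \<sigma> * x)"
    by (rule distr_cong) auto
  ultimately show ?thesis using False by (simp add: normal_law_def)
qed

lemma borel_measurable_vec_lambda: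
  fixes f :: "'k::finite \<Rightarrow> 'a \<Rightarrow> real"
  assumes "\<And>i. f i \<in> borel_measurable M"
  shows "(\<lambda>x. \<chi> i. f i x) \<in> borel_measurable M"
  using assms by (subst borel_measurable_euclidean_space) (auto simp: Basis_vec_def inner_axis)

text \<open>If \<open>S = A A\<^sup>T\<close> and the coordinates of \<open>g\<close> are independent standard normal variables, then \<open>A g\<close> has
covariance matrix \<open>S\<close>. This covers singular matrices, where there is no density. Projections are
identified by their characteristic functions.\<close>

lemma exists_centred_gaussian_vector:
  fixes S :: "real ^ 'k ^ 'k"
  assumes sym: "\<And>i j. S $ i $ j = S $ j $ i"
    and psd: "\<And>u. 0 \<le> (\<Sum>i\<in>UNIV. \<Sum>j\<in>UNIV. u i * u j * S $ i $ j)"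
  shows "\<exists>N. centred_gaussian_vector N S \<and> (\<forall>u. (\<integral>x. iexp (u \<bullet> x) \<partial>N) =
      exp (- complex_of_real (\<Sum>i\<in>UNIV. \<Sum>j\<in>UNIV. u $ i * u $ j * S $ i $ j) / 2))"
proof -
  have "\<exists>a :: 'k \<Rightarrow> 'k \<Rightarrow> real. \<forall>i\<in>UNIV. \<forall>j\<in>UNIV. S $ i $ j = (\<Sum>l\<in>UNIV. a i l * a j l)"
    by (rule positive_semidefinite_factorization[of UNIV "\<lambda>i j. S $ i $ j", OF finite sym psd])
  then obtain a :: "'k \<Rightarrow> 'k \<Rightarrow> real" where a: "\<And>i j. S $ i $ j = (\<Sum>l\<in>UNIV. a i l * a j l)"
    by blast
  define Q where "Q u = (\<Sum>i\<in>UNIV. \<Sum>j\<in>UNIV. u $ i * u $ j * S $ i $ j)" for u :: "real ^ 'k"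
  define b where "b u l = (\<Sum>i\<in>UNIV. u $ i * a i l)" for u :: "real ^ 'k" and l
  have Qb: "Q u = (\<Sum>l\<in>UNIV. (b u l)\<^sup>2)" for u
  proof -
    have "(\<Sum>l\<in>UNIV. (b u l)\<^sup>2) = (\<Sum>l\<in>UNIV. \<Sum>i\<in>UNIV. \<Sum>j\<in>UNIV. u $ i * u $ j * (a i l * a j l))"
      unfolding b_def power2_eq_square sum_product by (simp add: mult_ac)
    also have "\<dots> = (\<Sum>i\<in>UNIV. \<Sum>j\<in>UNIV. \<Sum>l\<in>UNIV. u $ i * u $ j * (a i l * a j l))"
      by (subst sum.swap) (intro sum.cong refl sum.swap)
    finally show ?thesis by (simp add: Q_def a sum_distrib_left)
  qed
  have Q0: "0 \<le> Q u" for u by (simp add: Qb sum_nonneg)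
  interpret st: real_distribution std_normal_distribution by (rule real_dist_normal_dist)
  define G where "G = PiM (UNIV :: 'k set) (\<lambda>_. std_normal_distribution)"
  interpret G: product_prob_space "\<lambda>_. std_normal_distribution" "UNIV :: 'k set"
    by unfold_locales
  interpret PG: prob_space G unfolding G_def by (rule G.prob_space_axioms)
  define T where "T g = (\<chi> i. \<Sum>l\<in>UNIV. a i l * g l)" for g
  have Gm: "(\<lambda>g. g l) \<in> borel_measurable G" for l
    unfolding G_def by (rule measurable_compose[OF measurable_component_singleton]) auto
  have uT: "u \<bullet> T g = (\<Sum>l\<in>UNIV. b u l * g l)" for u g
  proof -
    have "u \<bullet> T g = (\<Sum>i\<in>UNIV. \<Sum>l\<in>UNIV. u $ i * a i l * g l)"
      by (simp add: inner_vec_def T_def sum_distrib_left mult_ac)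
    also have "\<dots> = (\<Sum>l\<in>UNIV. b u l * g l)"
      by (subst sum.swap) (simp add: b_def sum_distrib_right)
    finally show ?thesis .
  qed
  have T[measurable]: "T \<in> borel_measurable G"
    unfolding T_def by (rule borel_measurable_vec_lambda) (use Gm in measurable)
  define N where "N = distr G borel T"
  interpret N: prob_space N unfolding N_def by (rule PG.prob_space_distr) simp
  have setsN[simp, measurable_cong]: "sets N = sets borel" by (simp add: N_def)
  have char: "(\<integral>x. iexp (u \<bullet> x) \<partial>N) = exp (- complex_of_real (Q u) / 2)" for u
  proof -
    have "(\<integral>x. iexp (u \<bullet> x) \<partial>N) = (\<integral>g. (\<Prod>l\<in>UNIV. iexp (b u l * g l)) \<partial>G)"
      unfolding N_def by (subst integral_distr) (auto simp: uT exp_sum sum_distrib_left)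
    also have "\<dots> = (\<Prod>l\<in>UNIV. char std_normal_distribution (b u l))"
      unfolding G_def char_def
      by (subst G.product_integral_prod) (auto intro!: st.integrable_iexp)
    also have "\<dots> = exp (- complex_of_real (Q u) / 2)"
      by (simp add: char_std_normal_distribution Qb exp_of_real[symmetric] exp_sum[symmetric]
          sum_negf sum_divide_distrib)
    finally show ?thesis .
  qed
  have law: "distr N borel (\<lambda>x. u \<bullet> x) = distr std_normal_distribution borel (\<lambda>x. sqrt (Q u) * x)" (is "?L = ?R") for u
  proof (rule Levy_uniqueness)
    show "real_distribution ?L" by (rule N.real_distribution_distr) simp
    show "real_distribution ?R" by (rule st.real_distribution_distr) simp
    show "char ?L = char ?R"
    proof
      fix t
      have "char ?L t = (\<integral>x. iexp ((t *\<^sub>R u) \<bullet> x) \<partial>N)"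
        unfolding char_def by (subst integral_distr) auto
      also have "\<dots> = exp (- complex_of_real (Q (t *\<^sub>R u)) / 2)" by (rule char)
      also have "Q (t *\<^sub>R u) = (t * sqrt (Q u))\<^sup>2"
        using Q0[of u] by (simp add: Q_def sum_distrib_left power_mult_distrib)
          (simp add: power2_eq_square mult_ac)
      also have "exp (- complex_of_real ((t * sqrt (Q u))\<^sup>2) / 2) = char std_normal_distribution (t * sqrt (Q u))"
        by (simp add: char_std_normal_distribution exp_of_real[symmetric])
      also have "\<dots> = char ?R t"
        unfolding char_def by (subst integral_distr) (auto simp: mult_ac)
      finally show "char ?L t = char ?R t" .
    qed
  qed
  have law_integral: "(\<integral>x. f (u \<bullet> x) \<partial>N) = (\<integral>y. f (sqrt (Q u) * y) \<partial>std_normal_distribution)"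
    if [measurable]: "f \<in> borel_measurable borel" for f :: "real \<Rightarrow> real" and u
    using integral_distr[of "\<lambda>x. u \<bullet> x" N borel f]
      integral_distr[of "\<lambda>x. sqrt (Q u) * x" std_normal_distribution borel f] by (simp add: law)
  have mean: "(\<integral>x. u \<bullet> x \<partial>N) = 0" for u
    using law_integral[of "\<lambda>y. y" u] integral_std_normal_distribution_moment_odd[of 1] by simp
  have sq: "integrable N (\<lambda>x. (u \<bullet> x)\<^sup>2)" "(\<integral>x. (u \<bullet> x)\<^sup>2 \<partial>N) = Q u" for u
  proof -
    have "integrable (distr N borel (\<lambda>x. u \<bullet> x)) (\<lambda>y. y\<^sup>2)"
      unfolding law by (subst integrable_distr_eq)
        (auto simp: power_mult_distrib intro!: integrable_mult_right integrable_std_normal_distribution_moment)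
    then show "integrable N (\<lambda>x. (u \<bullet> x)\<^sup>2)" by (subst (asm) integrable_distr_eq) auto
    show "(\<integral>x. (u \<bullet> x)\<^sup>2 \<partial>N) = Q u"
      using law_integral[of "\<lambda>y. y\<^sup>2" u] std_normal_distribution_even_moments[of 1] Q0[of u]
      by (simp add: power_mult_distrib has_bochner_integral_iff)
  qed
  have "gaussian_vector N"
    unfolding gaussian_vector_def
  proof (intro conjI allI)
    show "\<exists>m \<sigma>. 0 \<le> \<sigma> \<and> distr N borel (\<lambda>x. u \<bullet> x) = normal_law m \<sigma>" for u
      using Q0[of u] by (intro exI[of _ 0] exI[of _ "sqrt (Q u)"]) (simp add: law normal_law_0_eq_distr)
  qed (simp_all add: N.prob_space_axioms)
  moreover have "(\<integral>x. x $ i \<partial>N) = 0" for i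
    using mean[of "axis i 1"] by (simp add: inner_axis')
  moreover have "(\<integral>x. x $ i * x $ j \<partial>N) = S $ i $ j" for i j
  proof -
    define e where "e i = (axis i 1 :: real ^ 'k)" for i
    have e: "e i \<bullet> x = x $ i" for i x by (simp add: e_def inner_axis')
    \<comment> \<open>Polarization reduces mixed moments to second moments of projections.\<close>
    have "(\<integral>x. x $ i * x $ j \<partial>N) =
        (\<integral>x. (1/2) * (((e i + e j) \<bullet> x)\<^sup>2 - (e i \<bullet> x)\<^sup>2 - (e j \<bullet> x)\<^sup>2) \<partial>N)"
      by (intro Bochner_Integration.integral_cong refl)
        (simp add: e inner_add_left power2_eq_square algebra_simps)
    also have "\<dots> = (1/2) * (Q (e i + e j) - Q (e i) - Q (e j))"
      using sq by simp
    also have "\<dots> = (\<Sum>l\<in>UNIV. b (e i) l * b (e j) l)"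
    proof -
      have "b (e i + e j) l = b (e i) l + b (e j) l" for l
        by (simp add: b_def distrib_right sum.distrib)
      then show ?thesis
        unfolding Qb by (simp add: power2_sum sum.distrib mult.assoc flip: sum_distrib_left)
    qed
    also have "\<dots> = S $ i $ j"
    proof -
      have "b (e i) l = a i l" for i l
      proof -
        have "b (e i) l = (\<Sum>m\<in>UNIV. if m = i then a m l else 0)"
          unfolding b_def e_def by (intro sum.cong) (auto simp: axis_def)
        then show ?thesis by simp
      qed
      then show ?thesis by (simp add: a)
    qed
    finally show ?thesis .
  qed
  ultimately have "centred_gaussian_vector N S"
    by (simp add: centred_gaussian_vector_def)
  then show ?thesis using char unfolding Q_def by blast
qed

section \<open>Stochastic order symbols\<close>

abbreviation tail :: "'a measure \<Rightarrow> ('a \<Rightarrow> real) \<Rightarrow> real \<Rightarrow> real"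
  where "tail P Y c \<equiv> measure P {\<omega> \<in> space P. \<bar>Y \<omega>\<bar> > c}"

text \<open>Conditions are imposed for large \<open>n\<close> only, because \<open>n\<close> will be the dimension, and dimension 0 is meaningless.\<close>

definition rv_seq :: "(nat \<Rightarrow> 'a measure) \<Rightarrow> (nat \<Rightarrow> 'a \<Rightarrow> real) \<Rightarrow> bool"
  where "rv_seq M Y \<longleftrightarrow>
    (\<forall>\<^sub>F n in sequentially. prob_space (M n) \<and> Y n \<in> borel_measurable (M n))"

text \<open>The classes \<open>o\<^sub>P(1)\<close> and \<open>O\<^sub>P(1)\<close>. Measurability is part of both notions, so that the rules of calculation have no
side conditions.\<close>

definition vanishing :: "(nat \<Rightarrow> 'a measure) \<Rightarrow> (nat \<Rightarrow> 'a \<Rightarrow> real) \<Rightarrow> bool"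
  where "vanishing M Y \<longleftrightarrow> rv_seq M Y \<and> tends_to_zero_in_probability M Y"

definition stoch_bounded :: "(nat \<Rightarrow> 'a measure) \<Rightarrow> (nat \<Rightarrow> 'a \<Rightarrow> real) \<Rightarrow> bool"
  where "stoch_bounded M Y \<longleftrightarrow> rv_seq M Y \<and>
    (\<forall>\<epsilon>>0. \<exists>K. \<forall>\<^sub>F n in sequentially. tail (M n) (Y n) K < \<epsilon>)"

lemma rv_seqI:
  "(\<And>n. 1 \<le> n \<Longrightarrow> prob_space (M n)) \<Longrightarrow> (\<And>n. 1 \<le> n \<Longrightarrow> Y n \<in> borel_measurable (M n)) \<Longrightarrow> rv_seq M Y"
  by (auto simp: rv_seq_def eventually_sequentially)

lemma rv_seq_const: "rv_seq M Y \<Longrightarrow> rv_seq M (\<lambda>n _. c n)"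
  by (auto simp: rv_seq_def elim!: eventually_mono)

lemma rv_seq_add: "rv_seq M Y \<Longrightarrow> rv_seq M Z \<Longrightarrow> rv_seq M (\<lambda>n \<omega>. Y n \<omega> + Z n \<omega>)"
  unfolding rv_seq_def by (erule (1) eventually_elim2) auto

lemma rv_seq_diff: "rv_seq M Y \<Longrightarrow> rv_seq M Z \<Longrightarrow> rv_seq M (\<lambda>n \<omega>. Y n \<omega> - Z n \<omega>)"
  unfolding rv_seq_def by (erule (1) eventually_elim2) auto

lemma rv_seq_mult: "rv_seq M Y \<Longrightarrow> rv_seq M Z \<Longrightarrow> rv_seq M (\<lambda>n \<omega>. Y n \<omega> * Z n \<omega>)"
  unfolding rv_seq_def by (erule (1) eventually_elim2) auto

lemma rv_seq_sum:
  assumes "finite I" "I \<noteq> {}" "\<And>i. i \<in> I \<Longrightarrow> rv_seq M (A i)"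
  shows "rv_seq M (\<lambda>n \<omega>. \<Sum>i\<in>I. A i n \<omega>)"
  using assms by (induction rule: finite_ne_induct) (simp_all add: rv_seq_add)

lemma vanishing_rv_seq: "vanishing M Y \<Longrightarrow> rv_seq M Y"
  by (simp add: vanishing_def)

lemma stoch_bounded_rv_seq: "stoch_bounded M Y \<Longrightarrow> rv_seq M Y"
  by (simp add: stoch_bounded_def)

lemma tail_le_add:
  assumes "prob_space P" and [measurable]: "A \<in> borel_measurable P" "B \<in> borel_measurable P"
    and incl: "\<And>\<omega>. \<omega> \<in> space P \<Longrightarrow> \<bar>A \<omega>\<bar> \<le> a \<Longrightarrow> \<bar>B \<omega>\<bar> \<le> b \<Longrightarrow> \<bar>Y \<omega>\<bar> \<le> c"
  shows "tail P Y c \<le> tail P A a + tail P B b"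
proof -
  interpret prob_space P by fact
  have "{\<omega> \<in> space P. \<bar>Y \<omega>\<bar> > c} \<subseteq> {\<omega> \<in> space P. \<bar>A \<omega>\<bar> > a} \<union> {\<omega> \<in> space P. \<bar>B \<omega>\<bar> > b}"
    using incl by (auto simp: not_less[symmetric])
  then have "tail P Y c \<le> prob ({\<omega> \<in> space P. \<bar>A \<omega>\<bar> > a} \<union> {\<omega> \<in> space P. \<bar>B \<omega>\<bar> > b})"
    by (intro finite_measure_mono) auto
  also have "\<dots> \<le> tail P A a + tail P B b"
    by (intro measure_Un_le) auto
  finally show ?thesis .
qed

lemma tail_le:
  assumes "prob_space P" and "A \<in> borel_measurable P"
    and incl: "\<And>\<omega>. \<omega> \<in> space P \<Longrightarrow> \<bar>A \<omega>\<bar> \<le> a \<Longrightarrow> \<bar>Y \<omega>\<bar> \<le> c"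
  shows "tail P Y c \<le> tail P A a"
  using tail_le_add[OF assms(1,2), of "\<lambda>_. 0" a 0 Y c] incl by simp

lemma tail_mono:
  assumes "prob_space P" and "A \<in> borel_measurable P" "a \<le> b"
  shows "tail P A b \<le> tail P A a"
  using assms by (intro tail_le) auto

lemma tendsto_zero_squeeze_eventually:
  fixes f :: "nat \<Rightarrow> real"
  assumes "\<And>n. 0 \<le> f n" "\<And>e. 0 < e \<Longrightarrow> \<forall>\<^sub>F n in sequentially. f n < e"
  shows "f \<longlonglongrightarrow> 0"
  using assms by (intro tendstoI) (auto simp: dist_real_def elim!: eventually_mono)

lemma vanishing_iff:
  "vanishing M Y \<longleftrightarrow> rv_seq M Y \<and> (\<forall>\<epsilon>>0. \<forall>\<delta>>0. \<forall>\<^sub>F n in sequentially. tail (M n) (Y n) \<epsilon> < \<delta>)"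
  unfolding vanishing_def tends_to_zero_in_probability_def
  by (intro conj_cong refl all_cong iffI)
    (auto intro: order_tendstoD(2) tendsto_zero_squeeze_eventually)

lemma vanishingI:
  "rv_seq M Y \<Longrightarrow> (\<And>\<epsilon> \<delta>. 0 < \<epsilon> \<Longrightarrow> 0 < \<delta> \<Longrightarrow> \<forall>\<^sub>F n in sequentially. tail (M n) (Y n) \<epsilon> < \<delta>) \<Longrightarrow> vanishing M Y"
  by (simp add: vanishing_iff)

lemma vanishingD:
  "vanishing M Y \<Longrightarrow> 0 < \<epsilon> \<Longrightarrow> 0 < \<delta> \<Longrightarrow> \<forall>\<^sub>F n in sequentially. tail (M n) (Y n) \<epsilon> < \<delta>"
  by (simp add: vanishing_iff)

lemma stoch_boundedD:
  "stoch_bounded M Y \<Longrightarrow> 0 < \<epsilon> \<Longrightarrow> \<exists>K. \<forall>\<^sub>F n in sequentially. tail (M n) (Y n) K < \<epsilon>"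
  by (simp add: stoch_bounded_def)

lemma vanishing_stoch_bounded: "vanishing M Y \<Longrightarrow> stoch_bounded M Y"
  by (auto simp: vanishing_iff stoch_bounded_def intro!: exI[of _ "1::real"])

lemma stoch_bounded_const: "rv_seq M Y \<Longrightarrow> stoch_bounded M (\<lambda>_ _. c)"
  by (auto simp: stoch_bounded_def rv_seq_const intro!: exI[of _ "\<bar>c\<bar>"])

lemma vanishing_mult:
  assumes A: "stoch_bounded M A" and B: "vanishing M B"
  shows "vanishing M (\<lambda>n \<omega>. A n \<omega> * B n \<omega>)"
proof (rule vanishingI)
  note rv = stoch_bounded_rv_seq[OF A] vanishing_rv_seq[OF B]
  show "rv_seq M (\<lambda>n \<omega>. A n \<omega> * B n \<omega>)" by (rule rv_seq_mult[OF rv])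
  fix \<epsilon> \<delta> :: real assume "0 < \<epsilon>" "0 < \<delta>"
  obtain K where K: "\<forall>\<^sub>F n in sequentially. tail (M n) (A n) K < \<delta> / 2"
    using stoch_boundedD[OF A, of "\<delta> / 2"] \<open>0 < \<delta>\<close> by auto
  define L where "L = max K 1"
  have L: "0 < L" "K \<le> L" by (auto simp: L_def)
  have "\<forall>\<^sub>F n in sequentially. tail (M n) (B n) (\<epsilon> / L) < \<delta> / 2"
    using vanishingD[OF B, of "\<epsilon> / L" "\<delta> / 2"] \<open>0 < \<epsilon>\<close> \<open>0 < \<delta>\<close> L by simp
  then show "\<forall>\<^sub>F n in sequentially. tail (M n) (\<lambda>\<omega>. A n \<omega> * B n \<omega>) \<epsilon> < \<delta>"
    using K rv[unfolded rv_seq_def]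
  proof eventually_elim
    case (elim n)
    have "\<bar>A n \<omega> * B n \<omega>\<bar> \<le> \<epsilon>" if "\<bar>A n \<omega>\<bar> \<le> L" "\<bar>B n \<omega>\<bar> \<le> \<epsilon> / L" for \<omega>
      using mult_mono[OF that] L by (simp add: abs_mult)
    then have "tail (M n) (\<lambda>\<omega>. A n \<omega> * B n \<omega>) \<epsilon> \<le> tail (M n) (A n) L + tail (M n) (B n) (\<epsilon> / L)"
      using elim by (intro tail_le_add) auto
    moreover have "tail (M n) (A n) L \<le> tail (M n) (A n) K"
      using elim L by (intro tail_mono) auto
    ultimately show ?case using elim by linarith
  qed
qed

lemma vanishing_cmult: "vanishing M B \<Longrightarrow> vanishing M (\<lambda>n \<omega>. c * B n \<omega>)"
  by (rule vanishing_mult[OF stoch_bounded_const[OF vanishing_rv_seq]])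

lemma vanishing_seq:
  assumes "rv_seq M Y" "c \<longlonglongrightarrow> 0"
  shows "vanishing M (\<lambda>n _. c n)"
proof (rule vanishingI[OF rv_seq_const[OF assms(1)]])
  fix \<epsilon> \<delta> :: real assume "0 < \<epsilon>" "0 < \<delta>"
  have "\<forall>\<^sub>F n in sequentially. \<bar>c n\<bar> < \<epsilon>"
    using tendstoD[OF assms(2) \<open>0 < \<epsilon>\<close>] by (simp add: dist_real_def)
  then show "\<forall>\<^sub>F n in sequentially. tail (M n) (\<lambda>_. c n) \<epsilon> < \<delta>"
    by eventually_elim (use \<open>0 < \<delta>\<close> in auto)
qed

lemma vanishing_add:
  assumes A: "vanishing M A" and B: "vanishing M B"
  shows "vanishing M (\<lambda>n \<omega>. A n \<omega> + B n \<omega>)"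
proof (rule vanishingI)
  note rv = vanishing_rv_seq[OF A] vanishing_rv_seq[OF B]
  show "rv_seq M (\<lambda>n \<omega>. A n \<omega> + B n \<omega>)" by (rule rv_seq_add[OF rv])
  fix \<epsilon> \<delta> :: real assume "0 < \<epsilon>" "0 < \<delta>"
  then have "\<forall>\<^sub>F n in sequentially. tail (M n) (A n) (\<epsilon> / 2) < \<delta> / 2"
    "\<forall>\<^sub>F n in sequentially. tail (M n) (B n) (\<epsilon> / 2) < \<delta> / 2"
    using vanishingD[OF A, of "\<epsilon> / 2" "\<delta> / 2"] vanishingD[OF B, of "\<epsilon> / 2" "\<delta> / 2"] by simp_all
  then show "\<forall>\<^sub>F n in sequentially. tail (M n) (\<lambda>\<omega>. A n \<omega> + B n \<omega>) \<epsilon> < \<delta>"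
    using rv[unfolded rv_seq_def]
  proof eventually_elim
    case (elim n)
    have "tail (M n) (\<lambda>\<omega>. A n \<omega> + B n \<omega>) \<epsilon> \<le> tail (M n) (A n) (\<epsilon>/2) + tail (M n) (B n) (\<epsilon>/2)"
      using elim by (intro tail_le_add) auto
    then show ?case using elim by linarith
  qed
qed

lemma vanishing_diff:
  "vanishing M A \<Longrightarrow> vanishing M B \<Longrightarrow> vanishing M (\<lambda>n \<omega>. A n \<omega> - B n \<omega>)"
  using vanishing_add[of M A, OF _ vanishing_cmult[of M B "-1"]] by simp

lemma vanishing_sum:
  assumes "finite I" "I \<noteq> {}" "\<And>i. i \<in> I \<Longrightarrow> vanishing M (A i)"
  shows "vanishing M (\<lambda>n \<omega>. \<Sum>i\<in>I. A i n \<omega>)"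
  using assms by (induction rule: finite_ne_induct) (simp_all add: vanishing_add)

lemma stoch_bounded_add:
  assumes A: "stoch_bounded M A" and B: "stoch_bounded M B"
  shows "stoch_bounded M (\<lambda>n \<omega>. A n \<omega> + B n \<omega>)"
  unfolding stoch_bounded_def
proof (intro conjI allI impI)
  note rv = stoch_bounded_rv_seq[OF A] stoch_bounded_rv_seq[OF B]
  show "rv_seq M (\<lambda>n \<omega>. A n \<omega> + B n \<omega>)" by (rule rv_seq_add[OF rv])
  fix \<delta> :: real assume "0 < \<delta>"
  then obtain K L where K: "\<forall>\<^sub>F n in sequentially. tail (M n) (A n) K < \<delta> / 2"
    and L: "\<forall>\<^sub>F n in sequentially. tail (M n) (B n) L < \<delta> / 2"
    using stoch_boundedD[OF A, of "\<delta> / 2"] stoch_boundedD[OF B, of "\<delta> / 2"] by auto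
  have "\<forall>\<^sub>F n in sequentially. tail (M n) (\<lambda>\<omega>. A n \<omega> + B n \<omega>) (K + L) < \<delta>"
    using K L rv[unfolded rv_seq_def]
  proof eventually_elim
    case (elim n)
    have "tail (M n) (\<lambda>\<omega>. A n \<omega> + B n \<omega>) (K + L) \<le> tail (M n) (A n) K + tail (M n) (B n) L"
      using elim by (intro tail_le_add) auto
    then show ?case using elim by linarith
  qed
  then show "\<exists>K. \<forall>\<^sub>F n in sequentially. tail (M n) (\<lambda>\<omega>. A n \<omega> + B n \<omega>) K < \<delta>" ..
qed

lemma stoch_bounded_sum:
  assumes "finite I" "I \<noteq> {}" "\<And>i. i \<in> I \<Longrightarrow> stoch_bounded M (A i)"
  shows "stoch_bounded M (\<lambda>n \<omega>. \<Sum>i\<in>I. A i n \<omega>)"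
  using assms by (induction rule: finite_ne_induct) (simp_all add: stoch_bounded_add)

lemma stoch_bounded_abs: "stoch_bounded M A \<Longrightarrow> stoch_bounded M (\<lambda>n \<omega>. \<bar>A n \<omega>\<bar>)"
  by (auto simp: stoch_bounded_def rv_seq_def elim!: eventually_mono)

lemma stoch_bounded_perturb:
  "vanishing M (\<lambda>n \<omega>. Y n \<omega> - Z n \<omega>) \<Longrightarrow> stoch_bounded M Z \<Longrightarrow> stoch_bounded M Y"
  using stoch_bounded_add[OF vanishing_stoch_bounded, of M "\<lambda>n \<omega>. Y n \<omega> - Z n \<omega>" Z] by simp

lemma stoch_bounded_cmult:
  assumes A: "stoch_bounded M A"
  shows "stoch_bounded M (\<lambda>n \<omega>. c * A n \<omega>)"
  unfolding stoch_bounded_def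
proof (intro conjI allI impI)
  note rv = stoch_bounded_rv_seq[OF A]
  show "rv_seq M (\<lambda>n \<omega>. c * A n \<omega>)" by (intro rv_seq_mult rv_seq_const[OF rv] rv)
  fix \<delta> :: real assume "0 < \<delta>"
  then obtain K where K: "\<forall>\<^sub>F n in sequentially. tail (M n) (A n) K < \<delta>"
    using stoch_boundedD[OF A] by blast
  have "\<forall>\<^sub>F n in sequentially. tail (M n) (\<lambda>\<omega>. c * A n \<omega>) (\<bar>c\<bar> * K) < \<delta>"
    using K rv[unfolded rv_seq_def]
  proof eventually_elim
    case (elim n)
    have "tail (M n) (\<lambda>\<omega>. c * A n \<omega>) (\<bar>c\<bar> * K) \<le> tail (M n) (A n) K"
      using elim by (intro tail_le) (auto simp: abs_mult intro: mult_left_mono)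
    then show ?case using elim by linarith
  qed
  then show "\<exists>K. \<forall>\<^sub>F n in sequentially. tail (M n) (\<lambda>\<omega>. c * A n \<omega>) K < \<delta>" ..
qed

lemma stoch_bounded_diff:
  "stoch_bounded M A \<Longrightarrow> stoch_bounded M B \<Longrightarrow> stoch_bounded M (\<lambda>n \<omega>. A n \<omega> - B n \<omega>)"
  using stoch_bounded_add[of M A, OF _ stoch_bounded_cmult[of M B "-1"]] by simp

lemma vanishing_compose:
  assumes A: "vanishing M A" and r: "(r \<longlongrightarrow> 0) (nhds 0)" and [measurable]: "r \<in> borel_measurable borel"
  shows "vanishing M (\<lambda>n \<omega>. r (A n \<omega>))"
proof (rule vanishingI)
  note rv = vanishing_rv_seq[OF A, unfolded rv_seq_def]
  show "rv_seq M (\<lambda>n \<omega>. r (A n \<omega>))"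
    unfolding rv_seq_def using rv by eventually_elim auto
  fix \<epsilon> \<delta> :: real assume "0 < \<epsilon>" "0 < \<delta>"
  from tendstoD[OF r \<open>0 < \<epsilon>\<close>] obtain d where d: "0 < d" "\<And>x. \<bar>x\<bar> < d \<Longrightarrow> \<bar>r x\<bar> < \<epsilon>"
    by (auto simp: eventually_nhds_metric dist_real_def)
  have "\<forall>\<^sub>F n in sequentially. tail (M n) (A n) (d / 2) < \<delta>"
    using vanishingD[OF A, of "d / 2" \<delta>] \<open>0 < d\<close> \<open>0 < \<delta>\<close> by simp
  then show "\<forall>\<^sub>F n in sequentially. tail (M n) (\<lambda>\<omega>. r (A n \<omega>)) \<epsilon> < \<delta>"
    using rv
  proof eventually_elim
    case (elim n)
    have "tail (M n) (\<lambda>\<omega>. r (A n \<omega>)) \<epsilon> \<le> tail (M n) (A n) (d / 2)"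
      using elim d by (intro tail_le) (auto intro!: less_imp_le)
    then show ?case using elim by linarith
  qed
qed

text \<open>Identities that involve a quotient hold only where the denominator is not 0. They may be used
if the exceptional set is covered by an event \<open>\<bar>W\<^sub>n\<bar> > 1/2\<close> with \<open>W\<^sub>n\<close> tending to 0.\<close>

lemma vanishing_cong_on:
  assumes Z: "vanishing M Z" and W: "vanishing M W" and Y: "rv_seq M Y"
    and eq: "\<And>n \<omega>. 1 \<le> n \<Longrightarrow> \<omega> \<in> space (M n) \<Longrightarrow> \<bar>W n \<omega>\<bar> \<le> 1 / 2 \<Longrightarrow> Y n \<omega> = Z n \<omega>"
  shows "vanishing M Y"
proof (rule vanishingI[OF Y])
  fix \<epsilon> \<delta> :: real assume "0 < \<epsilon>" "0 < \<delta>"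
  then have "\<forall>\<^sub>F n in sequentially. tail (M n) (Z n) \<epsilon> < \<delta> / 2"
    "\<forall>\<^sub>F n in sequentially. tail (M n) (W n) (1 / 2) < \<delta> / 2"
    using vanishingD[OF Z, of \<epsilon> "\<delta> / 2"] vanishingD[OF W, of "1 / 2" "\<delta> / 2"] by simp_all
  then show "\<forall>\<^sub>F n in sequentially. tail (M n) (Y n) \<epsilon> < \<delta>"
    using vanishing_rv_seq[OF Z, unfolded rv_seq_def] vanishing_rv_seq[OF W, unfolded rv_seq_def]
      eventually_ge_at_top[of 1]
  proof eventually_elim
    case (elim n)
    have "tail (M n) (Y n) \<epsilon> \<le> tail (M n) (Z n) \<epsilon> + tail (M n) (W n) (1 / 2)"
      using elim eq[of n] by (intro tail_le_add) auto
    then show ?case using elim by linarith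
  qed
qed

lemma vanishing_cong:
  assumes "\<And>n \<omega>. 1 \<le> n \<Longrightarrow> \<omega> \<in> space (M n) \<Longrightarrow> Y n \<omega> = Z n \<omega>" and Z: "vanishing M Z"
  shows "vanishing M Y"
proof (rule vanishing_cong_on[OF Z Z])
  show "rv_seq M Y"
    using vanishing_rv_seq[OF Z] eventually_ge_at_top[of 1] unfolding rv_seq_def
    by eventually_elim (use assms(1) in \<open>auto cong: measurable_cong\<close>)
qed (use assms(1) in auto)

lemma vanishing_div_sqrt:
  assumes Y: "stoch_bounded M Y"
  shows "vanishing M (\<lambda>n \<omega>. Y n \<omega> / sqrt n)"
proof -
  have "(\<lambda>n. 1 / sqrt (real n)) \<longlonglongrightarrow> 0" by real_asymp
  from vanishing_mult[OF Y vanishing_seq[OF stoch_bounded_rv_seq[OF Y] this]]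
  show ?thesis by simp
qed

text \<open>The difference quotient \<open>r h = (f h - f 0) / h - D\<close> tends to 0, and the left-hand side is \<open>Y\<close> times
\<open>r (Y / \<surd>n)\<close>, a bounded factor times a vanishing one.\<close>

lemma delta_method:
  assumes Y: "stoch_bounded M Y"
    and f: "(f has_real_derivative D) (at 0)" and [measurable]: "f \<in> borel_measurable borel"
  shows "vanishing M (\<lambda>n \<omega>. sqrt n * (f (Y n \<omega> / sqrt n) - f 0) - D * Y n \<omega>)"
proof -
  define r where "r h = (if h = 0 then 0 else (f h - f 0) / h - D)" for h
  have [measurable]: "r \<in> borel_measurable borel" unfolding r_def by measurable
  have "((\<lambda>h. (f h - f 0) / h) \<longlongrightarrow> D) (at 0)"
    using f by (simp add: has_field_derivative_iff)
  then have "((\<lambda>h. (f h - f 0) / h - D) \<longlongrightarrow> D - D) (at 0)" by (intro tendsto_intros)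
  moreover have "((\<lambda>h. (f h - f 0) / h - D) \<longlongrightarrow> 0) (at 0) \<longleftrightarrow> (r \<longlongrightarrow> 0) (at 0)"
    by (intro filterlim_cong refl) (auto simp: eventually_at_filter r_def)
  moreover have "r 0 = 0" by (simp add: r_def)
  ultimately have r: "(r \<longlongrightarrow> 0) (nhds 0)"
    using tendsto_at_iff_tendsto_nhds[of r 0] by simp
  show ?thesis
    by (rule vanishing_cong[OF _ vanishing_mult[OF Y vanishing_compose[OF vanishing_div_sqrt[OF Y] r]]])
      (auto simp: r_def field_simps)
qed

lemma norm_iexp_diff_le: "norm (iexp a - iexp b) \<le> min 2 \<bar>a - b\<bar>"
proof -
  have "iexp a - iexp b = iexp b * (iexp (a - b) - 1)"
    by (simp add: algebra_simps exp_add[symmetric])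
  then have "norm (iexp a - iexp b) = norm (iexp (a - b) - 1)"
    by (simp add: norm_mult)
  moreover have "norm (iexp (a - b) - 1) \<le> \<bar>a - b\<bar>"
    using iexp_approx1[of "a - b" 0] by simp
  moreover have "norm (iexp a - iexp b) \<le> 2"
    using norm_triangle_ineq4[of "iexp a" "iexp b"] by simp
  ultimately show ?thesis by simp
qed

text \<open>Slutsky's lemma for characteristic functions: \<open>iexp\<close> is bounded and Lipschitz.\<close>

lemma integral_iexp_tendsto_perturb:
  assumes diff: "vanishing M (\<lambda>n \<omega>. Y n \<omega> - Z n \<omega>)" and Z: "rv_seq M Z"
    and lim: "(\<lambda>n. \<integral>\<omega>. iexp (Z n \<omega>) \<partial>M n) \<longlonglongrightarrow> L"
  shows "(\<lambda>n. \<integral>\<omega>. iexp (Y n \<omega>) \<partial>M n) \<longlonglongrightarrow> L"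
proof -
  have rv: "rv_seq M Y" "rv_seq M Z"
    using rv_seq_add[OF vanishing_rv_seq[OF diff] Z] Z by simp_all
  have "(\<lambda>n. norm ((\<integral>\<omega>. iexp (Y n \<omega>) \<partial>M n) - (\<integral>\<omega>. iexp (Z n \<omega>) \<partial>M n))) \<longlonglongrightarrow> 0"
  proof (rule tendsto_zero_squeeze_eventually)
    fix e :: real assume "0 < e"
    have "\<forall>\<^sub>F n in sequentially. tail (M n) (\<lambda>\<omega>. Y n \<omega> - Z n \<omega>) (e / 2) < e / 4"
      using vanishingD[OF diff, of "e / 2" "e / 4"] \<open>0 < e\<close> by simp
    then show "\<forall>\<^sub>F n in sequentially. norm ((\<integral>\<omega>. iexp (Y n \<omega>) \<partial>M n) - (\<integral>\<omega>. iexp (Z n \<omega>) \<partial>M n)) < e"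
      using rv[unfolded rv_seq_def]
    proof eventually_elim
      case (elim n)
      interpret prob_space "M n" using elim by simp
      have [measurable]: "Y n \<in> borel_measurable (M n)" "Z n \<in> borel_measurable (M n)"
        using elim by auto
      define E where "E = {\<omega> \<in> space (M n). \<bar>Y n \<omega> - Z n \<omega>\<bar> > e / 2}"
      have [measurable]: "E \<in> events" unfolding E_def by measurable
      have "norm ((\<integral>\<omega>. iexp (Y n \<omega>) \<partial>M n) - (\<integral>\<omega>. iexp (Z n \<omega>) \<partial>M n)) =
          norm (\<integral>\<omega>. iexp (Y n \<omega>) - iexp (Z n \<omega>) \<partial>M n)"
        by (subst Bochner_Integration.integral_diff) (auto intro!: integrable_iexp)
      also have "\<dots> \<le> (\<integral>\<omega>. e / 2 + 2 * indicator E \<omega> \<partial>M n)"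
      proof (rule order_trans[OF integral_norm_bound integral_mono])
        show "integrable (M n) (\<lambda>\<omega>. e / 2 + 2 * indicator E \<omega>)" 
          by (intro Bochner_Integration.integrable_add integrable_mult_right) (auto simp: emeasure_eq_measure)
        show "integrable (M n) (\<lambda>\<omega>. norm (iexp (Y n \<omega>) - iexp (Z n \<omega>)))"
          by (intro integrable_norm Bochner_Integration.integrable_diff integrable_iexp) auto
        show "norm (iexp (Y n \<omega>) - iexp (Z n \<omega>)) \<le> e / 2 + 2 * indicator E \<omega>"
          if "\<omega> \<in> space (M n)" for \<omega>
          using norm_iexp_diff_le[of "Y n \<omega>" "Z n \<omega>"] that \<open>0 < e\<close>
          by (cases "\<omega> \<in> E") (auto simp: E_def)
      qed
      also have "\<dots> = e / 2 + 2 * prob E"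
        by (subst Bochner_Integration.integral_add) (auto simp: emeasure_eq_measure prob_space intro!: integrable_mult_right)
      also have "\<dots> < e" using elim(1) unfolding E_def by simp
      finally show ?case .
    qed
  qed auto
  then have "(\<lambda>n. ((\<integral>\<omega>. iexp (Y n \<omega>) \<partial>M n) - (\<integral>\<omega>. iexp (Z n \<omega>) \<partial>M n)) + (\<integral>\<omega>. iexp (Z n \<omega>) \<partial>M n)) \<longlonglongrightarrow> 0 + L"
    by (intro tendsto_add lim) (simp add: tendsto_norm_zero_iff)
  then show ?thesis by simp
qed

text \<open>Slutsky's lemma for distribution functions: \<open>{Y \<le> t}\<close> lies between \<open>{Z \<le> t - h}\<close> and \<open>{Z \<le> t + h}\<close>, up to the
event that \<open>Y\<close> and \<open>Z\<close> differ by more than \<open>h\<close>.\<close>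

lemma cdf_tendsto_perturb:
  assumes diff: "vanishing M (\<lambda>n \<omega>. Y n \<omega> - Z n \<omega>)" and Z: "rv_seq M Z"
    and lim: "\<And>t. (\<lambda>n. measure (M n) {\<omega> \<in> space (M n). Z n \<omega> \<le> t}) \<longlonglongrightarrow> F t"
    and cont: "isCont F t"
  shows "(\<lambda>n. measure (M n) {\<omega> \<in> space (M n). Y n \<omega> \<le> t}) \<longlonglongrightarrow> F t"
proof (rule tendstoI)
  fix e :: real assume "0 < e"
  have rv: "rv_seq M Y" "rv_seq M Z"
    using rv_seq_add[OF vanishing_rv_seq[OF diff] Z] Z by simp_all
  obtain d where d: "0 < d" "\<And>s. \<bar>s - t\<bar> < d \<Longrightarrow> \<bar>F s - F t\<bar> < e / 3"
    using cont \<open>0 < e\<close> unfolding continuous_at_eps_delta dist_real_def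
    by (metis divide_pos_pos zero_less_numeral)
  define h where "h = d / 2"
  have h: "0 < h" "\<bar>F (t + h) - F t\<bar> < e / 3" "\<bar>F (t - h) - F t\<bar> < e / 3"
    using d by (auto simp: h_def)
  have ev: "\<forall>\<^sub>F n in sequentially. \<bar>measure (M n) {\<omega> \<in> space (M n). Z n \<omega> \<le> s} - F s\<bar> < e / 3" for s
    using tendstoD[OF lim[of s], of "e / 3"] \<open>0 < e\<close> by (simp add: dist_real_def)
  have "\<forall>\<^sub>F n in sequentially. tail (M n) (\<lambda>\<omega>. Y n \<omega> - Z n \<omega>) h < e / 3"
    using vanishingD[OF diff, of h "e / 3"] \<open>0 < e\<close> h by simp
  then show "\<forall>\<^sub>F n in sequentially. dist (measure (M n) {\<omega> \<in> space (M n). Y n \<omega> \<le> t}) (F t) < e"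
    using ev[of "t + h"] ev[of "t - h"] rv[unfolded rv_seq_def]
  proof eventually_elim
    case (elim n)
    interpret prob_space "M n" using elim by simp
    have [measurable]: "Y n \<in> borel_measurable (M n)" "Z n \<in> borel_measurable (M n)"
      using elim by auto
    have le: "prob {\<omega> \<in> space (M n). A \<omega> \<le> s} \<le> prob {\<omega> \<in> space (M n). B \<omega> \<le> s + h} + tail (M n) (\<lambda>\<omega>. Y n \<omega> - Z n \<omega>) h"
      if [measurable]: "A \<in> borel_measurable (M n)" "B \<in> borel_measurable (M n)"
        and "\<And>\<omega>. B \<omega> \<le> A \<omega> + \<bar>Y n \<omega> - Z n \<omega>\<bar>" for A B s
    proof -
      have "prob {\<omega> \<in> space (M n). A \<omega> \<le> s} \<le>
          prob ({\<omega> \<in> space (M n). B \<omega> \<le> s + h} \<union> {\<omega> \<in> space (M n). \<bar>Y n \<omega> - Z n \<omega>\<bar> > h})"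
      proof (intro finite_measure_mono subsetI)
        fix \<omega> assume "\<omega> \<in> {\<omega> \<in> space (M n). A \<omega> \<le> s}"
        with that(3)[of \<omega>] show "\<omega> \<in> {\<omega> \<in> space (M n). B \<omega> \<le> s + h} \<union> {\<omega> \<in> space (M n). \<bar>Y n \<omega> - Z n \<omega>\<bar> > h}"
          by auto
      qed measurable
      also have "\<dots> \<le> prob {\<omega> \<in> space (M n). B \<omega> \<le> s + h} + tail (M n) (\<lambda>\<omega>. Y n \<omega> - Z n \<omega>) h"
        by (intro measure_Un_le) auto
      finally show ?thesis .
    qed
    have "prob {\<omega> \<in> space (M n). Y n \<omega> \<le> t} \<le> prob {\<omega> \<in> space (M n). Z n \<omega> \<le> t + h} + tail (M n) (\<lambda>\<omega>. Y n \<omega> - Z n \<omega>) h"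
      "prob {\<omega> \<in> space (M n). Z n \<omega> \<le> t - h} \<le> prob {\<omega> \<in> space (M n). Y n \<omega> \<le> t} + tail (M n) (\<lambda>\<omega>. Y n \<omega> - Z n \<omega>) h"
      using le[of "Y n" "Z n" t] le[of "Z n" "Y n" "t - h"] by simp_all
    then show ?case using elim(1-3) h(2,3) unfolding dist_real_def by linarith
  qed
qed

text \<open>No mass escapes, because the limit \<open>F\<close> has the limits 0 and 1 of a distribution function.\<close>

lemma cdf_tendsto_imp_stoch_bounded:
  assumes rv: "rv_seq M Z"
    and lim: "\<And>t. (\<lambda>n. measure (M n) {\<omega> \<in> space (M n). Z n \<omega> \<le> t}) \<longlonglongrightarrow> F t"
    and F: "(F \<longlongrightarrow> 0) at_bot" "(F \<longlongrightarrow> 1) at_top"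
  shows "stoch_bounded M Z"
  unfolding stoch_bounded_def
proof (intro conjI allI impI rv)
  fix e :: real assume "0 < e"
  have "\<forall>\<^sub>F x in at_top. F (- x) < e / 4"
    using order_tendstoD(2)[OF F(1), of "e / 4"] \<open>0 < e\<close>
    by (simp add: at_bot_mirror eventually_filtermap)
  moreover have "\<forall>\<^sub>F x in at_top. F x > 1 - e / 4"
    using order_tendstoD(1)[OF F(2), of "1 - e / 4"] \<open>0 < e\<close> by simp
  ultimately have "\<forall>\<^sub>F x in at_top. F (- x) < e / 4 \<and> F x > 1 - e / 4" by eventually_elim simp
  then obtain K where K: "F (- K) < e / 4" "F K > 1 - e / 4"
    by (auto simp: eventually_at_top_linorder)
  have ev: "\<forall>\<^sub>F n in sequentially. \<bar>measure (M n) {\<omega> \<in> space (M n). Z n \<omega> \<le> s} - F s\<bar> < e / 4" for s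
    using tendstoD[OF lim[of s], of "e / 4"] \<open>0 < e\<close> by (simp add: dist_real_def)
  have "\<forall>\<^sub>F n in sequentially. tail (M n) (Z n) K < e"
    using ev[of K] ev[of "- K"] rv[unfolded rv_seq_def]
  proof eventually_elim
    case (elim n)
    interpret prob_space "M n" using elim by simp
    have [measurable]: "Z n \<in> borel_measurable (M n)"
      using elim by auto
    have "tail (M n) (Z n) K \<le>
        prob ({\<omega> \<in> space (M n). Z n \<omega> \<le> - K} \<union> (space (M n) - {\<omega> \<in> space (M n). Z n \<omega> \<le> K}))"
      by (intro finite_measure_mono) auto
    also have "\<dots> \<le> prob {\<omega> \<in> space (M n). Z n \<omega> \<le> - K} +
        prob (space (M n) - {\<omega> \<in> space (M n). Z n \<omega> \<le> K})"
      by (intro measure_Un_le) auto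
    also have "\<dots> = prob {\<omega> \<in> space (M n). Z n \<omega> \<le> - K} + (1 - prob {\<omega> \<in> space (M n). Z n \<omega> \<le> K})"
      by (subst prob_compl) auto
    finally show ?case using elim(1,2) K by linarith
  qed
  then show "\<exists>K. \<forall>\<^sub>F n in sequentially. tail (M n) (Z n) K < e" ..
qed

text \<open>The distribution function \<open>r\<^sup>n\<close> on \<open>[0, 1]\<close> belongs to the radius of a uniform point of the unit ball, and also to
the maximum of \<open>n\<close> independent uniform variables. It concentrates near 1 at the scale \<open>1/n\<close>, so even \<open>\<surd>n\<close> times
the distance to 1 is negligible.\<close>

lemma power_cdf_fluctuation:
  assumes M: "\<And>n. 1 \<le> n \<Longrightarrow> prob_space (M n)"
    and R: "\<And>n. 1 \<le> n \<Longrightarrow> R n \<in> borel_measurable (M n)"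
    and cdf: "\<And>n r. 1 \<le> n \<Longrightarrow> 0 < r \<Longrightarrow> r \<le> 1 \<Longrightarrow> measure (M n) {\<omega> \<in> space (M n). R n \<omega> \<le> r} = r ^ n"
  shows "vanishing M (\<lambda>n \<omega>. sqrt n * (R n \<omega> - 1))"
  unfolding vanishing_def tends_to_zero_in_probability_def
proof (intro conjI allI impI)
  show "rv_seq M (\<lambda>n \<omega>. sqrt n * (R n \<omega> - 1))"
    using M R by (intro rv_seqI) auto
  fix \<epsilon> :: real assume "0 < \<epsilon>"
  have small: "\<forall>\<^sub>F n in sequentially. 0 < 1 - \<epsilon> / sqrt (real n)"
    using \<open>0 < \<epsilon>\<close> by real_asymp
  have lim: "(\<lambda>n. (1 - \<epsilon> / sqrt (real n)) ^ n) \<longlonglongrightarrow> 0"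
  proof -
    have "\<forall>\<^sub>F n in sequentially. 0 \<le> (1 - \<epsilon> / sqrt (real n)) ^ n \<and> (1 - \<epsilon> / sqrt (real n)) ^ n \<le> exp (- \<epsilon> * sqrt n)"
      using small eventually_ge_at_top[of 1]
    proof eventually_elim
      case (elim n)
      have "(1 - \<epsilon> / sqrt (real n)) ^ n \<le> exp (- (\<epsilon> / sqrt n)) ^ n"
        using elim exp_ge_add_one_self[of "- (\<epsilon> / sqrt n)"] by (intro power_mono) auto
      also have "\<dots> = exp (- \<epsilon> * (n / sqrt n))"
        by (simp add: exp_of_nat_mult[symmetric] mult.commute)
      also have "n / sqrt n = sqrt n" by (simp add: real_div_sqrt)
      finally show ?case using elim by simp
    qed
    then have "\<forall>\<^sub>F n in sequentially. 0 \<le> (1 - \<epsilon> / sqrt (real n)) ^ n"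
      "\<forall>\<^sub>F n in sequentially. (1 - \<epsilon> / sqrt (real n)) ^ n \<le> exp (- \<epsilon> * sqrt n)"
      by (auto elim: eventually_mono)
    moreover have "(\<lambda>n. exp (- \<epsilon> * sqrt (real n))) \<longlonglongrightarrow> 0"
      using \<open>0 < \<epsilon>\<close> by real_asymp
    ultimately show ?thesis
      by (rule tendsto_sandwich[OF _ _ tendsto_const])
  qed
  have bound: "\<forall>\<^sub>F n in sequentially. tail (M n) (\<lambda>\<omega>. sqrt n * (R n \<omega> - 1)) \<epsilon> \<le> (1 - \<epsilon> / sqrt (real n)) ^ n"
    using small eventually_ge_at_top[of 1]
  proof eventually_elim
    case (elim n)
    interpret prob_space "M n" using M elim by simp
    have [measurable]: "R n \<in> borel_measurable (M n)" using R elim by simp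
    let ?E = "\<lambda>r. {\<omega> \<in> space (M n). R n \<omega> \<le> r}"
    have "tail (M n) (\<lambda>\<omega>. sqrt n * (R n \<omega> - 1)) \<epsilon> \<le> prob (?E (1 - \<epsilon> / sqrt (real n)) \<union> (space (M n) - ?E 1))"
    proof (intro finite_measure_mono subsetI)
      fix \<omega> assume "\<omega> \<in> {\<omega> \<in> space (M n). \<epsilon> < \<bar>sqrt n * (R n \<omega> - 1)\<bar>}"
      then have "\<omega> \<in> space (M n)" "\<epsilon> < sqrt n * \<bar>R n \<omega> - 1\<bar>"
        by (auto simp: abs_mult)
      moreover from this have "\<epsilon> / sqrt n < \<bar>R n \<omega> - 1\<bar>"
        using elim by (simp add: field_simps)
      ultimately show "\<omega> \<in> ?E (1 - \<epsilon> / sqrt (real n)) \<union> (space (M n) - ?E 1)"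
        by auto
    qed measurable
    also have "\<dots> \<le> prob (?E (1 - \<epsilon> / sqrt (real n))) + prob (space (M n) - ?E 1)"
      by (intro measure_Un_le) measurable
    also have "prob (space (M n) - ?E 1) = 1 - prob (?E 1)"
      by (rule prob_compl) measurable
    also have "prob (?E 1) = 1"
      using elim(2) cdf[of n 1] by simp
    also have "prob (?E (1 - \<epsilon> / sqrt (real n))) = (1 - \<epsilon> / sqrt (real n)) ^ n"
      using elim \<open>0 < \<epsilon>\<close> by (intro cdf) auto
    finally show ?case by simp
  qed
  show "(\<lambda>n. tail (M n) (\<lambda>\<omega>. sqrt n * (R n \<omega> - 1)) \<epsilon>) \<longlonglongrightarrow> 0"
    by (rule tendsto_sandwich[OF _ bound tendsto_const lim]) simp
qed

text \<open>All three properties depend on the laws only. This transfers them from a sequence of independent variables to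
the given probability spaces.\<close>

lemma
  assumes law: "\<And>n. 1 \<le> n \<Longrightarrow> distr (M n) borel (Y n) = distr (M' n) borel (Y' n)"
    and rv: "rv_seq M Y" "rv_seq M' Y'"
  shows stoch_bounded_law: "stoch_bounded M' Y' \<Longrightarrow> stoch_bounded M Y"
    and integral_iexp_law: "(\<lambda>n. \<integral>\<omega>. iexp (Y' n \<omega>) \<partial>M' n) \<longlonglongrightarrow> L \<Longrightarrow> (\<lambda>n. \<integral>\<omega>. iexp (Y n \<omega>) \<partial>M n) \<longlonglongrightarrow> L"
    and cdf_law: "(\<lambda>n. measure (M' n) {\<omega> \<in> space (M' n). Y' n \<omega> \<le> t}) \<longlonglongrightarrow> l \<Longrightarrow>
      (\<lambda>n. measure (M n) {\<omega> \<in> space (M n). Y n \<omega> \<le> t}) \<longlonglongrightarrow> l"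
proof -
  have set: "measure P {\<omega> \<in> space P. Z \<omega> \<in> S} = measure (distr P borel Z) S"
    if "Z \<in> borel_measurable P" "S \<in> sets borel" for P and Z :: "_ \<Rightarrow> real" and S
    using that by (subst measure_distr) (auto intro!: arg_cong2[where f = measure])
  have ev: "\<forall>\<^sub>F n in sequentially. Y n \<in> borel_measurable (M n) \<and> Y' n \<in> borel_measurable (M' n) \<and>
      distr (M n) borel (Y n) = distr (M' n) borel (Y' n)"
    using rv[unfolded rv_seq_def] eventually_ge_at_top[of 1] by eventually_elim (use law in auto)
  have eq: "\<forall>\<^sub>F n in sequentially. measure (M' n) {\<omega> \<in> space (M' n). Y' n \<omega> \<in> S} = measure (M n) {\<omega> \<in> space (M n). Y n \<omega> \<in> S}"
    if "S \<in> sets borel" for S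
    using ev by eventually_elim (simp add: set that)
  show "stoch_bounded M Y" if "stoch_bounded M' Y'"
    unfolding stoch_bounded_def
  proof (intro conjI allI impI rv)
    fix e :: real assume "0 < e"
    then obtain K where "\<forall>\<^sub>F n in sequentially. tail (M' n) (Y' n) K < e"
      using stoch_boundedD[OF \<open>stoch_bounded M' Y'\<close>] by blast
    with eq[of "{y. \<bar>y\<bar> > K}"] have "\<forall>\<^sub>F n in sequentially. tail (M n) (Y n) K < e"
      by (auto elim: eventually_elim2)
    then show "\<exists>K. \<forall>\<^sub>F n in sequentially. tail (M n) (Y n) K < e" ..
  qed
  show "(\<lambda>n. measure (M n) {\<omega> \<in> space (M n). Y n \<omega> \<le> t}) \<longlonglongrightarrow> l"
    if "(\<lambda>n. measure (M' n) {\<omega> \<in> space (M' n). Y' n \<omega> \<le> t}) \<longlonglongrightarrow> l"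
    by (rule Lim_transform_eventually[OF that]) (use eq[of "{..t}"] in simp)
  have "\<forall>\<^sub>F n in sequentially. (\<integral>\<omega>. iexp (Y' n \<omega>) \<partial>M' n) = (\<integral>\<omega>. iexp (Y n \<omega>) \<partial>M n)"
    using ev
  proof eventually_elim
    case (elim n)
    then have "(\<integral>\<omega>. iexp (Y n \<omega>) \<partial>M n) = (\<integral>y. iexp y \<partial>distr (M n) borel (Y n))"
      by (subst integral_distr) auto
    also have "\<dots> = (\<integral>\<omega>. iexp (Y' n \<omega>) \<partial>M' n)"
      using elim by (simp add: integral_distr)
    finally show ?case by simp
  qed
  then show "(\<lambda>n. \<integral>\<omega>. iexp (Y n \<omega>) \<partial>M n) \<longlonglongrightarrow> L" if "(\<lambda>n. \<integral>\<omega>. iexp (Y' n \<omega>) \<partial>M' n) \<longlonglongrightarrow> L"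
    by (rule Lim_transform_eventually[OF that])
qed

section \<open>Cones and \<open>p\<close>-radial densities\<close>

definition scale_n :: "nat \<Rightarrow> real \<Rightarrow> (nat \<Rightarrow> real) \<Rightarrow> nat \<Rightarrow> real"
  where "scale_n n c x = (\<lambda>i\<in>{..<n}. c * x i)"

lemma space_lborel_n: "space (lborel_n n) = extensional {..<n}"
  by (auto simp: lborel_n_def space_PiM PiE_def)

lemma lp_norm_cong:
  assumes "\<And>i. i < n \<Longrightarrow> x i = y i"
  shows "lp_norm n p x = lp_norm n p y"
proof -
  have "(\<lambda>i. \<bar>x i\<bar>) ` {..<n} = (\<lambda>i. \<bar>y i\<bar>) ` {..<n}"
    using assms by (intro image_cong) auto
  then show ?thesis using assms by (simp add: lp_norm_def)
qed

lemma lp_norm_nonneg: "1 \<le> n \<Longrightarrow> 0 \<le> lp_norm n p x"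
  by (auto simp: lp_norm_def Max_ge_iff lessThan_empty_iff intro!: exI[of _ 0])

lemma real_of_ereal_ge_1: "1 \<le> p \<Longrightarrow> p \<noteq> \<infinity> \<Longrightarrow> 1 \<le> real_of_ereal p"
  by (cases p) auto

lemma abs_le_lp_norm:
  assumes "1 \<le> p" "i < n"
  shows "\<bar>x i\<bar> \<le> lp_norm n p x"
proof (cases "p = \<infinity>")
  case True
  then show ?thesis using assms by (auto simp: lp_norm_def intro!: Max_ge)
next
  case False
  define r where "r = real_of_ereal p"
  have r: "1 \<le> r" using real_of_ereal_ge_1 assms False by (simp add: r_def)
  have "\<bar>x i\<bar> = (\<bar>x i\<bar> powr r) powr (1 / r)" using r by (simp add: powr_powr)
  also have "\<dots> \<le> (\<Sum>i<n. \<bar>x i\<bar> powr r) powr (1 / r)"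
    using r assms by (intro powr_mono2 member_le_sum) auto
  finally show ?thesis using False by (simp add: lp_norm_def r_def)
qed

lemma lp_norm_scale:
  assumes "1 \<le> n" "1 \<le> p" "0 \<le> c"
  shows "lp_norm n p (\<lambda>i. c * x i) = c * lp_norm n p x"
proof (cases "p = \<infinity>")
  case True
  have "(MAX i\<in>{..<n}. \<bar>c * x i\<bar>) = (MAX i\<in>{..<n}. c * \<bar>x i\<bar>)"
    using assms by (simp add: abs_mult)
  also have "\<dots> = c * (MAX i\<in>{..<n}. \<bar>x i\<bar>)"
    using mono_Max_commute[of "\<lambda>y. c * y" "(\<lambda>i. \<bar>x i\<bar>) ` {..<n}"] assms
    by (auto simp: mono_def mult_left_mono lessThan_empty_iff image_image)
  finally show ?thesis using True by (simp add: lp_norm_def)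
next
  case False
  have r: "1 \<le> real_of_ereal p" using real_of_ereal_ge_1 assms False by simp
  then show ?thesis using False assms
    by (simp add: lp_norm_def abs_mult powr_mult sum_distrib_left[symmetric] sum_nonneg powr_powr)
qed

lemma lp_norm_scale_n: "1 \<le> n \<Longrightarrow> 1 \<le> p \<Longrightarrow> 0 \<le> c \<Longrightarrow> lp_norm n p (scale_n n c x) = c * lp_norm n p x"
  by (subst lp_norm_scale[symmetric]) (auto simp: scale_n_def intro!: lp_norm_cong)

lemma lp_norm_measurable:
  assumes "1 \<le> n" and [measurable]: "\<And>i. i < n \<Longrightarrow> (\<lambda>\<omega>. X \<omega> i) \<in> borel_measurable M"
  shows "(\<lambda>\<omega>. lp_norm n p (X \<omega>)) \<in> borel_measurable M"
proof (cases "p = \<infinity>")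
  case True
  have "(\<lambda>\<omega>. MAX i\<in>{..<n}. \<bar>X \<omega> i\<bar>) \<in> borel_measurable M"
    by (rule borel_measurable_Max) auto
  then show ?thesis using True by (simp add: lp_norm_def)
next
  case False
  have "(\<lambda>\<omega>. (\<Sum>i<n. \<bar>X \<omega> i\<bar> powr real_of_ereal p) powr (1 / real_of_ereal p)) \<in> borel_measurable M"
    by measurable
  then show ?thesis using False by (simp add: lp_norm_def)
qed

lemma component_measurable_lborel_n [measurable]: "i < n \<Longrightarrow> (\<lambda>x. x i) \<in> borel_measurable (lborel_n n)"
  unfolding lborel_n_def by (rule measurable_compose[OF measurable_component_singleton]) auto

lemma lp_norm_measurable_lborel_n [measurable]:
  "1 \<le> n \<Longrightarrow> lp_norm n p \<in> borel_measurable (lborel_n n)"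
  using lp_norm_measurable[of n "\<lambda>x. x" "lborel_n n" p] by simp

lemma measurable_lborel_nI:
  assumes "\<And>i. i < n \<Longrightarrow> (\<lambda>\<omega>. f \<omega> i) \<in> borel_measurable M"
  shows "(\<lambda>\<omega>. \<lambda>i\<in>{..<n}. f \<omega> i) \<in> measurable M (lborel_n n)"
  unfolding lborel_n_def using assms by (intro measurable_restrict) auto

lemma scale_n_measurable [measurable]: "scale_n n c \<in> measurable (lborel_n n) (lborel_n n)"
  unfolding scale_n_def[abs_def] by (intro measurable_lborel_nI) measurable

interpretation lborel_n: product_sigma_finite "\<lambda>_::nat. lborel :: real measure"
  by unfold_locales

text \<open>It suffices to compare the two measures on boxes, where each of the \<open>n\<close> sides contributes a factor \<open>c\<close>.\<close>

lemma density_distr_scale_n: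
  assumes "0 < c"
  shows "density (distr (lborel_n n) (lborel_n n) (scale_n n c)) (\<lambda>_. ennreal (c ^ n)) = lborel_n n"
  unfolding lborel_n_def
proof (rule lborel_n.PiM_eqI)
  fix A :: "nat \<Rightarrow> real set" assume "\<And>i. i \<in> {..<n} \<Longrightarrow> A i \<in> sets lborel"
  then have A[measurable]: "\<And>i. i < n \<Longrightarrow> A i \<in> sets borel" by simp
  have PiE: "Pi\<^sub>E {..<n} A \<in> sets (lborel_n n)"
    unfolding lborel_n_def by (rule sets_PiM_I_finite) auto
  have vim: "(\<lambda>x. c * x) -` A i \<in> sets borel" if "i < n" for i
    using measurable_sets[OF borel_measurable_times[OF borel_measurable_const measurable_ident] A[OF that]]
    by simp
  have "emeasure (density (distr (lborel_n n) (lborel_n n) (scale_n n c)) (\<lambda>_. ennreal (c ^ n))) (Pi\<^sub>E {..<n} A) =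
      ennreal (c ^ n) * emeasure (lborel_n n) (scale_n n c -` Pi\<^sub>E {..<n} A \<inter> space (lborel_n n))"
    using PiE by (simp add: emeasure_density nn_integral_cmult_indicator emeasure_distr)
  also have "scale_n n c -` Pi\<^sub>E {..<n} A \<inter> space (lborel_n n) = (\<Pi>\<^sub>E i\<in>{..<n}. (\<lambda>x. c * x) -` A i)"
    by (auto simp: scale_n_def space_lborel_n PiE_def Pi_def)
  also have "emeasure (lborel_n n) (\<Pi>\<^sub>E i\<in>{..<n}. (\<lambda>x. c * x) -` A i) =
      (\<Prod>i<n. emeasure lborel ((\<lambda>x. c * x) -` A i))"
    unfolding lborel_n_def using vim by (subst lborel_n.emeasure_PiM) auto
  also have "ennreal (c ^ n) * \<dots> = (\<Prod>i<n. ennreal c * emeasure lborel ((\<lambda>x. c * x) -` A i))"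
    using assms by (simp add: prod.distrib ennreal_power[symmetric])
  also have "\<dots> = (\<Prod>i<n. emeasure lborel (A i))"
  proof (intro prod.cong refl)
    fix i assume "i \<in> {..<n}"
    then have [measurable]: "A i \<in> sets borel" using A by simp
    have "emeasure lborel (A i) = emeasure (density (distr lborel borel ((*) c)) (\<lambda>_. \<bar>c\<bar>)) (A i)"
      using lborel_distr_mult'[of c] assms by simp
    also have "\<dots> = ennreal c * emeasure lborel ((\<lambda>x. c * x) -` A i)"
      using assms by (simp add: emeasure_density nn_integral_cmult_indicator emeasure_distr)
    finally show "ennreal c * emeasure lborel ((\<lambda>x. c * x) -` A i) = emeasure lborel (A i)" by simp
  qed
  finally show "emeasure (density (distr (Pi\<^sub>M {..<n} (\<lambda>_. lborel)) (Pi\<^sub>M {..<n} (\<lambda>_. lborel)) (scale_n n c))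
      (\<lambda>_. ennreal (c ^ n))) (Pi\<^sub>E {..<n} A) = (\<Prod>i<n. emeasure lborel (A i))"
    unfolding lborel_n_def .
qed auto

lemma emeasure_scale_n:
  assumes "0 < c" "A \<in> sets (lborel_n n)"
  shows "ennreal (c ^ n) * emeasure (lborel_n n) (scale_n n c -` A \<inter> space (lborel_n n)) = emeasure (lborel_n n) A"
  by (subst (3) density_distr_scale_n[OF assms(1), symmetric])
    (use assms in \<open>simp add: emeasure_density nn_integral_cmult_indicator emeasure_distr\<close>)

definition cone :: "nat \<Rightarrow> (nat \<Rightarrow> real) set \<Rightarrow> bool"
  where "cone n A \<longleftrightarrow> A \<in> sets (lborel_n n) \<and>
    (\<forall>x\<in>space (lborel_n n). \<forall>c>0. scale_n n c x \<in> A \<longleftrightarrow> x \<in> A)"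

definition cone_vol :: "nat \<Rightarrow> ereal \<Rightarrow> (nat \<Rightarrow> real) set \<Rightarrow> ennreal"
  where "cone_vol n p A = emeasure (lborel_n n) (A \<inter> lp_ball n p)"

definition radial_measure :: "nat \<Rightarrow> ereal \<Rightarrow> (nat \<Rightarrow> real) set \<Rightarrow> real measure"
  where "radial_measure n p A = distr (density (lborel_n n) (indicator A)) borel (lp_norm n p)"

lemma cone_space: "cone n (space (lborel_n n))"
  using sets.top[of "lborel_n n"] by (auto simp: cone_def scale_n_def space_lborel_n)

lemma lp_ball_sets [measurable]: "1 \<le> n \<Longrightarrow> lp_ball n p \<in> sets (lborel_n n)"
  unfolding lp_ball_def by measurable

lemma cone_vol_finite:
  assumes "1 \<le> n" "1 \<le> p"
  shows "cone_vol n p A < \<infinity>"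
proof -
  have "cone_vol n p A \<le> emeasure (lborel_n n) (Pi\<^sub>E {..<n} (\<lambda>_. {-1..1}))"
    unfolding cone_vol_def
  proof (intro emeasure_mono)
    show "Pi\<^sub>E {..<n} (\<lambda>_. {-1..1}) \<in> sets (lborel_n n)"
      unfolding lborel_n_def by (rule sets_PiM_I_finite) auto
    show "A \<inter> lp_ball n p \<subseteq> Pi\<^sub>E {..<n} (\<lambda>_. {-1..1})"
    proof
      fix x assume x: "x \<in> A \<inter> lp_ball n p"
      have "\<bar>x i\<bar> \<le> 1" if "i < n" for i
        using abs_le_lp_norm[OF assms(2) that, of x] x by (auto simp: lp_ball_def)
      then show "x \<in> Pi\<^sub>E {..<n} (\<lambda>_. {-1..1})"
        using x by (auto simp: lp_ball_def space_lborel_n PiE_def abs_le_iff)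
    qed
  qed
  also have "\<dots> = (\<Prod>i<n. 2)"
    unfolding lborel_n_def by (subst lborel_n.emeasure_PiM) auto
  also have "\<dots> < \<infinity>" by (simp add: power_less_top_ennreal)
  finally show ?thesis .
qed

text \<open>The points of \<open>A\<close> of norm at most \<open>r\<close> form the \<open>r\<close>-fold multiple of the part of \<open>A\<close> in the unit ball.\<close>

lemma emeasure_radial_measure:
  assumes n: "1 \<le> n" and p: "1 \<le> p" and A: "cone n A"
  shows "emeasure (radial_measure n p A) {..r} = ennreal (max r 0 ^ n) * cone_vol n p A"
proof -
  have [measurable]: "A \<in> sets (lborel_n n)" using A by (simp add: cone_def)
  have sub: "A \<subseteq> space (lborel_n n)" by (rule sets.sets_into_space) measurable
  note n[measurable]
  have eq: "emeasure (radial_measure n p A) {..r} = emeasure (lborel_n n) {x \<in> A. lp_norm n p x \<le> r}" for r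
  proof -
    have "emeasure (radial_measure n p A) {..r} =
        emeasure (density (lborel_n n) (indicator A)) {x \<in> space (lborel_n n). lp_norm n p x \<le> r}"
      using n unfolding radial_measure_def by (subst emeasure_distr) (auto intro!: arg_cong2[where f = emeasure])
    also have "\<dots> = emeasure (lborel_n n) (A \<inter> {x \<in> space (lborel_n n). lp_norm n p x \<le> r})"
      using n by (subst emeasure_density) (auto simp: indicator_inter_arith[symmetric])
    also have "A \<inter> {x \<in> space (lborel_n n). lp_norm n p x \<le> r} = {x \<in> A. lp_norm n p x \<le> r}"
      using sub by auto
    finally show ?thesis .
  qed
  have pos: "emeasure (radial_measure n p A) {..r} = ennreal (r ^ n) * cone_vol n p A" if "0 < r" for r
  proof -
    have set: "scale_n n (1 / r) -` (A \<inter> lp_ball n p) \<inter> space (lborel_n n) = {x \<in> A. lp_norm n p x \<le> r}"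
    proof -
      have "scale_n n (1 / r) x \<in> A \<inter> lp_ball n p \<longleftrightarrow> x \<in> A \<and> lp_norm n p x \<le> r"
        if "x \<in> space (lborel_n n)" for x
      proof -
        have "scale_n n (1 / r) x \<in> space (lborel_n n)" by (simp add: scale_n_def space_lborel_n)
        moreover have "scale_n n (1 / r) x \<in> A \<longleftrightarrow> x \<in> A"
          using A that \<open>0 < r\<close> unfolding cone_def by (metis zero_less_divide_1_iff)
        ultimately show ?thesis
          using \<open>0 < r\<close> by (simp add: lp_ball_def lp_norm_scale_n[OF n p] divide_le_eq)
      qed
      then show ?thesis using sub by auto
    qed
    have "cone_vol n p A = ennreal ((1 / r) ^ n) * emeasure (lborel_n n) {x \<in> A. lp_norm n p x \<le> r}"
      unfolding cone_vol_def set[symmetric] using n \<open>0 < r\<close> by (subst emeasure_scale_n) auto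
    then have "ennreal (r ^ n) * cone_vol n p A =
        ennreal (r ^ n * (1 / r) ^ n) * emeasure (lborel_n n) {x \<in> A. lp_norm n p x \<le> r}"
      using \<open>0 < r\<close> by (simp add: ennreal_mult mult.assoc)
    also have "r ^ n * (1 / r) ^ n = 1" using \<open>0 < r\<close> by (simp add: power_mult_distrib[symmetric])
    finally show ?thesis by (simp add: eq)
  qed
  show ?thesis
  proof (cases "0 < r")
    case True
    then show ?thesis by (simp add: pos)
  next
    case False
    \<comment> \<open>Points of norm at most \<open>r \<le> 0\<close> form a null set, as one sees by letting the radius \<open>e > 0\<close> tend to 0.\<close>
    define v where "v = enn2real (cone_vol n p A)"
    have v: "cone_vol n p A = ennreal v"
      using cone_vol_finite[OF n p, of A] by (simp add: v_def)
    have "emeasure (radial_measure n p A) {..r} \<le> ennreal (e ^ n) * cone_vol n p A" if "0 < e" for e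
      unfolding pos[OF that, symmetric] using that False
      by (intro emeasure_mono) (auto simp: radial_measure_def)
    then have "\<forall>\<^sub>F e in at_right 0. emeasure (radial_measure n p A) {..r} \<le> ennreal (e ^ n) * cone_vol n p A"
      by (auto simp: eventually_at_right_less intro: eventually_mono[OF eventually_at_right_less])
    moreover have "((\<lambda>e. ennreal (e ^ n) * cone_vol n p A) \<longlongrightarrow> ennreal (0 ^ n) * cone_vol n p A) (at_right 0)"
      unfolding v by (subst (1 2) ennreal_mult''[symmetric])
        (auto simp: v_def intro!: tendsto_ennrealI tendsto_intros)
    ultimately have "emeasure (radial_measure n p A) {..r} \<le> ennreal (0 ^ n) * cone_vol n p A"
      by (intro tendsto_lowerbound) auto
    then show ?thesis using False n by (simp add: max_def power_0_left)
  qed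
qed

lemma cone_vol_space_pos:
  assumes "1 \<le> n" "1 \<le> p"
  shows "0 < cone_vol n p (space (lborel_n n))"
proof (rule ccontr)
  assume "\<not> ?thesis"
  then have 0: "cone_vol n p (space (lborel_n n)) = 0" by (simp add: zero_less_iff_neq_zero)
  have "emeasure (radial_measure n p (space (lborel_n n))) (\<Union>k::nat. {..real k}) = 0"
    using emeasure_radial_measure[OF assms cone_space] 
    by (intro emeasure_UN_eq_0) (auto simp: 0 radial_measure_def)
  also have "(\<Union>k::nat. {..real k}) = UNIV" using real_arch_simple by auto
  finally have "emeasure (density (lborel_n n) (indicator (space (lborel_n n)))) (space (lborel_n n)) = 0"
    unfolding radial_measure_def using assms by (subst (asm) emeasure_distr) auto
  then have "emeasure (lborel_n n) (space (lborel_n n)) = 0"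
    by (subst (asm) emeasure_density) (auto simp: indicator_inter_arith[symmetric])
  moreover have "emeasure (lborel_n n) (space (lborel_n n)) = (\<Prod>i<n. \<infinity>)"
    unfolding lborel_n_def space_PiM by (subst lborel_n.emeasure_PiM) auto
  ultimately show False using assms by (simp add: power_eq_top_ennreal)
qed

lemma radial_measure_proportional:
  assumes n: "1 \<le> n" and p: "1 \<le> p" and A: "cone n A"
  shows "scale_measure (cone_vol n p (space (lborel_n n))) (radial_measure n p A) =
    scale_measure (cone_vol n p A) (radial_measure n p (space (lborel_n n)))"
    (is "?L = ?R")
proof (rule measure_eqI_generator_eq[where E = "range atMost" and \<Omega> = UNIV and A = "\<lambda>i. {..real i}"])
  show "Int_stable (range (atMost :: real \<Rightarrow> _))" by (auto simp: Int_stable_def)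
  show "emeasure ?L X = emeasure ?R X" if "X \<in> range atMost" for X
    using that emeasure_radial_measure[OF n p A] emeasure_radial_measure[OF n p cone_space]
    by (auto simp: mult_ac)
  show "sets ?L = sigma_sets UNIV (range atMost)" "sets ?R = sigma_sets UNIV (range atMost)"
    by (simp_all add: radial_measure_def borel_eq_atMost)
  show "emeasure ?L {..real i} \<noteq> \<infinity>" for i
    using emeasure_radial_measure[OF n p A] cone_vol_finite[OF n p]
    by (simp add: ennreal_mult_eq_top_iff less_top)
qed (auto simp: real_arch_simple)

text \<open>If the density is \<open>G (\<parallel>x\<parallel>\<^sub>p)\<close>, then the probability of a cone \<open>A\<close> is the integral of \<open>G\<close> with respect to the
radial measure of \<open>A\<close>. The radial measures of all cones are proportional, and the cone consisting of the whole
space has probability 1; this eliminates \<open>G\<close>.\<close>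

lemma emeasure_cone_p_radial:
  assumes n: "1 \<le> n" and p: "1 \<le> p" and A: "cone n A" and M: "prob_space M"
    and X: "continuous_p_radial n p M X"
  shows "emeasure M {\<omega> \<in> space M. X \<omega> \<in> A} = cone_vol n p A / cone_vol n p (space (lborel_n n))"
proof -
  interpret prob_space M by fact
  obtain f g where f: "distributed M (lborel_n n) X f"
    and g: "\<And>x. x \<in> space (lborel_n n) \<Longrightarrow> f x = g (lp_norm n p x)"
    using X by (auto simp: continuous_p_radial_def p_radial_fun_def)
  have fm[measurable]: "f \<in> borel_measurable (lborel_n n)" and Xm[measurable]: "X \<in> measurable M (lborel_n n)"
    and Xd: "distr M (lborel_n n) X = density (lborel_n n) f"
    using f by (auto simp: distributed_def)
  \<comment> \<open>The function \<open>g\<close> need not be measurable. Evaluating \<open>f\<close> on a coordinate axis gives a measurable substitute \<open>G\<close>.\<close>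
  define e where "e r = (\<lambda>i\<in>{..<n}. if i = 0 then r else 0)" for r :: real
  have e[measurable]: "e \<in> measurable borel (lborel_n n)"
    unfolding e_def by (rule measurable_lborel_nI) auto
  have norm_e: "lp_norm n p (e r) = r" if "0 \<le> r" for r
  proof -
    have "lp_norm n p (e r) = lp_norm n p (\<lambda>i. r * (if i = 0 then 1 else 0))"
      by (rule lp_norm_cong) (auto simp: e_def)
    also have "\<dots> = r * lp_norm n p (\<lambda>i. if i = 0 then 1 else 0)"
      by (rule lp_norm_scale[OF n p that])
    also have "lp_norm n p (\<lambda>i. if i = 0 then 1 else 0) = 1"
    proof (cases "p = \<infinity>")
      case True
      have "(MAX i\<in>{..<n}. \<bar>if i = 0 then 1 else 0 :: real\<bar>) = 1"
        using n by (intro Max_eqI) (auto simp: image_iff intro!: bexI[of _ 0])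
      then show ?thesis using True by (simp add: lp_norm_def)
    next
      case False
      have "(\<Sum>i<n. \<bar>if i = 0 then 1 else 0 :: real\<bar> powr real_of_ereal p) = (\<Sum>i<n. if i = 0 then 1 else 0)"
        by (intro sum.cong) auto
      then show ?thesis using False n by (simp add: lp_norm_def)
    qed
    finally show ?thesis by simp
  qed
  define G where "G r = f (e r)" for r
  have [measurable]: "G \<in> borel_measurable borel" unfolding G_def by measurable
  have fG: "f x = G (lp_norm n p x)" if "x \<in> space (lborel_n n)" for x
  proof -
    have "e (lp_norm n p x) \<in> space (lborel_n n)" by (simp add: e_def space_lborel_n)
    then show ?thesis
      using g[OF that] g[of "e (lp_norm n p x)"] norm_e[OF lp_norm_nonneg[OF n]] by (simp add: G_def)
  qed
  have int: "emeasure M {\<omega> \<in> space M. X \<omega> \<in> B} = (\<integral>\<^sup>+r. G r \<partial>radial_measure n p B)"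
    if [measurable]: "B \<in> sets (lborel_n n)" for B
  proof -
    have "emeasure M {\<omega> \<in> space M. X \<omega> \<in> B} = emeasure (distr M (lborel_n n) X) B"
      by (subst emeasure_distr) (auto intro!: arg_cong2[where f = emeasure])
    also have "\<dots> = (\<integral>\<^sup>+x. f x * indicator B x \<partial>lborel_n n)"
      unfolding Xd by (subst emeasure_density) auto
    also have "\<dots> = (\<integral>\<^sup>+x. indicator B x * G (lp_norm n p x) \<partial>lborel_n n)"
      by (intro nn_integral_cong) (simp add: fG mult.commute)
    also have "\<dots> = (\<integral>\<^sup>+r. G r \<partial>radial_measure n p B)"
      unfolding radial_measure_def using n
      by (subst nn_integral_distr) (auto simp: nn_integral_density)
    finally show ?thesis .
  qed
  let ?V = "cone_vol n p (space (lborel_n n))"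
  have Am: "A \<in> sets (lborel_n n)" using A by (simp add: cone_def)
  have "?V * emeasure M {\<omega> \<in> space M. X \<omega> \<in> A} = (\<integral>\<^sup>+r. G r \<partial>scale_measure ?V (radial_measure n p A))"
    by (simp add: int[OF Am] nn_integral_scale_measure radial_measure_def)
  also have "\<dots> = cone_vol n p A * emeasure M {\<omega> \<in> space M. X \<omega> \<in> space (lborel_n n)}"
    unfolding radial_measure_proportional[OF n p A]
    by (simp add: int nn_integral_scale_measure radial_measure_def)
  also have "{\<omega> \<in> space M. X \<omega> \<in> space (lborel_n n)} = space M"
    using measurable_space[OF Xm] by auto
  finally have "?V * emeasure M {\<omega> \<in> space M. X \<omega> \<in> A} = cone_vol n p A"
    by (simp add: emeasure_space_1)
  moreover have "emeasure M {\<omega> \<in> space M. X \<omega> \<in> A} * ?V / ?V = emeasure M {\<omega> \<in> space M. X \<omega> \<in> A}"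
    using cone_vol_space_pos[OF n p] cone_vol_finite[OF n p, of "space (lborel_n n)"]
    by (intro ennreal_mult_divide_eq) auto
  ultimately show ?thesis by (simp add: mult.commute)
qed

lemma distr_homogeneous_p_radial:
  assumes n: "1 \<le> n" and p: "1 \<le> p"
    and M: "prob_space M" "continuous_p_radial n p M X"
    and M': "prob_space M'" "continuous_p_radial n p M' X'"
    and h[measurable]: "h \<in> borel_measurable (lborel_n n)"
    and hom: "\<And>c x. 0 < c \<Longrightarrow> x \<in> space (lborel_n n) \<Longrightarrow> h (scale_n n c x) = h x"
  shows "distr M borel (\<lambda>\<omega>. h (X \<omega>)) = distr M' borel (\<lambda>\<omega>. h (X' \<omega>))"
proof (rule measure_eqI)
  have [measurable]: "X \<in> measurable M (lborel_n n)" "X' \<in> measurable M' (lborel_n n)"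
    using M(2) M'(2) by (auto simp: continuous_p_radial_def distributed_def)
  have Xs: "X \<omega> \<in> space (lborel_n n)" if "\<omega> \<in> space M" for \<omega>
    using that by (rule measurable_space[rotated]) measurable
  have Xs': "X' \<omega> \<in> space (lborel_n n)" if "\<omega> \<in> space M'" for \<omega>
    using that by (rule measurable_space[rotated]) measurable
  fix S assume "S \<in> sets (distr M borel (\<lambda>\<omega>. h (X \<omega>)))"
  then have [measurable]: "S \<in> sets borel" by simp
  define A where "A = h -` S \<inter> space (lborel_n n)"
  have "A \<in> sets (lborel_n n)" unfolding A_def by measurable
  moreover have "scale_n n c x \<in> A \<longleftrightarrow> x \<in> A" if "0 < c" "x \<in> space (lborel_n n)" for c x
    using hom[OF that] that by (auto simp: A_def) (auto simp: scale_n_def space_lborel_n)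
  ultimately have A: "cone n A"
    by (auto simp: cone_def)
  have "emeasure (distr M borel (\<lambda>\<omega>. h (X \<omega>))) S = emeasure M {\<omega> \<in> space M. X \<omega> \<in> A}"
    using Xs by (subst emeasure_distr) (auto simp: A_def intro!: arg_cong2[where f = emeasure])
  also have "\<dots> = emeasure M' {\<omega> \<in> space M'. X' \<omega> \<in> A}"
    by (simp add: emeasure_cone_p_radial[OF n p A M] emeasure_cone_p_radial[OF n p A M'])
  also have "\<dots> = emeasure (distr M' borel (\<lambda>\<omega>. h (X' \<omega>))) S"
    using Xs' by (subst emeasure_distr) (auto simp: A_def intro!: arg_cong2[where f = emeasure])
  finally show "emeasure (distr M borel (\<lambda>\<omega>. h (X \<omega>))) S = emeasure (distr M' borel (\<lambda>\<omega>. h (X' \<omega>))) S" .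
qed simp

lemma uniform_continuous_p_radial:
  assumes n: "1 \<le> n" and X: "X \<in> measurable M (lborel_n n)" "distr M (lborel_n n) X = unif_lp_ball n p"
  shows "continuous_p_radial n p M X"
  unfolding continuous_p_radial_def
proof (intro exI conjI)
  let ?f = "\<lambda>x. indicator (lp_ball n p) x / emeasure (lborel_n n) (lp_ball n p) :: ennreal"
  note [measurable] = n
  show "distributed M (lborel_n n) X ?f"
    using X n unfolding distributed_def unif_lp_ball_def uniform_measure_def by simp
  show "p_radial_fun n p ?f"
    unfolding p_radial_fun_def
    by (intro exI[of _ "\<lambda>r. (if r \<le> 1 then 1 else 0) / emeasure (lborel_n n) (lp_ball n p)"])
      (auto simp: lp_ball_def indicator_def)
qed

lemma uniform_lp_norm_cdf:
  assumes n: "1 \<le> n" and p: "1 \<le> p" and M: "prob_space M"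
    and X[measurable]: "X \<in> measurable M (lborel_n n)" "distr M (lborel_n n) X = unif_lp_ball n p"
    and r: "0 < r" "r \<le> 1"
  shows "measure M {\<omega> \<in> space M. lp_norm n p (X \<omega>) \<le> r} = r ^ n"
proof -
  note [measurable] = n
  let ?V = "cone_vol n p (space (lborel_n n))"
  have V: "emeasure (lborel_n n) (lp_ball n p) = ?V"
    unfolding cone_vol_def by (rule arg_cong2[where f = emeasure]) (auto simp: lp_ball_def)
  have "emeasure M {\<omega> \<in> space M. lp_norm n p (X \<omega>) \<le> r} =
      emeasure (distr M (lborel_n n) X) {x \<in> space (lborel_n n). lp_norm n p x \<le> r}"
    using n measurable_space[OF X(1)] by (subst emeasure_distr) (auto intro!: arg_cong2[where f = emeasure])
  also have "\<dots> = emeasure (lborel_n n) (lp_ball n p \<inter> {x \<in> space (lborel_n n). lp_norm n p x \<le> r}) / ?V"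
    unfolding X(2) unif_lp_ball_def using n by (subst emeasure_uniform_measure) (auto simp: V)
  also have "lp_ball n p \<inter> {x \<in> space (lborel_n n). lp_norm n p x \<le> r} = {x \<in> space (lborel_n n). lp_norm n p x \<le> r}"
    using r by (auto simp: lp_ball_def)
  also have "emeasure (lborel_n n) {x \<in> space (lborel_n n). lp_norm n p x \<le> r} =
      emeasure (radial_measure n p (space (lborel_n n))) {..r}"
    unfolding radial_measure_def using n
    by (subst emeasure_distr) (auto simp: emeasure_density indicator_inter_arith[symmetric]
        intro!: arg_cong2[where f = emeasure])
  also have "\<dots> / ?V = ennreal (r ^ n)"
    using emeasure_radial_measure[OF n p cone_space, of r] r cone_vol_space_pos[OF n p] cone_vol_finite[OF n p]
    by (simp add: ennreal_mult_divide_eq less_top zero_less_iff_neq_zero)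
  finally show ?thesis using r by (simp add: measure_def)
qed

section \<open>The generalized normal distribution\<close>

lemma Gamma_plus1_pos: "0 < z \<Longrightarrow> Gamma (1 + z) = z * Gamma z" for z :: real
  using Gamma_plus1[of z] by (auto simp: add.commute nonpos_Ints_def)

text \<open>The substitution \<open>x = (r t)\<^bsup>1/r\<^esup>\<close> turns the Gamma integral into an absolute moment.\<close>

lemma Gamma_substitution_powr:
  fixes r q :: real
  assumes r: "1 \<le> r" and q: "0 \<le> q"
  shows "has_bochner_integral lborel (\<lambda>x. indicator {0..} x *\<^sub>R (\<bar>x\<bar> powr q * exp (- (\<bar>x\<bar> powr r / r))))
    (r powr ((q + 1) / r - 1) * Gamma ((q + 1) / r))"
proof -
  define s where "s = (q + 1) / r"
  have s: "0 < s" unfolding s_def using r q by (intro divide_pos_pos) auto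
  define f where "f x = x powr q * exp (- (x powr r / r))" for x :: real
  define g where "g t = (r * t) powr (1 / r)" for t :: real
  define g' where "g' t = (r * t) powr (1 / r - 1)" for t :: real
  have G: "has_bochner_integral lborel (\<lambda>t. indicator {0..} t * t powr (s - 1) / exp t) (Gamma s)"
    using Gamma_conv_nn_integral_real[OF s] s
    by (intro has_bochner_integral_nn_integral) (auto simp: Gamma_real_nonneg)
  have fg: "f (g t) * g' t = r powr (s - 1) * (t powr (s - 1) / exp t)" if "0 < t" for t
  proof -
    have "(g t) powr r = r * t" using that r by (simp add: g_def powr_powr)
    then have "f (g t) * g' t = ((g t) powr q * g' t) * exp (- t)"
      using r by (simp add: f_def)
    also have "(g t) powr q * g' t = (r * t) powr (q / r + (1 / r - 1))"
      using that r by (simp add: g_def g'_def powr_powr powr_add[symmetric])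
    also have "q / r + (1 / r - 1) = s - 1" by (simp add: s_def add_divide_distrib)
    finally show ?thesis
      using that r by (simp add: powr_mult exp_minus divide_inverse mult.assoc)
  qed
  have "has_bochner_integral lborel
      (\<lambda>t. r powr (s - 1) * (indicator {0..} t * t powr (s - 1) / exp t)) (r powr (s - 1) * Gamma s)"
    by (intro has_bochner_integral_mult_right G)
  also have "?this \<longleftrightarrow> has_bochner_integral lborel
      (\<lambda>t. indicator {0<..} t *\<^sub>R (f (g t) * g' t)) (r powr (s - 1) * Gamma s)"
    by (rule has_bochner_integral_cong_AE; (simp add: f_def g_def g'_def; fail)?)
      (use AE_lborel_singleton[of "0::real"] in eventually_elim, auto simp: fg split: split_indicator)
  finally have FG: "has_bochner_integral lborel
      (\<lambda>t. indicator {0<..} t *\<^sub>R (f (g t) * g' t)) (r powr (s - 1) * Gamma s)" .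
  have lims: "((ereal \<circ> g \<circ> real_of_ereal) \<longlongrightarrow> ereal 0) (at_right (ereal 0))"
    "((ereal \<circ> g \<circ> real_of_ereal) \<longlongrightarrow> \<infinity>) (at_left \<infinity>)"
  proof -
    have "(g \<longlongrightarrow> 0) (at_right 0)"
      unfolding g_def using r by real_asymp
    then show "((ereal \<circ> g \<circ> real_of_ereal) \<longlongrightarrow> ereal 0) (at_right (ereal 0))"
      by (simp only: ereal_tendsto_simps)
    have "filterlim g at_top at_top"
      unfolding g_def using r by real_asymp
    then show "((ereal \<circ> g \<circ> real_of_ereal) \<longlongrightarrow> \<infinity>) (at_left \<infinity>)"
      by (simp only: ereal_tendsto_simps)
  qed
  have deriv: "DERIV g x :> g' x" if "0 < x" for x
    unfolding g_def g'_def using that r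
    by (auto intro!: derivative_eq_intros simp: powr_diff field_simps)
  have fgint: "set_integrable lborel (einterval (ereal 0) \<infinity>) (\<lambda>x. f (g x) * g' x)"
    using FG by (simp add: set_integrable_def has_bochner_integral_iff)
  have gpos: "0 < g x" if "0 < x" for x using that r by (simp add: g_def)
  have cont_f: "isCont f (g x)" if "ereal 0 < ereal x" for x
    using gpos[of x] that r unfolding f_def by (intro continuous_intros) auto
  have cont_g': "isCont g' x" if "ereal 0 < ereal x" for x
    using that r unfolding g'_def by (intro continuous_intros) auto
  note sub = interval_integral_substitution_nonneg[of "ereal 0" \<infinity> g g' f, OF _ deriv cont_f cont_g' _ _ lims fgint]
  have 1: "set_integrable lborel (einterval (ereal 0) \<infinity>) f"
    by (rule sub(1)) (auto simp: f_def g'_def)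
  have 2: "(LBINT x=ereal 0..\<infinity>. f x) = (LBINT x=ereal 0..\<infinity>. f (g x) * g' x)"
    by (rule sub(2)) (auto simp: f_def g'_def)
  have "(LBINT x=ereal 0..\<infinity>. f (g x) * g' x) = r powr (s - 1) * Gamma s"
    using FG by (simp add: interval_integral_to_infinity_eq set_lebesgue_integral_def has_bochner_integral_iff)
  then have "has_bochner_integral lborel (\<lambda>x. indicator {0<..} x *\<^sub>R f x) (r powr (s - 1) * Gamma s)"
    using 1 2 by (simp add: interval_integral_to_infinity_eq set_lebesgue_integral_def has_bochner_integral_iff
        set_integrable_def)
  also have "?this \<longleftrightarrow> ?thesis"
    unfolding s_def
    by (rule has_bochner_integral_cong_AE; (simp add: f_def; fail)?)
      (use AE_lborel_singleton[of "0::real"] in eventually_elim, auto simp: f_def split: split_indicator)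
  finally show ?thesis .
qed

text \<open>The density \<open>f\<^sub>p\<close>; for \<open>p = \<infinity>\<close> its limit, the uniform density on \<open>[-1, 1]\<close>.\<close>

definition gen_normal_density :: "ereal \<Rightarrow> real \<Rightarrow> real"
  where "gen_normal_density p x =
    (if p = \<infinity> then indicator {-1..1} x / 2
     else let r = real_of_ereal p in exp (- (\<bar>x\<bar> powr r / r)) / (2 * (r powr (1 / r) * Gamma (1 + 1 / r))))"

definition gen_normal :: "ereal \<Rightarrow> real measure"
  where "gen_normal p = density lborel (\<lambda>x. ennreal (gen_normal_density p x))"

lemma gen_normal_density_nonneg:
  assumes "1 \<le> p"
  shows "0 \<le> gen_normal_density p x"
proof (cases "p = \<infinity>")
  case False
  then have "0 < Gamma (1 + 1 / real_of_ereal p)"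
    using real_of_ereal_ge_1[OF assms] by (intro Gamma_real_pos add_pos_nonneg) auto
  then show ?thesis by (simp add: gen_normal_density_def Let_def)
qed (simp add: gen_normal_density_def)

lemma gen_normal_density_measurable [measurable]: "gen_normal_density p \<in> borel_measurable borel"
  unfolding gen_normal_density_def[abs_def] Let_def by measurable

lemma abs_moment_pos:
  assumes "1 \<le> p" "0 \<le> q"
  shows "0 < abs_moment p q"
proof (cases "p = \<infinity>")
  case False
  define r where "r = real_of_ereal p"
  have r: "1 \<le> r" using real_of_ereal_ge_1 assms False by (simp add: r_def)
  have "0 < 1 + (q + 1) / r" "0 < 1 + 1 / r"
    using assms r by (auto intro!: add_pos_nonneg)
  then show ?thesis
    using False r assms by (simp add: abs_moment_def Let_def r_def[symmetric] Gamma_real_pos)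
qed (use assms in \<open>simp add: abs_moment_def\<close>)

lemma abs_moment_eq:
  assumes "1 \<le> p" "p \<noteq> \<infinity>" "0 \<le> q"
  defines "r \<equiv> real_of_ereal p"
  shows "abs_moment p q = r powr (q / r) * Gamma ((q + 1) / r) / Gamma (1 / r)"
proof -
  have r: "1 \<le> r" using real_of_ereal_ge_1 assms by simp
  from Gamma_plus1_pos[of "(q + 1) / r"] Gamma_plus1_pos[of "1 / r"] show ?thesis
    using assms r by (simp add: abs_moment_def Let_def)
qed

lemma gen_normal_density_moment:
  assumes p: "1 \<le> p" and q: "0 \<le> q"
  shows "has_bochner_integral lborel (\<lambda>x. \<bar>x\<bar> powr q * gen_normal_density p x) (abs_moment p q)"
proof (cases "p = \<infinity>")
  case True
  have "has_bochner_integral lborel (\<lambda>x. indicator {0..1} x * x powr q) (1 / (q + 1))"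
    using nn_integral_has_integral_lebesgue[OF _ has_integral_powr_from_0[of q 1]] q
    by (intro has_bochner_integral_nn_integral) auto
  then have "has_bochner_integral lborel (\<lambda>x. (1/2) * (indicator {0..1} x * x powr q)) ((1/2) * (1 / (q + 1)))"
    by (rule has_bochner_integral_mult_right)
  also have "(\<lambda>x. (1/2) * (indicator {0..1} x * x powr q)) =
      (\<lambda>x. indicator {0..} x *\<^sub>R (\<bar>x\<bar> powr q * gen_normal_density p x))"
    by (auto simp: fun_eq_iff True gen_normal_density_def split: split_indicator)
  finally have "has_bochner_integral lborel (\<lambda>x. \<bar>x\<bar> powr q * gen_normal_density p x) (2 *\<^sub>R ((1/2) * (1 / (q + 1))))"
    by (rule has_bochner_integral_even_function) (auto simp: True gen_normal_density_def split: split_indicator)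
  also have "2 *\<^sub>R ((1/2) * (1 / (q + 1))) = abs_moment p q"
    using q by (simp add: True abs_moment_def divide_simps)
  finally show ?thesis .
next
  case False
  define r where "r = real_of_ereal p"
  have r: "1 \<le> r" using real_of_ereal_ge_1 p False by (simp add: r_def)
  define C where "C = 2 * (r powr (1 / r) * Gamma (1 + 1 / r))"
  define J where "J = r powr ((q + 1) / r - 1) * Gamma ((q + 1) / r)"
  have "has_bochner_integral lborel (\<lambda>x. \<bar>x\<bar> powr q * exp (- (\<bar>x\<bar> powr r / r))) (2 *\<^sub>R J)"
    unfolding J_def by (rule has_bochner_integral_even_function[OF Gamma_substitution_powr[OF r q]]) simp
  then have "has_bochner_integral lborel (\<lambda>x. (\<bar>x\<bar> powr q * exp (- (\<bar>x\<bar> powr r / r))) / C) (2 *\<^sub>R J / C)"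
    by (rule has_bochner_integral_divide_zero)
  also have "(\<lambda>x. (\<bar>x\<bar> powr q * exp (- (\<bar>x\<bar> powr r / r))) / C) = (\<lambda>x. \<bar>x\<bar> powr q * gen_normal_density p x)"
    using False by (auto simp: gen_normal_density_def C_def r_def Let_def)
  also have "2 *\<^sub>R J / C = abs_moment p q"
  proof -
    have "Gamma (1 + 1 / r) = 1 / r * Gamma (1 / r)"
      using Gamma_plus1_pos[of "1 / r"] r by simp
    moreover have "r powr ((q + 1) / r - 1) = r powr (q / r) * r powr (1 / r) / r"
      using r by (simp add: add_divide_distrib powr_add powr_diff)
    ultimately show ?thesis
      unfolding abs_moment_eq[OF p False q] r_def[symmetric] C_def J_def using r by simp
  qed
  finally show ?thesis .
qed

lemma abs_moment_0:
  assumes "1 \<le> p"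
  shows "abs_moment p 0 = 1"
proof (cases "p = \<infinity>")
  case False
  then have "0 < Gamma (1 + 1 / real_of_ereal p)"
    using real_of_ereal_ge_1[OF assms] by (intro Gamma_real_pos add_pos_nonneg) auto
  then show ?thesis
    using False real_of_ereal_ge_1[OF assms False] by (simp add: abs_moment_def Let_def)
qed (simp add: abs_moment_def)

lemma prob_space_gen_normal:
  assumes p: "1 \<le> p"
  shows "prob_space (gen_normal p)"
proof
  have "has_bochner_integral lborel (\<lambda>x. \<bar>x\<bar> powr 0 * gen_normal_density p x) 1"
    using gen_normal_density_moment[OF p, of 0] abs_moment_0[OF p] by simp
  also have "?this \<longleftrightarrow> has_bochner_integral lborel (gen_normal_density p) 1"
    by (rule has_bochner_integral_cong_AE; (simp; fail)?)
      (use AE_lborel_singleton[of "0::real"] in eventually_elim, auto)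
  finally have "(\<integral>\<^sup>+x. ennreal (gen_normal_density p x) \<partial>lborel) = 1"
    using gen_normal_density_nonneg[OF p] by (subst nn_integral_eq_integral) (auto simp: has_bochner_integral_iff)
  then show "emeasure (gen_normal p) (space (gen_normal p)) = 1"
    by (simp add: gen_normal_def emeasure_density)
qed

lemma sets_gen_normal [simp, measurable_cong]: "sets (gen_normal p) = sets borel"
  by (simp add: gen_normal_def)

lemma space_gen_normal [simp]: "space (gen_normal p) = UNIV"
  by (simp add: gen_normal_def)

lemma gen_normal_moment:
  assumes p: "1 \<le> p" and q: "0 \<le> q"
  shows "integrable (gen_normal p) (\<lambda>x. \<bar>x\<bar> powr q)" "(\<integral>x. \<bar>x\<bar> powr q \<partial>gen_normal p) = abs_moment p q"
  using gen_normal_density_moment[OF assms] gen_normal_density_nonneg[OF p]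
  unfolding gen_normal_def
  by (simp_all add: integrable_density integral_density has_bochner_integral_iff mult.commute)

lemma PiM_gen_normal:
  assumes p: "1 \<le> p"
  shows "density (lborel_n n) (\<lambda>x. \<Prod>i<n. ennreal (gen_normal_density p (x i))) = PiM {..<n} (\<lambda>_. gen_normal p)"
proof -
  interpret G: prob_space "gen_normal p" by (rule prob_space_gen_normal[OF p])
  interpret PG: product_sigma_finite "\<lambda>_::nat. gen_normal p" by unfold_locales
  show ?thesis
  proof (rule PG.PiM_eqI)
    show "sets (density (lborel_n n) (\<lambda>x. \<Prod>i<n. ennreal (gen_normal_density p (x i)))) = sets (PiM {..<n} (\<lambda>_. gen_normal p))"
      by (simp add: lborel_n_def cong: sets_PiM_cong)
    fix A :: "nat \<Rightarrow> real set" assume "\<And>i. i \<in> {..<n} \<Longrightarrow> A i \<in> sets (gen_normal p)"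
    then have A[measurable]: "i < n \<Longrightarrow> A i \<in> sets borel" for i by simp
    have PiE: "Pi\<^sub>E {..<n} A \<in> sets (lborel_n n)"
      unfolding lborel_n_def by (rule sets_PiM_I_finite) auto
    have "emeasure (density (lborel_n n) (\<lambda>x. \<Prod>i<n. ennreal (gen_normal_density p (x i)))) (Pi\<^sub>E {..<n} A) =
        (\<integral>\<^sup>+x. (\<Prod>i<n. ennreal (gen_normal_density p (x i))) * indicator (Pi\<^sub>E {..<n} A) x \<partial>lborel_n n)"
      using PiE by (subst emeasure_density) auto
    also have "\<dots> = (\<integral>\<^sup>+x. (\<Prod>i<n. ennreal (gen_normal_density p (x i)) * indicator (A i) (x i)) \<partial>lborel_n n)"
    proof (intro nn_integral_cong)
      fix x assume "x \<in> space (lborel_n n)"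
      then have "indicator (Pi\<^sub>E {..<n} A) x = (\<Prod>i<n. indicator (A i) (x i) :: ennreal)"
        by (auto simp: indicator_def space_lborel_n PiE_def Pi_def prod_eq_1_iff intro!: prod_zero[symmetric])
      then show "(\<Prod>i<n. ennreal (gen_normal_density p (x i))) * indicator (Pi\<^sub>E {..<n} A) x =
          (\<Prod>i<n. ennreal (gen_normal_density p (x i)) * indicator (A i) (x i))"
        by (simp add: prod.distrib)
    qed
    also have "\<dots> = (\<Prod>i<n. emeasure (gen_normal p) (A i))"
      unfolding lborel_n_def
      by (subst lborel_n.product_nn_integral_prod) (auto simp: gen_normal_def emeasure_density intro!: prod.cong)
    finally show "emeasure (density (lborel_n n) (\<lambda>x. \<Prod>i<n. ennreal (gen_normal_density p (x i)))) (Pi\<^sub>E {..<n} A) =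
        (\<Prod>i<n. emeasure (gen_normal p) (A i))" .
  qed auto
qed

definition gen_normal_seq :: "ereal \<Rightarrow> (nat \<Rightarrow> real) measure"
  where "gen_normal_seq p = PiM UNIV (\<lambda>_. gen_normal p)"

lemma prob_space_gen_normal_seq: "1 \<le> p \<Longrightarrow> prob_space (gen_normal_seq p)"
  unfolding gen_normal_seq_def by (intro prob_space_PiM prob_space_gen_normal)

text \<open>A product of factors \<open>exp (- \<bar>x\<^sub>i\<bar>\<^sup>p / p)\<close> depends on \<open>\<Sum>\<^sub>i \<bar>x\<^sub>i\<bar>\<^sup>p\<close> only, and a product of indicators of \<open>[-1, 1]\<close> is the
indicator of \<open>\<parallel>x\<parallel>\<^sub>\<infinity> \<le> 1\<close>.\<close>

lemma p_radial_gen_normal_density: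
  assumes n: "1 \<le> n" and p: "1 \<le> p"
  shows "p_radial_fun n p (\<lambda>x. \<Prod>i<n. ennreal (gen_normal_density p (x i)))"
proof (cases "p = \<infinity>")
  case True
  have "(\<Prod>i<n. ennreal (gen_normal_density p (x i))) = (if lp_norm n p x \<le> 1 then ennreal (1/2) ^ n else 0)" for x
  proof -
    have "lp_norm n p x \<le> 1 \<longleftrightarrow> (\<forall>i<n. x i \<in> {-1..1})"
      using n by (auto simp: lp_norm_def True Max_le_iff lessThan_empty_iff abs_le_iff)
    moreover have "(\<Prod>i<n. ennreal (gen_normal_density p (x i))) = ennreal (1/2) ^ n" if "\<forall>i<n. x i \<in> {-1..1}"
      using that by (simp add: gen_normal_density_def True)
    moreover have "(\<Prod>i<n. ennreal (gen_normal_density p (x i))) = 0" if out: "\<not> (\<forall>i<n. x i \<in> {-1..1})"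
    proof -
      obtain i where "i < n" "x i \<notin> {-1..1}" using out by blast
      then show ?thesis
        by (intro prod_zero) (auto simp: gen_normal_density_def True intro!: bexI[of _ i])
    qed
    ultimately show ?thesis by auto
  qed
  then show ?thesis unfolding p_radial_fun_def by (intro exI[of _ "\<lambda>r. if r \<le> 1 then ennreal (1/2) ^ n else 0"]) simp
next
  case False
  define r where "r = real_of_ereal p"
  have r: "1 \<le> r" using real_of_ereal_ge_1 p False by (simp add: r_def)
  define C where "C = 2 * (r powr (1 / r) * Gamma (1 + 1 / r))"
  have "(\<Prod>i<n. ennreal (gen_normal_density p (x i))) = ennreal (exp (- (lp_norm n p x powr r / r)) / C ^ n)" for x
  proof -
    have "lp_norm n p x powr r = (\<Sum>i<n. \<bar>x i\<bar> powr r)"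
      using False r by (simp add: lp_norm_def r_def[symmetric] powr_powr sum_nonneg)
    moreover have "(\<Prod>i<n. gen_normal_density p (x i)) = exp (- ((\<Sum>i<n. \<bar>x i\<bar> powr r) / r)) / C ^ n"
      using False by (simp add: gen_normal_density_def r_def[symmetric] C_def[symmetric] Let_def
          prod_dividef exp_sum[symmetric] sum_negf sum_divide_distrib)
    ultimately show ?thesis
      using gen_normal_density_nonneg[OF p] by (simp add: prod_ennreal)
  qed
  then show ?thesis unfolding p_radial_fun_def
    by (intro exI[of _ "\<lambda>s. ennreal (exp (- (s powr r / r)) / C ^ n)"]) simp
qed

lemma continuous_p_radial_gen_normal:
  assumes n: "1 \<le> n" and p: "1 \<le> p"
  shows "continuous_p_radial n p (gen_normal_seq p) (\<lambda>\<omega>. restrict \<omega> {..<n})"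
  unfolding continuous_p_radial_def
proof (intro exI conjI)
  let ?f = "\<lambda>x. \<Prod>i<n. ennreal (gen_normal_density p (x i))"
  have sets: "sets (lborel_n n) = sets (PiM {..<n} (\<lambda>_. gen_normal p))"
    unfolding lborel_n_def by (rule sets_PiM_cong) auto
  have X: "(\<lambda>\<omega>. restrict \<omega> {..<n}) \<in> measurable (gen_normal_seq p) (lborel_n n)"
    unfolding gen_normal_seq_def using measurable_cong_sets[OF refl sets]
    by (auto intro: measurable_restrict_subset)
  have "distr (gen_normal_seq p) (lborel_n n) (\<lambda>\<omega>. restrict \<omega> {..<n}) =
      distr (gen_normal_seq p) (PiM {..<n} (\<lambda>_. gen_normal p)) (\<lambda>\<omega>. restrict \<omega> {..<n})"
    by (rule distr_cong) (simp_all add: sets)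
  also have "\<dots> = PiM {..<n} (\<lambda>_. gen_normal p)"
    unfolding gen_normal_seq_def
    using distr_PiM_reindex[of UNIV "\<lambda>_. gen_normal p" "\<lambda>i. i" "{..<n}"] prob_space_gen_normal[OF p]
    by (simp add: restrict_def)
  also have "\<dots> = density (lborel_n n) ?f" by (rule PiM_gen_normal[OF p, symmetric])
  finally show "distributed (gen_normal_seq p) (lborel_n n) (\<lambda>\<omega>. restrict \<omega> {..<n}) ?f"
    using X by (simp add: distributed_def)
  show "p_radial_fun n p ?f" by (rule p_radial_gen_normal_density[OF n p])
qed

section \<open>Norms of vectors with independent coordinates\<close>

abbreviation iid :: "ereal \<Rightarrow> nat \<Rightarrow> (nat \<Rightarrow> real) measure"
  where "iid p \<equiv> (\<lambda>_. gen_normal_seq p)"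

lemma recip_ereal: "q \<noteq> 0 \<Longrightarrow> recip (ereal q) = 1 / q"
  by (simp add: recip_def one_ereal_def)

lemma lp_norm_restrict [simp]: "lp_norm n p (restrict x {..<n}) = lp_norm n p x"
  by (rule lp_norm_cong) simp

context
  fixes p :: ereal
begin

definition norm_sum :: "(real \<Rightarrow> real) \<Rightarrow> nat \<Rightarrow> (nat \<Rightarrow> real) \<Rightarrow> real"
  where "norm_sum \<phi> n z = (\<Sum>i<n. \<phi> (z i)) / sqrt n"

definition centred_power :: "real \<Rightarrow> real \<Rightarrow> real"
  where "centred_power q x = \<bar>x\<bar> powr q / abs_moment p q - 1"

text \<open>Typically \<open>m = m\<^sub>p\<^sub>,\<^sub>q\<close>. By definition, \<open>\<parallel>x\<parallel>\<^sub>q = n\<^bsup>1/q\<^esup> m (1 + d / \<surd>n)\<close> for the fluctuation \<open>d\<close>.\<close>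

definition norm_fluct :: "ereal \<Rightarrow> real \<Rightarrow> nat \<Rightarrow> (nat \<Rightarrow> real) \<Rightarrow> real"
  where "norm_fluct q m n z = sqrt n * (n powr (- recip q) * lp_norm n q z / m - 1)"

text \<open>The contribution of one coordinate to the fluctuation of \<open>\<parallel>z\<parallel>\<^sub>p\<close>. For \<open>p = \<infinity>\<close> the norm is within the order \<open>1/n\<close> of 1, so
that nothing remains at the scale \<open>1/\<surd>n\<close>.\<close>

definition radius_score :: "real \<Rightarrow> real"
  where "radius_score x = (if p = \<infinity> then 0 else centred_power (real_of_ereal p) x / real_of_ereal p)"

text \<open>The normalized \<open>q\<close>-norm of the direction \<open>x / \<parallel>x\<parallel>\<^sub>p\<close>; it is invariant under scaling of \<open>x\<close>.\<close>

definition angular_fluct :: "real \<Rightarrow> nat \<Rightarrow> (nat \<Rightarrow> real) \<Rightarrow> real"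
  where "angular_fluct q n x =
    sqrt n * (n powr (recip p - 1 / q) * (lp_norm n (ereal q) x / lp_norm n p x / m_const p q) - 1)"

definition angular_score :: "real \<Rightarrow> real \<Rightarrow> real"
  where "angular_score q x = centred_power q x / q - radius_score x"

context
  assumes p: "1 \<le> p"
begin

interpretation G: prob_space "gen_normal p" by (rule prob_space_gen_normal[OF p])
interpretation Z: prob_space "gen_normal_seq p" by (rule prob_space_gen_normal_seq[OF p])

lemma borel_measurable_gen_normal [simp]: "borel_measurable (gen_normal p) = borel_measurable borel"
  by (rule measurable_cong_sets) simp_all

lemma prob_UNIV: "measure (gen_normal p) UNIV = 1"
  using G.prob_space by simp

lemma component_measurable_gen_normal_seq: "(\<lambda>z. z i) \<in> borel_measurable (gen_normal_seq p)"
proof -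
  have "(\<lambda>z. z i) \<in> measurable (gen_normal_seq p) (gen_normal p)"
    unfolding gen_normal_seq_def by (rule measurable_component_singleton) simp
  then show ?thesis by (simp add: measurable_cong_sets[OF refl sets_gen_normal])
qed

lemma distr_component: "distr (gen_normal_seq p) (gen_normal p) (\<lambda>z. z i) = gen_normal p"
  unfolding gen_normal_seq_def by (rule distr_PiM_component[OF prob_space_gen_normal[OF p]]) simp

lemma indep_components: "Z.indep_vars (\<lambda>_. gen_normal p) (\<lambda>i z. z i) UNIV"
proof (subst Z.indep_vars_iff_distr_eq_PiM')
  show "(\<lambda>z. z i) \<in> measurable (gen_normal_seq p) (gen_normal p)" for i
    using component_measurable_gen_normal_seq by simp
  have "distr (gen_normal_seq p) (PiM UNIV (\<lambda>_. gen_normal p)) (\<lambda>x. \<lambda>i\<in>UNIV. x i) =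
      distr (gen_normal_seq p) (gen_normal_seq p) (\<lambda>x. x)"
    by (rule distr_cong) (auto simp: gen_normal_seq_def)
  also have "\<dots> = gen_normal_seq p" by (rule distr_id)
  finally show "distr (gen_normal_seq p) (PiM UNIV (\<lambda>_. gen_normal p)) (\<lambda>x. \<lambda>i\<in>UNIV. x i) =
      (\<Pi>\<^sub>M i\<in>UNIV. distr (gen_normal_seq p) (gen_normal p) (\<lambda>z. z i))"
    unfolding distr_component by (simp only: gen_normal_seq_def)
qed simp

lemma lp_norm_measurable_gen_normal_seq:
  "1 \<le> n \<Longrightarrow> lp_norm n q \<in> borel_measurable (gen_normal_seq p)"
  using lp_norm_measurable[of n "\<lambda>z. z" "gen_normal_seq p" q] component_measurable_gen_normal_seq by simp

text \<open>The sequence of independent generalized normal variables represents the directions of all \<open>p\<close>-radial vectors of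
all dimensions on one probability space.\<close>

lemma p_radial_law:
  assumes n: "1 \<le> n" and M: "prob_space M" "continuous_p_radial n p M X"
    and h: "h \<in> borel_measurable (lborel_n n)"
    and scale: "\<And>c x. 0 < c \<Longrightarrow> h (scale_n n c x) = h x"
    and local: "\<And>x. h (restrict x {..<n}) = h x"
  shows "distr M borel (\<lambda>z. h (X z)) = distr (gen_normal_seq p) borel h"
  using distr_homogeneous_p_radial[OF n p M Z.prob_space_axioms continuous_p_radial_gen_normal[OF n p] h scale]
  by (simp only: local)

lemma rv_seq_gen_normal_seqI:
  "(\<And>n. 1 \<le> n \<Longrightarrow> Y n \<in> borel_measurable (gen_normal_seq p)) \<Longrightarrow> rv_seq (iid p) Y"
  by (intro rv_seqI Z.prob_space_axioms)

lemma norm_sum_measurable: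
  assumes [measurable]: "\<phi> \<in> borel_measurable borel"
  shows "norm_sum \<phi> n \<in> borel_measurable (gen_normal_seq p)"
proof -
  note component_measurable_gen_normal_seq[measurable]
  show ?thesis unfolding norm_sum_def[abs_def] by measurable
qed

lemma norm_sum_rv_seq: "\<phi> \<in> borel_measurable borel \<Longrightarrow> rv_seq (iid p) (norm_sum \<phi>)"
  by (intro rv_seq_gen_normal_seqI norm_sum_measurable)

text \<open>If the variance is 0, then \<open>\<phi>\<close> vanishes almost surely; this case is separate because the one-dimensional
central limit theorem requires a positive variance.\<close>

lemma clt_norm_sum:
  assumes \<phi>[measurable]: "\<phi> \<in> borel_measurable borel"
    and sq: "integrable (gen_normal p) (\<lambda>x. (\<phi> x)\<^sup>2)" and mean: "(\<integral>x. \<phi> x \<partial>gen_normal p) = 0"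
  defines "v \<equiv> (\<integral>x. (\<phi> x)\<^sup>2 \<partial>gen_normal p)"
  shows "(\<lambda>n. \<integral>z. iexp (norm_sum \<phi> n z) \<partial>gen_normal_seq p) \<longlonglongrightarrow> exp (- complex_of_real v / 2)"
    and "stoch_bounded (iid p) (norm_sum \<phi>)"
proof -
  note component_measurable_gen_normal_seq[measurable]
  note [measurable] = norm_sum_measurable[OF \<phi>]
  have v0: "0 \<le> v" unfolding v_def by (rule Bochner_Integration.integral_nonneg) simp
  have goal: "(\<lambda>n. \<integral>z. iexp (norm_sum \<phi> n z) \<partial>gen_normal_seq p) \<longlonglongrightarrow> exp (- complex_of_real v / 2) \<and>
    stoch_bounded (iid p) (norm_sum \<phi>)"
  proof (cases "v = 0")
    case True
    then have "AE x in gen_normal p. (\<phi> x)\<^sup>2 = 0"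
      using integral_nonneg_eq_0_iff_AE[OF sq] by (simp add: v_def)
    then have "AE z in gen_normal_seq p. \<phi> (z i) = 0" for i
      unfolding gen_normal_seq_def
      by (intro AE_PiM_component[where P = "\<lambda>x. \<phi> x = 0" and M = "\<lambda>_. gen_normal p"] prob_space_gen_normal[OF p]) auto
    then have AE: "AE z in gen_normal_seq p. \<forall>i. \<phi> (z i) = 0"
      by (simp add: AE_all_countable)
    then have zero: "AE z in gen_normal_seq p. norm_sum \<phi> n z = 0" for n
      by eventually_elim (simp add: norm_sum_def)
    have "(\<integral>z. iexp (norm_sum \<phi> n z) \<partial>gen_normal_seq p) = (\<integral>z. 1 \<partial>gen_normal_seq p)" for n
      by (rule integral_cong_AE) (use zero[of n] in auto)
    moreover have "tail (gen_normal_seq p) (norm_sum \<phi> n) 0 = 0" for n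
      using zero[of n] by (subst Z.prob_eq_0) auto
    ultimately show ?thesis
      using True by (auto simp: stoch_bounded_def norm_sum_rv_seq[OF \<phi>] Z.prob_space intro!: exI[of _ 0])
  next
    case False
    then have v: "0 < v" using v0 by simp
    define \<sigma> where "\<sigma> = sqrt v"
    have \<sigma>: "0 < \<sigma>" "\<sigma>\<^sup>2 = v" using v by (auto simp: \<sigma>_def)
    have indep: "Z.indep_vars (\<lambda>_. borel) (\<lambda>i z. \<phi> (z i)) UNIV"
      by (rule Z.indep_vars_compose2[OF indep_components]) simp
    have int_comp: "integrable (gen_normal_seq p) (\<lambda>z. \<psi> (z i)) \<longleftrightarrow> integrable (gen_normal p) \<psi>"
        "(\<integral>z. \<psi> (z i) \<partial>gen_normal_seq p) = (\<integral>x. \<psi> x \<partial>gen_normal p)"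
      if [measurable]: "\<psi> \<in> borel_measurable borel" for \<psi> :: "real \<Rightarrow> real" and i
    proof -
      have m: "(\<lambda>z. z i) \<in> measurable (gen_normal_seq p) (gen_normal p)" by simp
      have \<psi>: "\<psi> \<in> borel_measurable (gen_normal p)" by simp
      show "integrable (gen_normal_seq p) (\<lambda>z. \<psi> (z i)) \<longleftrightarrow> integrable (gen_normal p) \<psi>"
        using integrable_distr_eq[OF m \<psi>] by (simp add: distr_component)
      show "(\<integral>z. \<psi> (z i) \<partial>gen_normal_seq p) = (\<integral>x. \<psi> x \<partial>gen_normal p)"
        using integral_distr[OF m \<psi>] by (simp add: distr_component)
    qed
    have distr_comp: "distr (gen_normal_seq p) borel (\<lambda>z. \<phi> (z i)) = distr (gen_normal p) borel \<phi>" for i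
    proof -
      have "distr (distr (gen_normal_seq p) (gen_normal p) (\<lambda>z. z i)) borel \<phi> =
          distr (gen_normal_seq p) borel (\<phi> \<circ> (\<lambda>z. z i))"
        by (rule distr_distr) (simp_all add: measurable_cong_sets[OF refl sets_gen_normal])
      then show ?thesis by (simp add: distr_component comp_def)
    qed
    define S where "S n z = (\<Sum>i<n. \<phi> (z i)) / sqrt (n * \<sigma>\<^sup>2)" for n :: nat and z :: "nat \<Rightarrow> real"
    have Sm[measurable]: "S n \<in> borel_measurable (gen_normal_seq p)" for n
      unfolding S_def[abs_def] by measurable
    have wc: "weak_conv_m (\<lambda>n. distr (gen_normal_seq p) borel (S n)) std_normal_distribution"
      unfolding S_def[abs_def]
    proof (rule Z.central_limit_theorem_zero_mean[OF indep])
      show "Z.expectation (\<lambda>z. \<phi> (z n)) = 0" for n by (simp add: int_comp mean)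
      then show "Z.variance (\<lambda>z. \<phi> (z n)) = \<sigma>\<^sup>2" for n
        using int_comp(2)[of "\<lambda>x. (\<phi> x)\<^sup>2" n] by (simp add: \<sigma>(2) v_def)
      show "integrable (gen_normal_seq p) (\<lambda>z. (\<phi> (z n))\<^sup>2)" for n
        using int_comp(1)[of "\<lambda>x. (\<phi> x)\<^sup>2" n] sq by simp
    qed (use \<sigma> distr_comp in auto)
    have SN: "norm_sum \<phi> n z = \<sigma> * S n z" for n z
      using \<sigma>(1) by (simp add: norm_sum_def S_def real_sqrt_mult)
    have "(\<lambda>n. char (distr (gen_normal_seq p) borel (S n)) \<sigma>) \<longlonglongrightarrow> char std_normal_distribution \<sigma>"
      by (rule levy_continuity1[OF _ real_dist_normal_dist wc]) (simp add: Z.real_distribution_distr)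
    also have "char std_normal_distribution \<sigma> = exp (- complex_of_real v / 2)"
      by (simp add: char_std_normal_distribution \<sigma>(2)[symmetric] exp_of_real[symmetric])
    also have "(\<lambda>n. char (distr (gen_normal_seq p) borel (S n)) \<sigma>) =
        (\<lambda>n. \<integral>z. iexp (norm_sum \<phi> n z) \<partial>gen_normal_seq p)"
      by (simp add: fun_eq_iff char_def integral_distr SN)
    finally have 1: "(\<lambda>n. \<integral>z. iexp (norm_sum \<phi> n z) \<partial>gen_normal_seq p) \<longlonglongrightarrow> exp (- complex_of_real v / 2)" .
    interpret N: real_distribution std_normal_distribution by (rule real_dist_normal_dist)
    have "isCont (cdf std_normal_distribution) t" for t
    proof -
      have "emeasure std_normal_distribution {t} = (\<integral>\<^sup>+x. 0 \<partial>lborel)"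
        by (subst emeasure_density) simp_all
      then show ?thesis by (simp add: N.isCont_cdf measure_def)
    qed
    then have lim: "(\<lambda>n. cdf (distr (gen_normal_seq p) borel (S n)) t) \<longlonglongrightarrow> cdf std_normal_distribution t" for t
      using wc by (simp add: weak_conv_m_def weak_conv_def)
    have cdf_S: "cdf (distr (gen_normal_seq p) borel (S n)) t = measure (gen_normal_seq p) {z \<in> space (gen_normal_seq p). S n z \<le> t}" for n t
      unfolding cdf_def by (subst measure_distr) (auto intro!: arg_cong2[where f = measure])
    have "stoch_bounded (iid p) S"
      by (rule cdf_tendsto_imp_stoch_bounded[OF rv_seq_gen_normal_seqI lim[unfolded cdf_S]])
        (auto simp: N.cdf_lim_at_bot N.cdf_lim_at_top_prob)
    then have "stoch_bounded (iid p) (\<lambda>n z. \<sigma> * S n z)"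
      by (rule stoch_bounded_cmult)
    then show ?thesis using 1 by (simp add: SN[abs_def])
  qed
  then show "(\<lambda>n. \<integral>z. iexp (norm_sum \<phi> n z) \<partial>gen_normal_seq p) \<longlonglongrightarrow> exp (- complex_of_real v / 2)"
    "stoch_bounded (iid p) (norm_sum \<phi>)" by auto
qed

lemma centred_power_measurable [measurable]: "centred_power q \<in> borel_measurable borel"
  unfolding centred_power_def[abs_def] by measurable

lemma centred_power_integrable:
  "0 \<le> q \<Longrightarrow> integrable (gen_normal p) (centred_power q)"
  unfolding centred_power_def[abs_def] using gen_normal_moment(1)[OF p] by auto

lemma centred_power_mean:
  "0 \<le> q \<Longrightarrow> (\<integral>x. centred_power q x \<partial>gen_normal p) = 0"
  unfolding centred_power_def[abs_def]
  using gen_normal_moment[OF p, of q] abs_moment_pos[OF p, of q] by (simp add: prob_UNIV)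

lemma centred_power_covariance:
  assumes "0 \<le> a" "0 \<le> b"
  shows "integrable (gen_normal p) (\<lambda>x. centred_power a x * centred_power b x)"
    and "(\<integral>x. centred_power a x * centred_power b x \<partial>gen_normal p) =
      abs_moment p (a + b) / (abs_moment p a * abs_moment p b) - 1"
proof -
  have eq: "centred_power a x * centred_power b x =
      \<bar>x\<bar> powr (a + b) / (abs_moment p a * abs_moment p b) - \<bar>x\<bar> powr a / abs_moment p a
        - \<bar>x\<bar> powr b / abs_moment p b + 1" for x
    by (simp add: centred_power_def powr_add algebra_simps)
  note int = gen_normal_moment[OF p] and pos = abs_moment_pos[OF p]
  show "integrable (gen_normal p) (\<lambda>x. centred_power a x * centred_power b x)"
    unfolding eq using int(1) assms by auto
  show "(\<integral>x. centred_power a x * centred_power b x \<partial>gen_normal p) =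
      abs_moment p (a + b) / (abs_moment p a * abs_moment p b) - 1"
    unfolding eq using int assms pos[of a] pos[of b] by (simp add: prob_UNIV)
qed

lemma norm_sum_centred_power_bounded:
  "0 \<le> q \<Longrightarrow> stoch_bounded (iid p) (norm_sum (centred_power q))"
  using centred_power_covariance(1)[of q q] centred_power_mean[of q]
  by (intro clt_norm_sum(2)) (auto simp: power2_eq_square)

text \<open>The delta method for \<open>u \<mapsto> (1 + u)\<^bsup>1/q\<^esup>\<close>, whose derivative at 0 is \<open>1/q\<close>.\<close>

lemma norm_fluct_linearize:
  assumes q: "1 \<le> q"
  shows "vanishing (iid p)
    (\<lambda>n z. norm_fluct (ereal q) (m_const p q) n z - 1 / q * norm_sum (centred_power q) n z)"
proof -
  have "((\<lambda>x. (1 + x) powr (1 / q)) has_real_derivative 1 / q) (at 0)"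
    by (auto intro!: derivative_eq_intros)
  from delta_method[OF norm_sum_centred_power_bounded this] q
  have lin: "vanishing (iid p)
    (\<lambda>n z. sqrt n * ((1 + norm_sum (centred_power q) n z / sqrt n) powr (1 / q) - (1 + 0) powr (1 / q))
      - 1 / q * norm_sum (centred_power q) n z)" by simp
  show ?thesis
  proof (rule vanishing_cong[OF _ lin])
    fix n :: nat and z assume n: "1 \<le> n"
    define M where "M = abs_moment p q"
    have M: "0 < M" using abs_moment_pos[OF p, of q] q by (simp add: M_def)
    have "norm_sum (centred_power q) n z / sqrt n = (\<Sum>i<n. \<bar>z i\<bar> powr q / M - 1) / n"
      by (simp add: norm_sum_def centred_power_def M_def)
    also have "\<dots> = (\<Sum>i<n. \<bar>z i\<bar> powr q) / (n * M) - 1"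
      using n M by (simp add: sum_subtractf sum_divide_distrib[symmetric] field_simps)
    finally have "(1 + norm_sum (centred_power q) n z / sqrt n) powr (1 / q) =
        ((\<Sum>i<n. \<bar>z i\<bar> powr q) / (n * M)) powr (1 / q)" by simp
    also have "\<dots> = n powr (- (1 / q)) * lp_norm n (ereal q) z / m_const p q"
      using n M by (simp add: powr_divide powr_mult sum_nonneg lp_norm_def m_const_def M_def powr_minus field_simps)
    finally have 1: "(1 + norm_sum (centred_power q) n z / sqrt n) powr (1 / q) =
        n powr (- (1 / q)) * lp_norm n (ereal q) z / m_const p q" .
    show "norm_fluct (ereal q) (m_const p q) n z - 1 / q * norm_sum (centred_power q) n z =
      sqrt n * ((1 + norm_sum (centred_power q) n z / sqrt n) powr (1 / q) - (1 + 0) powr (1 / q))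
      - 1 / q * norm_sum (centred_power q) n z"
      using q unfolding 1 by (simp add: norm_fluct_def recip_ereal)
  qed
qed

lemma sup_norm_cdf:
  assumes n: "1 \<le> n"
  shows "measure (gen_normal_seq p) {z \<in> space (gen_normal_seq p). lp_norm n \<infinity> z \<le> r} =
    measure (gen_normal p) {-r..r} ^ n"
proof -
  have "emeasure (gen_normal_seq p) {z \<in> space (gen_normal_seq p). \<forall>i\<in>{..<n}. z i \<in> {-r..r}} =
      (\<Prod>i<n. emeasure (gen_normal p) {-r..r})"
  proof -
    interpret product_prob_space "\<lambda>_. gen_normal p" "UNIV :: nat set" by unfold_locales
    show ?thesis unfolding gen_normal_seq_def by (rule emeasure_PiM_Collect) auto
  qed
  moreover have "{z \<in> space (gen_normal_seq p). lp_norm n \<infinity> z \<le> r} =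
      {z \<in> space (gen_normal_seq p). \<forall>i\<in>{..<n}. z i \<in> {-r..r}}"
  proof -
    have "x \<in> {-r..r} \<longleftrightarrow> \<bar>x\<bar> \<le> r" for x :: real by auto
    then show ?thesis using n by (simp add: lp_norm_def Max_le_iff lessThan_empty_iff)
  qed
  ultimately show ?thesis
    by (simp add: G.emeasure_eq_measure Z.emeasure_eq_measure ennreal_power)
qed

text \<open>A consequence of \<open>\<Gamma>(1 + z) = z \<Gamma>(z)\<close>. In particular \<open>M\<^sub>p(p) = 1\<close>.\<close>

lemma abs_moment_add:
  assumes "p \<noteq> \<infinity>" "0 \<le> a"
  shows "abs_moment p (a + real_of_ereal p) = (a + 1) * abs_moment p a"
proof -
  define r where "r = real_of_ereal p"
  have r: "1 \<le> r" using real_of_ereal_ge_1 p assms by (simp add: r_def)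
  have "(a + r + 1) / r = 1 + (a + 1) / r" "(a + r) / r = a / r + 1"
    using r by (auto simp: field_simps)
  then show ?thesis
    using r assms Gamma_plus1_pos[of "(a + 1) / r"]
    by (simp add: abs_moment_eq[OF p assms(1)] r_def[symmetric] powr_add)
qed

lemma radius_score_measurable [measurable]: "radius_score \<in> borel_measurable borel"
  unfolding radius_score_def[abs_def] by (cases "p = \<infinity>") simp_all

lemma norm_sum_radius_score_finite:
  "p \<noteq> \<infinity> \<Longrightarrow> norm_sum radius_score =
    (\<lambda>n z. 1 / real_of_ereal p * norm_sum (centred_power (real_of_ereal p)) n z)"
  by (simp add: fun_eq_iff norm_sum_def radius_score_def sum_divide_distrib[symmetric])

lemma norm_sum_radius_score_infinite: "p = \<infinity> \<Longrightarrow> norm_sum radius_score = (\<lambda>_ _. 0)"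
  unfolding norm_sum_def[abs_def] radius_score_def by simp

lemma norm_fluct_radius_linearize:
  "vanishing (iid p) (\<lambda>n z. norm_fluct p 1 n z - norm_sum radius_score n z)"
proof (cases "p = \<infinity>")
  case False
  define r where "r = real_of_ereal p"
  have r: "1 \<le> r" "p = ereal r" using real_of_ereal_ge_1 p False by (auto simp: r_def ereal_real)
  have "abs_moment p r = 1"
    using abs_moment_add[OF False, of 0] abs_moment_0[OF p] by (simp add: r_def)
  then have "m_const p r = 1" by (simp add: m_const_def)
  then show ?thesis
    using norm_fluct_linearize[OF r(1)] unfolding norm_sum_radius_score_finite[OF False]
    by (simp add: r(2)[symmetric] r_def[symmetric])
next
  case True
  have meas: "measure (gen_normal p) {-r..r} = r" if "0 \<le> r" "r \<le> 1" for r
  proof -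
    have "emeasure (gen_normal p) {-r..r} = (\<integral>\<^sup>+x. ennreal (1/2) * indicator {-r..r} x \<partial>lborel)"
      unfolding gen_normal_def using that
      by (subst emeasure_density)
        (auto simp: gen_normal_density_def True intro!: nn_integral_cong split: split_indicator)
    also have "\<dots> = ennreal (1/2) * ennreal (2 * r)"
      using that by (subst nn_integral_cmult_indicator) auto
    also have "\<dots> = ennreal (1/2 * (2 * r))"
      using that by (intro ennreal_mult[symmetric]) auto
    also have "1/2 * (2 * r) = r" by simp
    finally show ?thesis using that by (simp add: measure_def)
  qed
  have "vanishing (iid p) (\<lambda>n z. sqrt n * (lp_norm n \<infinity> z - 1))"
    by (rule power_cdf_fluctuation)
      (simp_all add: Z.prob_space_axioms lp_norm_measurable_gen_normal_seq sup_norm_cdf meas)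
  then show ?thesis
    unfolding norm_sum_radius_score_infinite[OF True]
    by (rule vanishing_cong[rotated]) (simp add: norm_fluct_def True recip_def)
qed

lemma norm_fluct_radius_bounded: "stoch_bounded (iid p) (norm_fluct p 1)"
proof (rule stoch_bounded_perturb[OF norm_fluct_radius_linearize])
  show "stoch_bounded (iid p) (norm_sum radius_score)"
  proof (cases "p = \<infinity>")
    case True
    show ?thesis
      unfolding norm_sum_radius_score_infinite[OF True]
      by (rule stoch_bounded_const[OF norm_sum_rv_seq[OF radius_score_measurable]])
  next
    case False
    show ?thesis
      unfolding norm_sum_radius_score_finite[OF False] using real_of_ereal_ge_1[OF p False]
      by (intro stoch_bounded_cmult norm_sum_centred_power_bounded) simp
  qed
qed

lemma inverse_radius_vanishing:
  "vanishing (iid p) (\<lambda>n z. 1 / (1 + norm_fluct p 1 n z / sqrt n) - 1)"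
proof (rule vanishing_compose[OF vanishing_div_sqrt[OF norm_fluct_radius_bounded]])
  have "((\<lambda>x. 1 / (1 + x) - 1) \<longlongrightarrow> 1 / (1 + 0) - (1::real)) (nhds 0)"
    by (intro tendsto_intros filterlim_ident) auto
  then show "((\<lambda>x::real. 1 / (1 + x) - 1) \<longlongrightarrow> 0) (nhds 0)" by simp
qed measurable

lemma inverse_radius_eq:
  assumes n: "1 \<le> n" and small: "\<bar>norm_fluct p 1 n z / sqrt n\<bar> \<le> 1 / 2"
  defines "U \<equiv> 1 + norm_fluct p 1 n z / sqrt n"
  shows "0 < U" "real n powr recip p / lp_norm n p z = 1 / U"
proof -
  have "U = n powr (- recip p) * lp_norm n p z"
    using n by (simp add: U_def norm_fluct_def)
  then have N: "lp_norm n p z = U * n powr recip p"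
    using n by (simp add: powr_minus field_simps)
  show "0 < U" using small unfolding U_def by linarith
  then show "real n powr recip p / lp_norm n p z = 1 / U"
    unfolding N using n by simp
qed

lemma angular_score_measurable [measurable]: "angular_score q \<in> borel_measurable borel"
  unfolding angular_score_def[abs_def] by measurable

lemma angular_fluct_rv_seq: "rv_seq (iid p) (angular_fluct q)"
proof (rule rv_seq_gen_normal_seqI)
  fix n :: nat assume "1 \<le> n"
  note lp_norm_measurable_gen_normal_seq[OF this, measurable]
  show "angular_fluct q n \<in> borel_measurable (gen_normal_seq p)"
    unfolding angular_fluct_def[abs_def] by measurable
qed

text \<open>With fluctuations \<open>D\<^sub>q\<close> and \<open>D\<^sub>p\<close> of the two norms, the quantity is \<open>\<surd>n ((1 + D\<^sub>q/\<surd>n) / (1 + D\<^sub>p/\<surd>n) - 1)\<close>,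
which equals \<open>(D\<^sub>q - D\<^sub>p) / (1 + D\<^sub>p/\<surd>n)\<close>.\<close>

lemma angular_fluct_linearize:
  assumes q: "1 \<le> q"
  shows "vanishing (iid p) (\<lambda>n z. angular_fluct q n z - norm_sum (angular_score q) n z)"
proof -
  define Dq where "Dq = norm_fluct (ereal q) (m_const p q)"
  define Dp where "Dp = norm_fluct p 1"
  define Aq where "Aq n z = 1 / q * norm_sum (centred_power q) n z" for n z
  define Ap where "Ap = norm_sum radius_score"
  define h where "h n z = 1 / (1 + Dp n z / sqrt n) - 1" for n :: nat and z
  have Dq: "vanishing (iid p) (\<lambda>n z. Dq n z - Aq n z)"
    unfolding Dq_def Aq_def by (rule norm_fluct_linearize[OF q])
  have Dp: "vanishing (iid p) (\<lambda>n z. Dp n z - Ap n z)"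
    unfolding Dp_def Ap_def by (rule norm_fluct_radius_linearize)
  have "stoch_bounded (iid p) Aq"
    unfolding Aq_def using q by (intro stoch_bounded_cmult norm_sum_centred_power_bounded) simp
  note Dq_bounded = stoch_bounded_perturb[OF Dq this]
  have Dp_bounded: "stoch_bounded (iid p) Dp"
    unfolding Dp_def by (rule norm_fluct_radius_bounded)
  have h: "vanishing (iid p) h" unfolding h_def Dp_def by (rule inverse_radius_vanishing)
  show ?thesis
  proof (rule vanishing_cong_on)
    show "vanishing (iid p) (\<lambda>n z. ((Dq n z - Aq n z) - (Dp n z - Ap n z)) + (Dq n z - Dp n z) * h n z)"
      by (intro vanishing_add vanishing_diff Dq Dp vanishing_mult stoch_bounded_diff Dq_bounded Dp_bounded h)
    show "vanishing (iid p) (\<lambda>n z. Dp n z / sqrt n)"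
      by (rule vanishing_div_sqrt[OF Dp_bounded])
    show "rv_seq (iid p) (\<lambda>n z. angular_fluct q n z - norm_sum (angular_score q) n z)"
      by (intro rv_seq_diff angular_fluct_rv_seq norm_sum_rv_seq angular_score_measurable)
    fix n :: nat and z assume n: "1 \<le> n" and small: "\<bar>Dp n z / sqrt n\<bar> \<le> 1 / 2"
    define U where "U = 1 + Dp n z / sqrt n"
    define Uq where "Uq = n powr (- (1 / q)) * lp_norm n (ereal q) z / m_const p q"
    have sn: "0 < sqrt n" using n by simp
    have D: "Dp n z = sqrt n * (U - 1)" "Dq n z = sqrt n * (Uq - 1)"
      using q sn by (auto simp: U_def Dq_def norm_fluct_def Uq_def recip_ereal)
    note U = inverse_radius_eq[OF n small[unfolded Dp_def], folded Dp_def, folded U_def]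
    have "n powr (recip p - 1 / q) * (lp_norm n (ereal q) z / lp_norm n p z / m_const p q) =
        Uq * (n powr recip p / lp_norm n p z)"
      using n by (simp add: Uq_def powr_diff powr_minus divide_inverse mult_ac)
    then have "angular_fluct q n z = sqrt n * (Uq / U - 1)"
      unfolding U(2) by (simp add: angular_fluct_def)
    also have "\<dots> = Dq n z - Dp n z + (Dq n z - Dp n z) * h n z"
      using U(1) unfolding h_def U_def[symmetric] unfolding D by (simp add: field_simps)
    finally have 1: "angular_fluct q n z = \<dots>" .
    have 2: "norm_sum (angular_score q) n z = Aq n z - Ap n z"
      by (simp add: norm_sum_def angular_score_def Aq_def Ap_def sum_subtractf diff_divide_distrib sum_divide_distrib[symmetric])
    show "angular_fluct q n z - norm_sum (angular_score q) n z =
        ((Dq n z - Aq n z) - (Dp n z - Ap n z)) + (Dq n z - Dp n z) * h n z"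
      unfolding 1 2 by simp
  qed
qed

lemma angular_score_mean: "0 \<le> q \<Longrightarrow> (\<integral>x. angular_score q x \<partial>gen_normal p) = 0"
  and angular_score_integrable: "0 \<le> q \<Longrightarrow> integrable (gen_normal p) (angular_score q)"
proof -
  have r: "0 \<le> real_of_ereal p" using p by (cases p) auto
  have rs: "integrable (gen_normal p) radius_score" "(\<integral>x. radius_score x \<partial>gen_normal p) = 0"
    using centred_power_integrable[OF r] centred_power_mean[OF r]
    unfolding radius_score_def[abs_def] by (cases "p = \<infinity>"; simp)+
  show "integrable (gen_normal p) (angular_score q)" if "0 \<le> q"
    unfolding angular_score_def[abs_def] using centred_power_integrable[OF that] rs by auto
  show "(\<integral>x. angular_score q x \<partial>gen_normal p) = 0" if "0 \<le> q"
    unfolding angular_score_def[abs_def] using centred_power_integrable[OF that] centred_power_mean[OF that] rs by simp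
qed

text \<open>For finite \<open>p\<close>, the covariance of \<open>\<bar>Z\<bar>\<^sup>c / M(c)\<close> and \<open>\<bar>Z\<bar>\<^sup>p\<close> is \<open>c\<close>. Hence each of the two mixed terms contributes
\<open>-1/p\<close> and the square of the radius score contributes \<open>1/p\<close>, which leaves the summand \<open>-1/p\<close> of \<open>\<Sigma>\<close>.\<close>

lemma angular_score_covariance:
  assumes q: "1 \<le> q $ i" "1 \<le> q $ j"
  shows "integrable (gen_normal p) (\<lambda>x. angular_score (q $ i) x * angular_score (q $ j) x)"
    and "(\<integral>x. angular_score (q $ i) x * angular_score (q $ j) x \<partial>gen_normal p) = clt_cov p q $ i $ j"
proof -
  define a b where "a = q $ i" and "b = q $ j"
  have ab: "1 \<le> a" "1 \<le> b" using q by (simp_all add: a_def b_def)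
  let ?G = "gen_normal p"
  have "integrable ?G (\<lambda>x. angular_score a x * angular_score b x) \<and>
    (\<integral>x. angular_score a x * angular_score b x \<partial>?G) = clt_cov p q $ i $ j"
  proof (cases "p = \<infinity>")
    case True
    have eq: "angular_score a x * angular_score b x = (centred_power a x * centred_power b x) / (a * b)" for x
      unfolding angular_score_def radius_score_def using True by simp
    have "(abs_moment p (a + b) / (abs_moment p a * abs_moment p b) - 1) / (a * b) = 1 / (a + b + 1)"
    proof -
      have "abs_moment p (a + b) / (abs_moment p a * abs_moment p b) - 1 = (a + 1) * (b + 1) / (a + b + 1) - 1"
        by (simp add: abs_moment_def True)
      also have "\<dots> = a * b / (a + b + 1)" using ab by (simp add: field_simps)
      finally show ?thesis using ab by simp
    qed
    then show ?thesis
      unfolding eq using centred_power_covariance[of a b] ab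
      by (simp add: clt_cov_def True a_def b_def)
  next
    case False
    define r where "r = real_of_ereal p"
    have r: "1 \<le> r" using real_of_ereal_ge_1 p False by (auto simp: r_def)
    note pos = abs_moment_pos[OF p]
    have cov_r: "(\<integral>x. centred_power c x * centred_power r x \<partial>?G) = c" if "0 \<le> c" for c
      using centred_power_covariance(2)[of c r] abs_moment_add[OF False that] abs_moment_add[OF False, of 0]
        abs_moment_0[OF p] pos[OF that] r that by (simp add: r_def[symmetric])
    have eq: "angular_score a x * angular_score b x =
        (1 / (a * b)) * (centred_power a x * centred_power b x)
        - (1 / (a * r)) * (centred_power a x * centred_power r x)
        - (1 / (b * r)) * (centred_power b x * centred_power r x)
        + (1 / (r * r)) * (centred_power r x * centred_power r x)" for x
      using ab r by (simp add: angular_score_def radius_score_def False r_def[symmetric] field_simps)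
    note int = centred_power_covariance(1)
    have I: "integrable ?G (\<lambda>x. angular_score a x * angular_score b x)"
      unfolding eq using ab r
      by (intro Bochner_Integration.integrable_add Bochner_Integration.integrable_diff integrable_mult_right int) auto
    have "(\<integral>x. angular_score a x * angular_score b x \<partial>?G) =
        (1 / (a * b)) * (abs_moment p (a + b) / (abs_moment p a * abs_moment p b) - 1) - 1 / r - 1 / r + 1 / r"
      unfolding eq using ab r int[of a b] int[of a r] int[of b r] int[of r r]
      by (simp add: cov_r centred_power_covariance(2)[of a b])
    also have "abs_moment p (a + b) / (abs_moment p a * abs_moment p b) =
        Gamma (1 / r) * Gamma ((a + b + 1) / r) / (Gamma ((a + 1) / r) * Gamma ((b + 1) / r))"
    proof -
      have "Gamma (1 / r) > 0" using r by (intro Gamma_real_pos) auto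
      then show ?thesis
        using ab r unfolding abs_moment_eq[OF p False, of a, simplified] 
        by (simp add: abs_moment_eq[OF p False] r_def[symmetric] add_divide_distrib powr_add)
    qed
    finally show ?thesis using I False by (simp add: clt_cov_def a_def b_def r_def Let_def)
  qed
  then show "integrable (gen_normal p) (\<lambda>x. angular_score (q $ i) x * angular_score (q $ j) x)"
    "(\<integral>x. angular_score (q $ i) x * angular_score (q $ j) x \<partial>gen_normal p) = clt_cov p q $ i $ j"
    by (auto simp: a_def b_def)
qed

lemma angular_score_quadratic_form:
  fixes q :: "real ^ 'k"
  assumes q: "\<And>i. 1 \<le> q $ i"
  shows "integrable (gen_normal p) (\<lambda>x. (\<Sum>i\<in>UNIV. u i * angular_score (q $ i) x)\<^sup>2)"
    and "(\<integral>x. (\<Sum>i\<in>UNIV. u i * angular_score (q $ i) x)\<^sup>2 \<partial>gen_normal p) =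
      (\<Sum>i\<in>UNIV. \<Sum>j\<in>UNIV. u i * u j * clt_cov p q $ i $ j)"
proof -
  have eq: "(\<Sum>i\<in>UNIV. u i * angular_score (q $ i) x)\<^sup>2 =
      (\<Sum>i\<in>UNIV. \<Sum>j\<in>UNIV. u i * u j * (angular_score (q $ i) x * angular_score (q $ j) x))" for x
    unfolding power2_eq_square sum_product by (simp add: mult_ac)
  note cov = angular_score_covariance[OF q q]
  show "integrable (gen_normal p) (\<lambda>x. (\<Sum>i\<in>UNIV. u i * angular_score (q $ i) x)\<^sup>2)"
    unfolding eq by (intro Bochner_Integration.integrable_sum integrable_mult_right cov(1))
  show "(\<integral>x. (\<Sum>i\<in>UNIV. u i * angular_score (q $ i) x)\<^sup>2 \<partial>gen_normal p) =
      (\<Sum>i\<in>UNIV. \<Sum>j\<in>UNIV. u i * u j * clt_cov p q $ i $ j)"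
    unfolding eq by (simp add: Bochner_Integration.integral_sum cov)
qed

text \<open>A linear combination of normalized sums of scores is the normalized sum of the combined score, so the
one-dimensional central limit theorem suffices.\<close>

lemma angular_fluct_char:
  fixes q :: "real ^ 'k"
  assumes q: "\<And>i. 1 \<le> q $ i"
  shows "(\<lambda>n. \<integral>z. iexp (\<Sum>i\<in>UNIV. u i * angular_fluct (q $ i) n z) \<partial>gen_normal_seq p)
    \<longlonglongrightarrow> exp (- complex_of_real (\<Sum>i\<in>UNIV. \<Sum>j\<in>UNIV. u i * u j * clt_cov p q $ i $ j) / 2)"
proof (rule integral_iexp_tendsto_perturb)
  define \<phi> where "\<phi> x = (\<Sum>i\<in>UNIV. u i * angular_score (q $ i) x)" for x
  have \<phi>[measurable]: "\<phi> \<in> borel_measurable borel" unfolding \<phi>_def by measurable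
  have q0: "0 \<le> q $ i" for i using q[of i] by simp
  have sum: "norm_sum \<phi> n z = (\<Sum>i\<in>UNIV. u i * norm_sum (angular_score (q $ i)) n z)" for n z
    unfolding norm_sum_def \<phi>_def
    by (subst sum.swap) (simp add: sum_divide_distrib sum_distrib_left)
  have "vanishing (iid p)
      (\<lambda>n z. \<Sum>i\<in>UNIV. u i * (angular_fluct (q $ i) n z - norm_sum (angular_score (q $ i)) n z))"
    by (intro vanishing_sum vanishing_cmult angular_fluct_linearize q) simp_all
  then show "vanishing (iid p)
      (\<lambda>n z. (\<Sum>i\<in>UNIV. u i * angular_fluct (q $ i) n z) - norm_sum \<phi> n z)"
    by (simp add: sum right_diff_distrib sum_subtractf)
  have mean: "(\<integral>x. \<phi> x \<partial>gen_normal p) = 0"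
    unfolding \<phi>_def using angular_score_mean[OF q0] angular_score_integrable[OF q0] by simp
  show "(\<lambda>n. \<integral>z. iexp (norm_sum \<phi> n z) \<partial>gen_normal_seq p) \<longlonglongrightarrow>
      exp (- complex_of_real (\<Sum>i\<in>UNIV. \<Sum>j\<in>UNIV. u i * u j * clt_cov p q $ i $ j) / 2)"
    using clt_norm_sum(1)[OF \<phi> _ mean] angular_score_quadratic_form[OF q, of u] by (simp add: \<phi>_def[symmetric])
  show "rv_seq (iid p) (norm_sum \<phi>)" by (rule norm_sum_rv_seq[OF \<phi>])
qed

lemma angular_fluct_bounded:
  assumes q: "1 \<le> q"
  shows "stoch_bounded (iid p) (angular_fluct q)"
proof (rule stoch_bounded_perturb[OF angular_fluct_linearize[OF q]])
  have "integrable (gen_normal p) (\<lambda>x. (angular_score q x)\<^sup>2)"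
    using angular_score_covariance(1)[where q = "\<chi> _. q" and i = "1 :: 1" and j = 1] q by (simp add: power2_eq_square)
  from clt_norm_sum(2)[OF angular_score_measurable this angular_score_mean] q
  show "stoch_bounded (iid p) (norm_sum (angular_score q))" by simp
qed

end

end

section \<open>The central limit theorem for \<open>p\<close>-radial vectors\<close>

lemma angular_fluct_restrict [simp]: "angular_fluct p q n (restrict x {..<n}) = angular_fluct p q n x"
  by (simp add: angular_fluct_def)

lemma angular_fluct_scale_n:
  assumes "1 \<le> n" "1 \<le> p" "1 \<le> q" "0 < c"
  shows "angular_fluct p q n (scale_n n c x) = angular_fluct p q n x"
  using assms by (simp add: angular_fluct_def lp_norm_scale_n)

lemma angular_fluct_measurable:
  "1 \<le> n \<Longrightarrow> angular_fluct p q n \<in> borel_measurable (lborel_n n)"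
  unfolding angular_fluct_def[abs_def]
  by (intro borel_measurable_times borel_measurable_diff borel_measurable_divide borel_measurable_const
      lp_norm_measurable_lborel_n)

text \<open>Let \<open>R = \<parallel>X\<parallel>\<^sub>p\<close>, and let \<open>V\<^sub>i\<close> be the fluctuation computed from the direction \<open>X / R\<close>. The fluctuation computed from \<open>X\<close>
is \<open>V\<^sub>i + (1 + V\<^sub>i/\<surd>n) \<surd>n (R - 1)\<close>, whose second summand vanishes. The law of the vector \<open>V\<close> is the same as
for independent coordinates.\<close>

theorem p_radial_clt:
  fixes q :: "real ^ 'k" and M :: "nat \<Rightarrow> 'a measure"
  assumes p: "1 \<le> p" and q: "\<And>i. 1 \<le> q $ i"
    and prob: "\<And>n. 1 \<le> n \<Longrightarrow> prob_space (M n)"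
    and radial: "\<And>n. 1 \<le> n \<Longrightarrow> continuous_p_radial n p (M n) (X n)"
    and radius: "tends_to_zero_in_probability M (\<lambda>n \<omega>. sqrt (real n) * (1 - lp_norm n p (X n \<omega>)))"
  shows "\<exists>N. centred_gaussian_vector N (clt_cov p q) \<and>
    converges_weakly
      (\<lambda>n. distr (M n) borel (\<lambda>\<omega>. \<chi> i. sqrt (real n) *
        (real n powr (recip p - 1 / q $ i) *
          (lp_norm n (ereal (q $ i)) (X n \<omega>) / m_const p (q $ i)) - 1)))
      N"
proof -
  have "clt_cov p q $ i $ j = clt_cov p q $ j $ i" for i j
    by (simp add: clt_cov_def Let_def add_ac mult_ac)
  moreover have "0 \<le> (\<Sum>i\<in>UNIV. \<Sum>j\<in>UNIV. u i * u j * clt_cov p q $ i $ j)" for u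
    unfolding angular_score_quadratic_form(2)[OF p q, symmetric]
    by (rule Bochner_Integration.integral_nonneg) simp
  ultimately obtain N where N: "centred_gaussian_vector N (clt_cov p q)"
    and N_char: "\<And>u. (\<integral>x. iexp (u \<bullet> x) \<partial>N) =
      exp (- complex_of_real (\<Sum>i\<in>UNIV. \<Sum>j\<in>UNIV. u $ i * u $ j * clt_cov p q $ i $ j) / 2)"
    using exists_centred_gaussian_vector[of "clt_cov p q"] by blast
  have Xm: "X n \<in> measurable (M n) (lborel_n n)" if "1 \<le> n" for n
    using radial[OF that] by (auto simp: continuous_p_radial_def distributed_def)
  define V where "V i n \<omega> = angular_fluct p (q $ i) n (X n \<omega>)" for i n \<omega>
  define E where "E n \<omega> = sqrt (real n) * (1 - lp_norm n p (X n \<omega>))" for n \<omega>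
  define T where "T i n \<omega> = sqrt (real n) * (real n powr (recip p - 1 / q $ i) *
      (lp_norm n (ereal (q $ i)) (X n \<omega>) / m_const p (q $ i)) - 1)" for i n \<omega>
  have norm_m [measurable]: "(\<lambda>\<omega>. lp_norm n s (X n \<omega>)) \<in> borel_measurable (M n)" if "1 \<le> n" for n s
    by (rule measurable_compose[OF Xm[OF that] lp_norm_measurable_lborel_n[OF that]])
  have Tm: "T i n \<in> borel_measurable (M n)" if "1 \<le> n" for i n
    unfolding T_def using norm_m[OF that] by measurable
  have Vm: "V i n \<in> borel_measurable (M n)" if "1 \<le> n" for i n
    unfolding V_def by (rule measurable_compose[OF Xm[OF that] angular_fluct_measurable[OF that]])
  have T_rv: "rv_seq M (T i)" and V_rv: "rv_seq M (V i)" for i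
    by (rule rv_seqI[OF prob Tm], assumption+, rule rv_seqI[OF prob Vm])
  have E: "vanishing M E"
    unfolding vanishing_def using radius norm_m
    by (auto simp: E_def[abs_def] intro!: rv_seqI prob)
  have V_bounded: "stoch_bounded M (V i)" for i
  proof (rule stoch_bounded_law[OF _ V_rv angular_fluct_rv_seq[OF p] angular_fluct_bounded[OF p q]])
    fix n :: nat assume n: "1 \<le> n"
    show "distr (M n) borel (V i n) = distr (gen_normal_seq p) borel (angular_fluct p (q $ i) n)"
      unfolding V_def
      by (rule p_radial_law[OF p n prob[OF n] radial[OF n] angular_fluct_measurable[OF n]])
        (use n p q in \<open>simp_all add: angular_fluct_scale_n\<close>)
  qed
  have diff: "vanishing M (\<lambda>n \<omega>. T i n \<omega> - V i n \<omega>)" for i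
  proof (rule vanishing_cong_on)
    show "vanishing M (\<lambda>n \<omega>. (1 + V i n \<omega> / sqrt n) * (-1 * E n \<omega>))"
      by (intro vanishing_mult stoch_bounded_add stoch_bounded_const[OF V_rv] vanishing_cmult E
          vanishing_stoch_bounded vanishing_div_sqrt V_bounded)
    show "vanishing M (\<lambda>n \<omega>. E n \<omega> / sqrt n)"
      by (intro vanishing_div_sqrt vanishing_stoch_bounded E)
    show "rv_seq M (\<lambda>n \<omega>. T i n \<omega> - V i n \<omega>)" by (rule rv_seq_diff[OF T_rv V_rv])
    fix n :: nat and \<omega> assume n: "1 \<le> n" and small: "\<bar>E n \<omega> / sqrt n\<bar> \<le> 1 / 2"
    define R where "R = lp_norm n p (X n \<omega>)"
    have sn: "0 < sqrt n" using n by simp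
    have "\<bar>1 - R\<bar> \<le> 1 / 2" using small sn by (simp add: E_def R_def)
    then have R: "0 < R" by linarith
    define a where "a = real n powr (recip p - 1 / q $ i) * (lp_norm n (ereal (q $ i)) (X n \<omega>) / R / m_const p (q $ i))"
    have V: "V i n \<omega> = sqrt n * (a - 1)" by (simp add: V_def angular_fluct_def a_def R_def)
    have T: "T i n \<omega> = sqrt n * (a * R - 1)" using R by (simp add: T_def a_def)
    show "T i n \<omega> - V i n \<omega> = (1 + V i n \<omega> / sqrt n) * (-1 * E n \<omega>)"
      using sn unfolding V T E_def R_def[symmetric] by (simp add: field_simps)
  qed
  have T_bounded: "stoch_bounded M (T i)" for i
    by (rule stoch_bounded_perturb[OF diff V_bounded])
  define \<mu> where "\<mu> n = distr (M n) borel (\<lambda>\<omega>. \<chi> i. T i n \<omega>)" for n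
  have Tvec: "(\<lambda>\<omega>. \<chi> i. T i n \<omega>) \<in> borel_measurable (M n)" if "1 \<le> n" for n
    by (intro borel_measurable_vec_lambda Tm that)
  have "converges_weakly \<mu> N"
  proof (rule converges_weaklyI_char)
    show "\<forall>\<^sub>F n in sequentially. prob_space (\<mu> n) \<and> sets (\<mu> n) = sets borel"
      using eventually_ge_at_top[of 1]
      by eventually_elim (auto simp: \<mu>_def intro!: prob_space.prob_space_distr prob Tvec)
    show "prob_space N" "sets N = sets borel"
      using N by (auto simp: centred_gaussian_vector_def gaussian_vector_def)
    fix u :: "real ^ 'k"
    let ?h = "\<lambda>n x. \<Sum>i\<in>UNIV. u $ i * angular_fluct p (q $ i) n x"
    have V_sum_rv: "rv_seq M (\<lambda>n \<omega>. ?h n (X n \<omega>))"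
      using V_rv unfolding V_def by (intro rv_seq_sum rv_seq_mult rv_seq_const[OF V_rv]) simp_all
    have law: "distr (M n) borel (\<lambda>\<omega>. ?h n (X n \<omega>)) = distr (gen_normal_seq p) borel (?h n)" if n: "1 \<le> n" for n
      by (rule p_radial_law[OF p n prob[OF n] radial[OF n]])
        (use n p q in \<open>auto simp: angular_fluct_scale_n intro!: borel_measurable_sum borel_measurable_times
            angular_fluct_measurable\<close>)
    have "rv_seq (iid p) ?h"
      by (intro rv_seq_sum rv_seq_mult rv_seq_const[OF angular_fluct_rv_seq] angular_fluct_rv_seq p) simp_all
    from integral_iexp_law[OF law V_sum_rv this angular_fluct_char[OF p q]]
    have V_lim: "(\<lambda>n. \<integral>\<omega>. iexp (?h n (X n \<omega>)) \<partial>M n) \<longlonglongrightarrow> (\<integral>x. iexp (u \<bullet> x) \<partial>N)"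
      by (simp add: N_char)
    have "vanishing M (\<lambda>n \<omega>. \<Sum>i\<in>UNIV. u $ i * (T i n \<omega> - V i n \<omega>))"
      by (intro vanishing_sum vanishing_cmult diff) simp_all
    then have "vanishing M (\<lambda>n \<omega>. (\<Sum>i\<in>UNIV. u $ i * T i n \<omega>) - ?h n (X n \<omega>))"
      by (simp add: V_def right_diff_distrib sum_subtractf)
    from integral_iexp_tendsto_perturb[OF this V_sum_rv V_lim]
    show "(\<lambda>n. \<integral>x. iexp (u \<bullet> x) \<partial>\<mu> n) \<longlonglongrightarrow> (\<integral>x. iexp (u \<bullet> x) \<partial>N)"
    proof (rule Lim_transform_eventually)
      show "\<forall>\<^sub>F n in sequentially. (\<integral>\<omega>. iexp (\<Sum>i\<in>UNIV. u $ i * T i n \<omega>) \<partial>M n) = (\<integral>x. iexp (u \<bullet> x) \<partial>\<mu> n)"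
        using eventually_ge_at_top[of 1] unfolding \<mu>_def
        by eventually_elim (subst integral_distr[OF Tvec], auto simp: inner_vec_def)
    qed
  next
    fix e :: real assume "0 < e"
    let ?S = "\<lambda>n \<omega>. \<Sum>i\<in>UNIV. \<bar>T i n \<omega>\<bar>"
    have S: "stoch_bounded M ?S" by (intro stoch_bounded_sum stoch_bounded_abs T_bounded) simp_all
    obtain K where K: "\<forall>\<^sub>F n in sequentially. tail (M n) (?S n) K < e"
      using stoch_boundedD[OF S \<open>0 < e\<close>] by blast
    have "\<forall>\<^sub>F n in sequentially. measure (\<mu> n) {x. norm x > K} < e"
      using K eventually_ge_at_top[of 1]
    proof eventually_elim
      case (elim n)
      have "measure (\<mu> n) {x. norm x > K} = tail (M n) (\<lambda>\<omega>. norm (\<chi> i. T i n \<omega>)) K"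
        unfolding \<mu>_def by (subst measure_distr[OF Tvec[OF elim(2)]]) (auto intro!: arg_cong2[where f = measure])
      also have "\<dots> \<le> tail (M n) (?S n) K"
        using Tm[OF elim(2)] norm_le_l1_cart[of "\<chi> i. T i n _"]
        by (intro tail_le prob elim borel_measurable_sum borel_measurable_abs) (force intro: order_trans)+
      finally show ?case using elim by simp
    qed
    then show "\<exists>K. \<forall>\<^sub>F n in sequentially. measure (\<mu> n) {x. norm x > K} < e" ..
  qed
  with N show ?thesis unfolding \<mu>_def[abs_def] T_def by blast
qed

section \<open>The maximal coordinate and the Gumbel law\<close>

text \<open>The derivative of \<open>- t\<^bsup>1-r\<^esup> exp (- t\<^sup>r/r)\<close> is \<open>(1 + (r - 1) t\<^bsup>-r\<^esup>) exp (- t\<^sup>r/r)\<close>, and for \<open>t \<ge> x\<close> the first factor lies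
between 1 and its value at \<open>x\<close>.\<close>

lemma exp_powr_tail_bounds:
  fixes r x :: real
  assumes r: "1 \<le> r" and x: "0 < x"
  obtains I where "has_bochner_integral lborel (\<lambda>t. indicator {x..} t * exp (- (t powr r / r))) I"
    "x powr (1 - r) * exp (- (x powr r / r)) / (1 + (r - 1) * x powr (- r)) \<le> I"
    "I \<le> x powr (1 - r) * exp (- (x powr r / r))"
proof -
  define e where "e t = exp (- (t powr r / r))" for t :: real
  define F where "F t = t powr (1 - r) * e t" for t
  define f where "f t = (1 + (r - 1) * t powr (- r)) * e t" for t
  have [measurable]: "e \<in> borel_measurable borel" "f \<in> borel_measurable borel"
    unfolding e_def[abs_def] f_def[abs_def] by measurable
  have deriv: "DERIV (\<lambda>t. - F t) t :> f t" if "x \<le> t" for t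
  proof -
    have t: "0 < t" using that x by simp
    have "DERIV (\<lambda>t. - F t) t :> - ((1 - r) * t powr (1 - r - 1) * e t + t powr (1 - r) * (e t * - (r * t powr (r - 1) / r)))"
      unfolding F_def e_def using t r by (auto intro!: derivative_eq_intros)
    also have "- ((1 - r) * t powr (1 - r - 1) * e t + t powr (1 - r) * (e t * - (r * t powr (r - 1) / r))) =
        ((r - 1) * t powr (- r) + t powr (1 - r) * t powr (r - 1)) * e t"
      using r by (simp add: algebra_simps)
    also have "t powr (1 - r) * t powr (r - 1) = 1" using t by (simp add: powr_add[symmetric])
    finally show ?thesis by (simp add: f_def add.commute)
  qed
  have nonneg: "0 \<le> f t" for t using r by (simp add: f_def e_def)
  have "(F \<longlongrightarrow> 0) at_top"
  proof (cases "r = 1")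
    case True
    have "((\<lambda>t::real. exp (- t)) \<longlongrightarrow> 0) at_top" by real_asymp
    moreover have "\<forall>\<^sub>F t in at_top. exp (- t) = F t"
      using eventually_gt_at_top[of "0::real"] by eventually_elim (simp add: F_def e_def True)
    ultimately show ?thesis by (rule Lim_transform_eventually)
  next
    case False
    then have "1 < r" using r by simp
    then show ?thesis unfolding F_def e_def by real_asymp
  qed
  then have lim: "((\<lambda>t. - F t) \<longlongrightarrow> 0) at_top" by (auto intro: tendsto_eq_intros)
  have FI: "(\<integral>\<^sup>+t. ennreal (f t) * indicator {x..} t \<partial>lborel) = ennreal (F x)"
    using nn_integral_FTC_atLeast[OF _ deriv nonneg lim] by simp
  define I where "I = enn2real (\<integral>\<^sup>+t. ennreal (e t) * indicator {x..} t \<partial>lborel)"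
  have F0: "0 \<le> F x" by (simp add: F_def e_def)
  have "(\<integral>\<^sup>+t. ennreal (e t) * indicator {x..} t \<partial>lborel) \<le> (\<integral>\<^sup>+t. ennreal (f t) * indicator {x..} t \<partial>lborel)"
  proof (intro nn_integral_mono mult_right_mono ennreal_leI)
    fix t
    show "e t \<le> f t" using r mult_right_mono[of 1 "1 + (r - 1) * t powr (- r)" "e t"] by (simp add: f_def e_def)
  qed simp
  then have le: "(\<integral>\<^sup>+t. ennreal (e t) * indicator {x..} t \<partial>lborel) \<le> ennreal (F x)" by (simp add: FI)
  then have eI: "(\<integral>\<^sup>+t. ennreal (e t) * indicator {x..} t \<partial>lborel) = ennreal I"
    unfolding I_def by (intro ennreal_enn2real[symmetric]) (auto simp: less_top[symmetric] top_unique)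
  have I0: "0 \<le> I" by (simp add: I_def)
  have "I \<le> F x" using le F0 unfolding eI by simp
  moreover have "F x / (1 + (r - 1) * x powr (- r)) \<le> I"
  proof -
    have "ennreal (F x) \<le> (\<integral>\<^sup>+t. ennreal (1 + (r - 1) * x powr (- r)) * (ennreal (e t) * indicator {x..} t) \<partial>lborel)"
      unfolding FI[symmetric]
    proof (intro nn_integral_mono)
      fix t
      have "f t \<le> (1 + (r - 1) * x powr (- r)) * e t" if "x \<le> t"
        unfolding f_def using that x r powr_mono2'[of "- r" x t]
        by (intro mult_right_mono add_left_mono mult_left_mono) (auto simp: e_def)
      then have "ennreal (f t) \<le> ennreal (1 + (r - 1) * x powr (- r)) * ennreal (e t)" if "x \<le> t"
        using that r by (subst ennreal_mult[symmetric]) (auto simp: e_def intro!: ennreal_leI)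
      then show "ennreal (f t) * indicator {x..} t \<le> ennreal (1 + (r - 1) * x powr (- r)) * (ennreal (e t) * indicator {x..} t)"
        by (auto split: split_indicator)
    qed
    also have "\<dots> = ennreal ((1 + (r - 1) * x powr (- r)) * I)"
      using r I0 by (subst nn_integral_cmult) (auto simp: eI ennreal_mult)
    finally have "F x \<le> (1 + (r - 1) * x powr (- r)) * I"
      using r I0 by (subst (asm) ennreal_le_iff) auto
    moreover have "0 < 1 + (r - 1) * x powr (- r)" using r by (intro add_pos_nonneg) auto
    ultimately show ?thesis by (simp add: divide_le_eq mult.commute)
  qed
  moreover have "has_bochner_integral lborel (\<lambda>t. indicator {x..} t * e t) I"
    using eI I0 by (intro has_bochner_integral_nn_integral)
      (auto simp: e_def mult.commute[of "indicator _ _"] ennreal_mult' ennreal_indicator)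
  ultimately show thesis using that[of I] unfolding F_def e_def by auto
qed

lemma gen_normal_cdf_bounds:
  assumes p: "1 \<le> p" "p \<noteq> \<infinity>" and x: "0 < x"
  defines "r \<equiv> real_of_ereal p"
  defines "c \<equiv> r powr (1 / r) * Gamma (1 + 1 / r)"
  defines "F \<equiv> x powr (1 - r) * exp (- (x powr r / r)) / c"
  shows "F / (1 + (r - 1) * x powr (- r)) \<le> 1 - measure (gen_normal p) {-x..x}"
    and "1 - measure (gen_normal p) {-x..x} \<le> F"
proof -
  interpret prob_space "gen_normal p" by (rule prob_space_gen_normal[OF p(1)])
  have r: "1 \<le> r" using real_of_ereal_ge_1[OF p] by (simp add: r_def)
  have c: "0 < c" unfolding c_def using r by (intro mult_pos_pos Gamma_real_pos add_pos_nonneg) auto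
  obtain I where I: "has_bochner_integral lborel (\<lambda>t. indicator {x..} t * exp (- (t powr r / r))) I"
    "x powr (1 - r) * exp (- (x powr r / r)) / (1 + (r - 1) * x powr (- r)) \<le> I"
    "I \<le> x powr (1 - r) * exp (- (x powr r / r))"
    using exp_powr_tail_bounds[OF r x] by blast
  define f where "f t = indicator (- {-x<..<x}) t * gen_normal_density p t" for t
  have "has_bochner_integral lborel (\<lambda>t. (indicator {x..} t * exp (- (t powr r / r))) / (2 * c)) (I / (2 * c))"
    by (rule has_bochner_integral_divide_zero[OF I(1)])
  also have "(\<lambda>t. (indicator {x..} t * exp (- (t powr r / r))) / (2 * c)) = (\<lambda>t. indicator {0..} t *\<^sub>R f t)"
    using p x by (auto simp: fun_eq_iff f_def gen_normal_density_def Let_def r_def[symmetric] c_def[symmetric] split: split_indicator)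
  finally have "has_bochner_integral lborel f (2 *\<^sub>R (I / (2 * c)))"
    by (rule has_bochner_integral_even_function)
      (auto simp: f_def gen_normal_density_def split: split_indicator)
  then have f: "has_bochner_integral lborel f (I / c)" by simp
  have f0: "0 \<le> f t" for t by (simp add: f_def gen_normal_density_nonneg[OF p(1)])
  have "emeasure (gen_normal p) (- {-x<..<x}) = (\<integral>\<^sup>+t. ennreal (f t) \<partial>lborel)"
    unfolding gen_normal_def f_def
    by (subst emeasure_density)
      (auto simp: ennreal_mult' ennreal_indicator mult.commute intro!: nn_integral_cong split: split_indicator)
  also have "\<dots> = ennreal (I / c)"
    using f f0 by (subst nn_integral_eq_integral) (auto simp: has_bochner_integral_iff)
  finally have "measure (gen_normal p) (- {-x<..<x}) = I / c"
    using c I(2) r f f0 by (simp add: measure_def has_bochner_integral_iff)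
      (metis Bochner_Integration.integral_nonneg enn2real_ennreal)
  moreover have "measure (gen_normal p) (- {-x<..<x}) = 1 - measure (gen_normal p) {-x<..<x}"
    using prob_compl[of "{-x<..<x}"] by (simp add: Compl_eq_Diff_UNIV)
  moreover have "measure (gen_normal p) {-x<..<x} = measure (gen_normal p) {-x..x}"
  proof -
    have "AE t in lborel. t \<noteq> x \<and> t \<noteq> - x"
      using AE_lborel_singleton[of x] AE_lborel_singleton[of "- x"] by eventually_elim simp
    then have "AE t in gen_normal p. t \<noteq> x \<and> t \<noteq> - x"
      unfolding gen_normal_def by (subst AE_density) (auto elim: eventually_mono)
    then show ?thesis
      by (intro finite_measure_eq_AE) (auto elim: eventually_mono)
  qed
  ultimately have "1 - measure (gen_normal p) {-x..x} = I / c" by simp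
  moreover have "F / (1 + (r - 1) * x powr (- r)) =
      (x powr (1 - r) * exp (- (x powr r / r)) / (1 + (r - 1) * x powr (- r))) / c"
    by (simp add: F_def)
  moreover have "(x powr (1 - r) * exp (- (x powr r / r)) / (1 + (r - 1) * x powr (- r))) / c \<le> I / c"
    using I(2) c by (intro divide_right_mono) auto
  ultimately show "F / (1 + (r - 1) * x powr (- r)) \<le> 1 - measure (gen_normal p) {-x..x}"
    by (simp only:)
  show "1 - measure (gen_normal p) {-x..x} \<le> F"
    unfolding \<open>1 - measure (gen_normal p) {-x..x} = I / c\<close> F_def
    using I(3) c by (intro divide_right_mono) auto
qed

lemma power_one_minus_tendsto_exp:
  fixes a :: "nat \<Rightarrow> real"
  assumes a: "(\<lambda>n. n * a n) \<longlonglongrightarrow> l" and pos: "\<forall>\<^sub>F n in sequentially. 0 < a n"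
  shows "(\<lambda>n. (1 - a n) ^ n) \<longlonglongrightarrow> exp (- l)"
proof -
  have "(\<lambda>n. (n * a n) * (1 / n)) \<longlonglongrightarrow> l * 0"
    by (intro tendsto_mult a) real_asymp
  moreover have "\<forall>\<^sub>F n in sequentially. (n * a n) * (1 / n) = a n"
    using eventually_gt_at_top[of 0] by eventually_elim simp
  ultimately have a0: "a \<longlonglongrightarrow> 0"
    by (auto intro: Lim_transform_eventually)
  have "filterlim a (at_right 0) sequentially"
    using a0 pos by (simp add: filterlim_at) (auto elim: eventually_mono)
  moreover have "((\<lambda>x::real. ln (1 - x) / x) \<longlongrightarrow> -1) (at_right 0)" by real_asymp
  ultimately have "(\<lambda>n. ln (1 - a n) / a n) \<longlonglongrightarrow> -1" by (rule filterlim_compose[rotated])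
  then have "(\<lambda>n. exp ((n * a n) * (ln (1 - a n) / a n))) \<longlonglongrightarrow> exp (l * -1)"
    by (intro tendsto_intros a)
  moreover have "\<forall>\<^sub>F n in sequentially. exp ((n * a n) * (ln (1 - a n) / a n)) = (1 - a n) ^ n"
    using pos order_tendstoD(2)[OF a0, of 1, simplified]
    by eventually_elim (simp add: exp_of_nat_mult)
  ultimately show ?thesis by (auto intro: Lim_transform_eventually)
qed

text \<open>Here \<open>L = r log n\<close>, so that \<open>exp (L / r) = n\<close>. For \<open>x = L\<^bsup>1/r\<^esup> (1 + w)\<close> one has \<open>x\<^sup>r / r = (L / r) (1 + w)\<^sup>r\<close>, which is
\<open>L / r + L w\<close> up to an error of the order \<open>L w\<^sup>2\<close>. This error tends to 0, since \<open>w\<close> is of the order \<open>log L / L\<close>. The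
choice of \<open>w\<close> makes all other terms of the exponent cancel in the limit, except for \<open>- t\<close>.\<close>

lemma extreme_level_limit:
  fixes r t d :: real
  assumes r: "1 \<le> r"
  defines "w \<equiv> \<lambda>L. (t + (1 - r) / r * ln L - d) / L"
  defines "x \<equiv> \<lambda>L. L powr (1 / r) * (1 + w L)"
  shows "((\<lambda>L. exp (L / r) * (x L powr (1 - r) * exp (- (x L powr r / r)) / exp d)) \<longlongrightarrow> exp (- t)) at_top"
    and "filterlim x at_top at_top"
proof -
  have w: "(w \<longlongrightarrow> 0) at_top" unfolding w_def by real_asymp
  have w2: "((\<lambda>L. L * (w L)\<^sup>2) \<longlongrightarrow> 0) at_top"
  proof -
    have "((\<lambda>L::real. 1 / sqrt L) \<longlongrightarrow> 0) at_top" "((\<lambda>L::real. ln L / sqrt L) \<longlongrightarrow> 0) at_top"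
      by real_asymp+
    then have "((\<lambda>L. ((t - d) * (1 / sqrt L) + (1 - r) / r * (ln L / sqrt L))\<^sup>2) \<longlongrightarrow>
        ((t - d) * 0 + (1 - r) / r * 0)\<^sup>2) at_top"
      by (intro tendsto_intros)
    moreover have "\<forall>\<^sub>F L in at_top. ((t - d) * (1 / sqrt L) + (1 - r) / r * (ln L / sqrt L))\<^sup>2 = L * (w L)\<^sup>2"
      using eventually_gt_at_top[of 0]
    proof eventually_elim
      case (elim L)
      have "(t - d) * (1 / sqrt L) + (1 - r) / r * (ln L / sqrt L) = (t + (1 - r) / r * ln L - d) / sqrt L"
        by (simp add: add_divide_distrib diff_divide_distrib)
      then show ?case using elim by (simp add: w_def power_divide) (simp add: power2_eq_square)
    qed
    ultimately have "((\<lambda>L. L * (w L)\<^sup>2) \<longlongrightarrow> ((t - d) * 0 + (1 - r) / r * 0)\<^sup>2) at_top"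
      by (rule Lim_transform_eventually)
    then show ?thesis by simp
  qed
  \<comment> \<open>the error of the linear approximation of \<open>(1 + u)\<^sup>r\<close>, divided by \<open>u\<^sup>2\<close>\<close>
  define \<rho> where "\<rho> u = (if u = 0 then r * (r - 1) / 2 else ((1 + u) powr r - 1 - r * u) / u\<^sup>2)" for u
  have "(\<rho> \<longlongrightarrow> r * (r - 1) / 2) (at 0)"
  proof -
    have "((\<lambda>u. ((1 + u) powr r - 1 - r * u) / u\<^sup>2) \<longlongrightarrow> r * (r - 1) / 2) (at 0)"
      using r by real_asymp
    moreover have "\<forall>\<^sub>F u in at 0. ((1 + u) powr r - 1 - r * u) / u\<^sup>2 = \<rho> u"
      by (auto simp: eventually_at_filter \<rho>_def)
    ultimately show ?thesis by (rule Lim_transform_eventually)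
  qed
  then have "isCont \<rho> 0" by (simp add: isCont_def \<rho>_def)
  from isCont_tendsto_compose[OF this w] have \<rho>: "((\<lambda>L. \<rho> (w L)) \<longlongrightarrow> \<rho> 0) at_top" .
  have "((\<lambda>L. exp (- t + (1 - r) * ln (1 + w L) - 1 / r * (L * (w L)\<^sup>2 * \<rho> (w L)))) \<longlongrightarrow>
      exp (- t + (1 - r) * ln (1 + 0) - 1 / r * (0 * \<rho> 0))) at_top"
    by (intro tendsto_intros w w2 \<rho>) auto
  moreover have "\<forall>\<^sub>F L in at_top. \<bar>w L\<bar> < 1"
    using tendstoD[OF w, of 1] by (simp add: dist_real_def)
  then have "\<forall>\<^sub>F L in at_top. exp (- t + (1 - r) * ln (1 + w L) - 1 / r * (L * (w L)\<^sup>2 * \<rho> (w L))) =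
      exp (L / r) * (x L powr (1 - r) * exp (- (x L powr r / r)) / exp d)"
    using eventually_gt_at_top[of 0]
  proof eventually_elim
    case (elim L)
    have pos: "0 < 1 + w L" using elim by auto
    have "(w L)\<^sup>2 * \<rho> (w L) = (1 + w L) powr r - 1 - r * w L"
      by (simp add: \<rho>_def)
    then have 1: "L * (w L)\<^sup>2 * \<rho> (w L) = L * ((1 + w L) powr r - 1 - r * w L)"
      by (simp add: mult.assoc)
    have 2: "x L powr r = L * (1 + w L) powr r"
      using elim pos r by (simp add: x_def powr_mult powr_powr)
    have 3: "x L powr (1 - r) = exp ((1 - r) / r * ln L + (1 - r) * ln (1 + w L))"
    proof -
      have "x L powr (1 - r) = exp ((1 - r) * ln (x L))"
        using elim pos by (simp add: powr_def x_def)
      also have "ln (x L) = 1 / r * ln L + ln (1 + w L)"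
        using elim pos by (simp add: x_def ln_mult ln_powr)
      finally show ?thesis by (simp add: algebra_simps)
    qed
    have 4: "L * w L = t + (1 - r) / r * ln L - d" using elim by (simp add: w_def)
    have "- t + (1 - r) * ln (1 + w L) - 1 / r * (L * (w L)\<^sup>2 * \<rho> (w L)) =
        L / r + ((1 - r) / r * ln L + (1 - r) * ln (1 + w L)) + - (x L powr r / r) - d"
    proof -
      have "1 / r * (L * (w L)\<^sup>2 * \<rho> (w L)) = x L powr r / r - L / r - L * w L"
        unfolding 1 2 using r by (simp add: field_simps)
      then show ?thesis unfolding 4 by simp
    qed
    also have "\<dots> = L / r + (((1 - r) / r * ln L + (1 - r) * ln (1 + w L)) + - (x L powr r / r) - d)"
      by simp
    finally show ?case unfolding 3 by (simp only: mult_exp_exp exp_diff[symmetric])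
  qed
  ultimately have "((\<lambda>L. exp (L / r) * (x L powr (1 - r) * exp (- (x L powr r / r)) / exp d)) \<longlongrightarrow>
      exp (- t + (1 - r) * ln (1 + 0) - 1 / r * (0 * \<rho> 0))) at_top"
    by (rule Lim_transform_eventually)
  then show "((\<lambda>L. exp (L / r) * (x L powr (1 - r) * exp (- (x L powr r / r)) / exp d)) \<longlongrightarrow> exp (- t)) at_top"
    by simp
  have "filterlim (\<lambda>L. L powr (1 / r)) at_top at_top" using r by real_asymp
  moreover have "((\<lambda>L. 1 + w L) \<longlongrightarrow> 1 + 0) at_top" by (intro tendsto_intros w)
  ultimately show "filterlim x at_top at_top"
    unfolding x_def by (intro filterlim_at_top_mult_tendsto_pos[where c = 1]) (auto simp: mult.commute)
qed

lemma gumbel_limits: "((\<lambda>t::real. exp (- exp (- t))) \<longlongrightarrow> 0) at_bot" "((\<lambda>t::real. exp (- exp (- t))) \<longlongrightarrow> 1) at_top"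
proof -
  interpret real_distribution gumbel by (rule real_distribution_gumbel)
  show "((\<lambda>t::real. exp (- exp (- t))) \<longlongrightarrow> 0) at_bot" "((\<lambda>t::real. exp (- exp (- t))) \<longlongrightarrow> 1) at_top"
    using cdf_lim_at_bot cdf_lim_at_top_prob by (simp_all add: cdf_gumbel)
qed

text \<open>The normalized maximum of the direction \<open>x / \<parallel>x\<parallel>\<^sub>p\<close>, rescaled by \<open>n\<^bsup>1/p\<^esup>\<close> as \<open>\<parallel>Z\<parallel>\<^sub>p\<close> is close to \<open>n\<^bsup>1/p\<^esup>\<close> for
independent coordinates.\<close>

definition direction_max :: "ereal \<Rightarrow> nat \<Rightarrow> (nat \<Rightarrow> real) \<Rightarrow> real"
  where "direction_max p n x =
    real n powr recip p / (real_of_ereal p * ln n) powr (recip p - 1) * (lp_norm n \<infinity> x / lp_norm n p x)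
    - gumbel_centring (real_of_ereal p) n"

lemma direction_max_measurable: "1 \<le> n \<Longrightarrow> direction_max p n \<in> borel_measurable (lborel_n n)"
  unfolding direction_max_def[abs_def]
  by (intro borel_measurable_times borel_measurable_diff borel_measurable_divide borel_measurable_const
      lp_norm_measurable_lborel_n)

lemma direction_max_rv_seq: "1 \<le> p \<Longrightarrow> rv_seq (iid p) (direction_max p)"
  unfolding direction_max_def[abs_def] using lp_norm_measurable_gen_normal_seq
  by (intro rv_seq_gen_normal_seqI) auto

context
  fixes p :: ereal and r :: real
  assumes p: "1 \<le> p" "p \<noteq> \<infinity>"
  defines "r \<equiv> real_of_ereal p"
begin

lemma direction_max_eq:
  "direction_max p n x = real n powr recip p / (r * ln n) powr (recip p - 1) * (lp_norm n \<infinity> x / lp_norm n p x)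
    - gumbel_centring r n"
  by (simp add: direction_max_def r_def)

lemma r_ge_1: "1 \<le> r"
  using real_of_ereal_ge_1[OF p] by (simp add: r_def)

lemma recip_p: "recip p = 1 / r"
  using p by (cases p) (auto simp: recip_def r_def one_ereal_def)

text \<open>All coordinates are at most \<open>x\<^sub>n\<close> in absolute value with probability \<open>(1 - a\<^sub>n)\<^sup>n\<close>, where \<open>n a\<^sub>n\<close> tends to
\<open>exp (- t)\<close> by the tail bounds.\<close>

lemma gen_normal_max_gumbel:
  "(\<lambda>n. measure (gen_normal_seq p) {z \<in> space (gen_normal_seq p).
      lp_norm n \<infinity> z / (r * ln n) powr (recip p - 1) - gumbel_centring r n \<le> t}) \<longlonglongrightarrow> exp (- exp (- t))"
proof -
  note r = r_ge_1
  define c where "c = r powr (1 / r) * Gamma (1 + 1 / r)"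
  have c: "0 < c" unfolding c_def using r by (intro mult_pos_pos Gamma_real_pos add_pos_nonneg) auto
  define L where "L n = r * ln (real n)" for n :: nat
  define w where "w y = (t + (1 - r) / r * ln y - ln c) / y" for y
  define x where "x y = y powr (1 / r) * (1 + w y)" for y
  define F where "F n = x (L n) powr (1 - r) * exp (- (x (L n) powr r / r)) / c" for n
  define a where "a n = 1 - measure (gen_normal p) {- x (L n)..x (L n)}" for n
  have L_top: "filterlim L at_top sequentially"
    unfolding L_def using r by real_asymp
  have L_pos: "\<forall>\<^sub>F n in sequentially. 0 < L n"
    using L_top by (simp add: filterlim_at_top_dense)
  note lim = extreme_level_limit[OF r, where t = t and d = "ln c", folded w_def, folded x_def]
  have x_top: "filterlim (\<lambda>n. x (L n)) at_top sequentially"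
    using filterlim_compose[OF lim(2) L_top] .
  have x_pos: "\<forall>\<^sub>F n in sequentially. 0 < x (L n)"
    using x_top by (simp add: filterlim_at_top_dense)
  have nF: "(\<lambda>n. n * F n) \<longlonglongrightarrow> exp (- t)"
  proof (rule Lim_transform_eventually)
    show "(\<lambda>n. exp (L n / r) * (x (L n) powr (1 - r) * exp (- (x (L n) powr r / r)) / exp (ln c))) \<longlonglongrightarrow> exp (- t)"
      using filterlim_compose[OF lim(1) L_top] .
    show "\<forall>\<^sub>F n in sequentially. exp (L n / r) * (x (L n) powr (1 - r) * exp (- (x (L n) powr r / r)) / exp (ln c)) = n * F n"
      using eventually_gt_at_top[of 0]
      by eventually_elim (use r c in \<open>simp add: L_def F_def\<close>)
  qed
  have "((\<lambda>y. y powr (- r)) \<longlongrightarrow> 0) at_top" using r by real_asymp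
  from filterlim_compose[OF this x_top]
  have "(\<lambda>n. n * F n / (1 + (r - 1) * x (L n) powr (- r))) \<longlonglongrightarrow> exp (- t) / (1 + (r - 1) * 0)"
    by (intro tendsto_intros nF) auto
  then have lower: "(\<lambda>n. n * F n / (1 + (r - 1) * x (L n) powr (- r))) \<longlonglongrightarrow> exp (- t)" by simp
  have bounds: "\<forall>\<^sub>F n in sequentially. 0 < a n \<and> n * F n / (1 + (r - 1) * x (L n) powr (- r)) \<le> n * a n \<and> n * a n \<le> n * F n"
    using x_pos
  proof eventually_elim
    case (elim n)
    note b = gen_normal_cdf_bounds[OF p elim, folded r_def, folded c_def, folded F_def a_def]
    have "0 < 1 + (r - 1) * x (L n) powr (- r)" using r by (intro add_pos_nonneg) auto
    then have "0 < F n / (1 + (r - 1) * x (L n) powr (- r))"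
      using c elim by (auto simp: F_def)
    then show ?case
      using b mult_left_mono[OF b(1), of "real n"] mult_left_mono[OF b(2), of "real n"] by simp
  qed
  have "(\<lambda>n. n * a n) \<longlonglongrightarrow> exp (- t)"
  proof (rule tendsto_sandwich[OF _ _ lower nF])
    show "\<forall>\<^sub>F n in sequentially. n * F n / (1 + (r - 1) * x (L n) powr (- r)) \<le> n * a n"
      "\<forall>\<^sub>F n in sequentially. n * a n \<le> n * F n"
      using bounds by (auto elim: eventually_mono)
  qed
  moreover have "\<forall>\<^sub>F n in sequentially. 0 < a n" using bounds by (auto elim: eventually_mono)
  ultimately have "(\<lambda>n. (1 - a n) ^ n) \<longlonglongrightarrow> exp (- exp (- t))"
    by (rule power_one_minus_tendsto_exp)
  moreover have "\<forall>\<^sub>F n in sequentially. (1 - a n) ^ n = measure (gen_normal_seq p) {z \<in> space (gen_normal_seq p).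
      lp_norm n \<infinity> z / (r * ln n) powr (recip p - 1) - gumbel_centring r n \<le> t}"
    using L_pos eventually_ge_at_top[of 1]
  proof eventually_elim
    case (elim n)
    define B where "B = L n powr (1 / r - 1)"
    have B: "0 < B" using elim by (simp add: B_def)
    have "L n * (1 + w (L n)) = gumbel_centring r n + t"
      using elim by (simp add: w_def gumbel_centring_def L_def[symmetric] c_def[symmetric] distrib_left)
    moreover have "L n powr (1 / r) = B * L n"
      using elim by (simp add: B_def powr_diff)
    ultimately have "x (L n) = B * (gumbel_centring r n + t)"
      by (simp add: x_def mult.assoc)
    then have "lp_norm n \<infinity> z / B - gumbel_centring r n \<le> t \<longleftrightarrow> lp_norm n \<infinity> z \<le> x (L n)" for z
      using B by (simp add: field_simps)
    then show ?case
      using sup_norm_cdf[OF p(1) elim(2), of "x (L n)"]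
      by (simp add: a_def recip_p L_def[symmetric] B_def[symmetric])
  qed
  ultimately show ?thesis by (rule Lim_transform_eventually)
qed

lemma gumbel_centring_negligible: "(\<lambda>n. gumbel_centring r n / sqrt n) \<longlonglongrightarrow> 0"
proof -
  have r: "0 < r" using r_ge_1 by simp
  define d where "d = ln (r powr (1 / r) * Gamma (1 + 1 / r))"
  have "(\<lambda>n. r * (ln (real n) / sqrt n) + (1 - r) / r * (ln (r * ln (real n)) / sqrt n) - d * (1 / sqrt n))
      \<longlonglongrightarrow> r * 0 + (1 - r) / r * 0 - d * 0"
    by (intro tendsto_intros; use r in real_asymp)
  also have "(\<lambda>n. r * (ln (real n) / sqrt n) + (1 - r) / r * (ln (r * ln (real n)) / sqrt n) - d * (1 / sqrt n)) =
      (\<lambda>n. gumbel_centring r n / sqrt n)"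
    by (simp add: fun_eq_iff gumbel_centring_def d_def add_divide_distrib diff_divide_distrib)
  finally show ?thesis by simp
qed

text \<open>If \<open>\<parallel>Z\<parallel>\<^sub>p = n\<^bsup>1/p\<^esup> (1 + D/\<surd>n)\<close>, then dividing by the second factor changes \<open>G + A\<close>, the sum of the normalized maximum and
the centring, by at most the order \<open>A/\<surd>n\<close>, which tends to 0.\<close>

lemma direction_max_gumbel:
  "(\<lambda>n. measure (gen_normal_seq p) {z \<in> space (gen_normal_seq p). direction_max p n z \<le> t}) \<longlonglongrightarrow> exp (- exp (- t))"
proof -
  define A where "A = gumbel_centring r"
  define D where "D = norm_fluct p 1"
  define G where "G n z = lp_norm n \<infinity> z / (r * ln n) powr (recip p - 1) - A n" for n and z :: "nat \<Rightarrow> real"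
  define h where "h n z = 1 / (1 + D n z / sqrt n) - 1" for n :: nat and z
  have G_rv: "rv_seq (iid p) G"
    unfolding G_def using lp_norm_measurable_gen_normal_seq[OF p(1)] by (intro rv_seq_gen_normal_seqI[OF p(1)]) auto
  have G_lim: "(\<lambda>n. measure (iid p n) {z \<in> space (iid p n). G n z \<le> t}) \<longlonglongrightarrow> exp (- exp (- t))" for t
    unfolding G_def A_def by (rule gen_normal_max_gumbel)
  have G_bounded: "stoch_bounded (iid p) G"
    by (rule cdf_tendsto_imp_stoch_bounded[OF G_rv G_lim gumbel_limits])
  have D_bounded: "stoch_bounded (iid p) D" unfolding D_def by (rule norm_fluct_radius_bounded[OF p(1)])
  note D_rv = stoch_bounded_rv_seq[OF D_bounded]
  have h: "vanishing (iid p) h" unfolding h_def D_def by (rule inverse_radius_vanishing[OF p(1)])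
  have A: "(\<lambda>n. A n / sqrt n) \<longlonglongrightarrow> 0" unfolding A_def by (rule gumbel_centring_negligible)
  have "vanishing (iid p) (\<lambda>n z. direction_max p n z - G n z)"
  proof (rule vanishing_cong_on)
    show "vanishing (iid p) (\<lambda>n z. G n z * h n z - (1 + h n z) * (D n z * (A n / sqrt n)))"
      by (intro vanishing_diff vanishing_mult G_bounded h stoch_bounded_add stoch_bounded_const[OF D_rv]
          vanishing_stoch_bounded[OF h] D_bounded vanishing_seq[OF D_rv A])
    show "vanishing (iid p) (\<lambda>n z. D n z / sqrt n)" by (rule vanishing_div_sqrt[OF D_bounded])
    show "rv_seq (iid p) (\<lambda>n z. direction_max p n z - G n z)"
      by (rule rv_seq_diff[OF direction_max_rv_seq[OF p(1)] G_rv])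
    fix n :: nat and z assume n: "1 \<le> n" and small: "\<bar>D n z / sqrt n\<bar> \<le> 1 / 2"
    define U where "U = 1 + D n z / sqrt n"
    note U = inverse_radius_eq[OF p(1) n small[unfolded D_def], folded D_def, folded U_def]
    define m where "m = lp_norm n \<infinity> z / (r * ln n) powr (recip p - 1)"
    have "direction_max p n z = m * (real n powr recip p / lp_norm n p z) - A n"
      unfolding direction_max_eq m_def A_def by (simp add: mult_ac)
    then have 1: "direction_max p n z = m / U - A n" by (simp add: U(2))
    have 2: "G n z = m - A n" by (simp add: G_def m_def)
    have 3: "D n z * (A n / sqrt n) = (U - 1) * A n" by (simp add: U_def)
    show "direction_max p n z - G n z = G n z * h n z - (1 + h n z) * (D n z * (A n / sqrt n))"
      unfolding h_def U_def[symmetric] 1 2 3 using U(1) by (simp add: field_simps)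
  qed
  from cdf_tendsto_perturb[OF this G_rv G_lim] show ?thesis by simp
qed

text \<open>The radius \<open>R\<close> of a uniform point changes \<open>H + A\<close>, the sum of the normalized maximum of the direction and the centring,
by \<open>(H + A) (R - 1)\<close>, where \<open>\<surd>n (R - 1)\<close> vanishes.\<close>

theorem uniform_max_gumbel:
  fixes M :: "nat \<Rightarrow> 'a measure"
  assumes prob: "\<And>n. 1 \<le> n \<Longrightarrow> prob_space (M n)"
    and X: "\<And>n. 1 \<le> n \<Longrightarrow> X n \<in> measurable (M n) (lborel_n n)"
      "\<And>n. 1 \<le> n \<Longrightarrow> distr (M n) (lborel_n n) (X n) = unif_lp_ball n p"
  shows "weak_conv_m
    (\<lambda>n. distr (M n) borel (\<lambda>\<omega>. real n powr recip p / (r * ln (real n)) powr (recip p - 1) *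
        lp_norm n \<infinity> (X n \<omega>) - gumbel_centring r n)) gumbel"
proof -
  have norm_m: "(\<lambda>\<omega>. lp_norm n s (X n \<omega>)) \<in> borel_measurable (M n)" if "1 \<le> n" for n s
    by (rule measurable_compose[OF X(1)[OF that] lp_norm_measurable_lborel_n[OF that]])
  define A where "A = gumbel_centring r"
  define H where "H n \<omega> = direction_max p n (X n \<omega>)" for n \<omega>
  define E where "E n \<omega> = sqrt n * (lp_norm n p (X n \<omega>) - 1)" for n \<omega>
  define T where "T n \<omega> = real n powr recip p / (r * ln (real n)) powr (recip p - 1) * lp_norm n \<infinity> (X n \<omega>) - A n" for n \<omega>
  have Tm: "T n \<in> borel_measurable (M n)" if "1 \<le> n" for n
    unfolding T_def using norm_m[OF that] by measurable
  have T_rv: "rv_seq M T" by (rule rv_seqI[OF prob Tm])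
  have H_rv: "rv_seq M H"
    unfolding H_def by (intro rv_seqI prob measurable_compose[OF X(1) direction_max_measurable])
  have law: "distr (M n) borel (H n) = distr (gen_normal_seq p) borel (direction_max p n)" if n: "1 \<le> n" for n
    unfolding H_def
    by (rule p_radial_law[OF p(1) n prob[OF n] uniform_continuous_p_radial[OF n X(1)[OF n] X(2)[OF n]]
          direction_max_measurable[OF n]])
      (use n p(1) in \<open>simp_all add: direction_max_def lp_norm_scale_n\<close>)
  have H_lim: "(\<lambda>n. measure (M n) {\<omega> \<in> space (M n). H n \<omega> \<le> t}) \<longlonglongrightarrow> exp (- exp (- t))" for t
    by (rule cdf_law[OF law H_rv direction_max_rv_seq[OF p(1)] direction_max_gumbel])
  have H_bounded: "stoch_bounded M H"
    by (rule cdf_tendsto_imp_stoch_bounded[OF H_rv H_lim gumbel_limits])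
  have E: "vanishing M E"
    unfolding E_def
    by (rule power_cdf_fluctuation[OF prob norm_m uniform_lp_norm_cdf[OF _ p(1) prob X]])
  have "(\<lambda>n. A n / sqrt n) \<longlonglongrightarrow> 0" unfolding A_def by (rule gumbel_centring_negligible)
  note A = vanishing_seq[OF T_rv this]
  have W: "vanishing M (\<lambda>n \<omega>. E n \<omega> / sqrt n)"
    by (intro vanishing_div_sqrt vanishing_stoch_bounded E)
  have "vanishing M (\<lambda>n \<omega>. T n \<omega> - H n \<omega>)"
  proof (rule vanishing_cong_on[OF _ W])
    show "vanishing M (\<lambda>n \<omega>. H n \<omega> * (E n \<omega> / sqrt n) + E n \<omega> * (A n / sqrt n))"
      by (intro vanishing_add vanishing_mult[OF H_bounded W] vanishing_mult[OF vanishing_stoch_bounded[OF E] A])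
    show "rv_seq M (\<lambda>n \<omega>. T n \<omega> - H n \<omega>)" by (rule rv_seq_diff[OF T_rv H_rv])
    fix n :: nat and \<omega> assume n: "1 \<le> n" and small: "\<bar>E n \<omega> / sqrt n\<bar> \<le> 1 / 2"
    define R where "R = lp_norm n p (X n \<omega>)"
    have sn: "0 < sqrt n" using n by simp
    have "\<bar>R - 1\<bar> \<le> 1 / 2" using small sn by (simp add: E_def R_def)
    then have R: "0 < R" by linarith
    define m where "m = real n powr recip p / (r * ln (real n)) powr (recip p - 1) * (lp_norm n \<infinity> (X n \<omega>) / R)"
    have 1: "H n \<omega> = m - A n" by (simp add: H_def direction_max_eq m_def R_def A_def)
    have 2: "T n \<omega> = m * R - A n" using R by (simp add: T_def m_def)
    have 3: "E n \<omega> / sqrt n = R - 1" "E n \<omega> * (A n / sqrt n) = (R - 1) * A n"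
      using sn by (simp_all add: E_def R_def)
    show "T n \<omega> - H n \<omega> = H n \<omega> * (E n \<omega> / sqrt n) + E n \<omega> * (A n / sqrt n)"
      unfolding 1 2 3 by (simp add: algebra_simps)
  qed
  from cdf_tendsto_perturb[OF this H_rv H_lim]
  have "(\<lambda>n. measure (M n) {\<omega> \<in> space (M n). T n \<omega> \<le> t}) \<longlonglongrightarrow> exp (- exp (- t))" for t by simp
  then have "(\<lambda>n. cdf (distr (M n) borel (T n)) t) \<longlonglongrightarrow> cdf gumbel t" for t
    unfolding cdf_gumbel
  proof (rule Lim_transform_eventually)
    show "\<forall>\<^sub>F n in sequentially. measure (M n) {\<omega> \<in> space (M n). T n \<omega> \<le> t} = cdf (distr (M n) borel (T n)) t"
      using eventually_ge_at_top[of 1]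
      by eventually_elim
        (simp add: cdf_def measure_distr[OF Tm], auto intro!: arg_cong2[where f = measure])
  qed
  then show ?thesis
    by (simp add: weak_conv_m_def weak_conv_def T_def[abs_def] A_def)
qed

end

section \<open>Limit theorems for \<open>q\<close>-norms\<close>

theorem theorem4p4:
  fixes p :: ereal
    and q :: "real ^ 'k"
    and M :: "nat \<Rightarrow> 'a measure"
    and X :: "nat \<Rightarrow> 'a \<Rightarrow> nat \<Rightarrow> real"
  assumes p: "1 \<le> p"
    and prob: "\<And>n. 1 \<le> n \<Longrightarrow> prob_space (M n)"
  shows
    "((\<forall>n\<ge>1. continuous_p_radial n p (M n) (X n)) \<and>
      tends_to_zero_in_probability M (\<lambda>n \<omega>. sqrt (real n) * (1 - lp_norm n p (X n \<omega>))) \<and>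
      (\<forall>i. 1 \<le> q $ i \<and> ereal (q $ i) \<noteq> p)
      \<longrightarrow>
      (\<exists>N. centred_gaussian_vector N (clt_cov p q) \<and>
        converges_weakly
          (\<lambda>n. distr (M n) borel (\<lambda>\<omega>. \<chi> i. sqrt (real n) *
            (real n powr (recip p - 1 / q $ i) *
              (lp_norm n (ereal (q $ i)) (X n \<omega>) / m_const p (q $ i)) - 1)))
          N))
     \<and>
     (p < \<infinity> \<and>
      (\<forall>n\<ge>1. X n \<in> measurable (M n) (lborel_n n) \<and>
        distr (M n) (lborel_n n) (X n) = unif_lp_ball n p)
      \<longrightarrow>
      weak_conv_m
        (\<lambda>n. distr (M n) borel (\<lambda>\<omega>.
          real n powr recip p / (real_of_ereal p * ln (real n)) powr (recip p - 1) *
            lp_norm n \<infinity> (X n \<omega>) - gumbel_centring (real_of_ereal p) n))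
        gumbel)"
proof (intro conjI impI)
  assume "(\<forall>n\<ge>1. continuous_p_radial n p (M n) (X n)) \<and>
    tends_to_zero_in_probability M (\<lambda>n \<omega>. sqrt (real n) * (1 - lp_norm n p (X n \<omega>))) \<and>
    (\<forall>i. 1 \<le> q $ i \<and> ereal (q $ i) \<noteq> p)"
  then show "\<exists>N. centred_gaussian_vector N (clt_cov p q) \<and>
      converges_weakly
        (\<lambda>n. distr (M n) borel (\<lambda>\<omega>. \<chi> i. sqrt (real n) *
          (real n powr (recip p - 1 / q $ i) *
            (lp_norm n (ereal (q $ i)) (X n \<omega>) / m_const p (q $ i)) - 1)))
        N"
    by (intro p_radial_clt[OF p _ prob]) auto
next
  assume "p < \<infinity> \<and> (\<forall>n\<ge>1. X n \<in> measurable (M n) (lborel_n n) \<and>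
    distr (M n) (lborel_n n) (X n) = unif_lp_ball n p)"
  then show "weak_conv_m
      (\<lambda>n. distr (M n) borel (\<lambda>\<omega>.
        real n powr recip p / (real_of_ereal p * ln (real n)) powr (recip p - 1) *
          lp_norm n \<infinity> (X n \<omega>) - gumbel_centring (real_of_ereal p) n))
      gumbel"
    by (intro uniform_max_gumbel[OF p _ prob]) auto
qed

end
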